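(* Let $\alpha\in(0,2)$, let $q,r>\frac{n+\alpha}{n-\alpha}$, and set $$\sigma_1=(n-\alpha)q-(n+\alpha),\qquad \sigma_2=(n-\alpha)r-(n+\alpha).$$ Let $(u,v)\in\left(L_\alpha\cap C^{1,1}_{loc}(\mathbb{R}^n)\right)^2$ be a positive solution of the system $$(-\Delta)^{\alpha/2}u(x)=|x|^{\sigma_1}v(x)^q,\quad (-\Delta)^{\alpha/2}v(x)=|x|^{\sigma_2}u(x)^r,\quad u(x)>0,\ v(x)>0,\qquad x\in\mathbb{R}^n.$$ If $$\lim_{|x|\to\infty}|x|^{n-\alpha}u(x)=+\infty\quad\text{and}\quad\lim_{|x|\to\infty}|x|^{n-\alpha}v(x)=+\infty,$$ then $u(x)$ and $v(x)$ are radially symmetric about the origin.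
   Context: Here $n$ is the dimension of the space $\mathbb{R}^n$. For $\alpha\in(0,2)$, the fractional Laplacian is $$(-\Delta)^{\alpha/2}u(x)=C_{n,\alpha}\lim_{\epsilon\to0}\int_{\mathbb{R}^n\setminus B_\epsilon(x)}\frac{u(x)-u(y)}{|x-y|^{n+\alpha}}\,dy,$$ where $C_{n,\alpha}>0$ is a normalization constant and $B_\epsilon(x)$ is the ball of radius $\epsilon$ centered at $x$. $L_\alpha$ is the set of functions $u:\mathbb{R}^n\to\mathbb{R}$ with $\int_{\mathbb{R}^n}\frac{|u(x)|}{1+|x|^{n+\alpha}}dx<+\infty$. $C^{1,1}_{loc}(\mathbb{R}^n)$ is the set of $C^1$ functions with locally Lipschitz gradient. For $u\in L_\alpha\cap C^{1,1}_{loc}(\mathbb{R}^n)$ the expression defining $(-\Delta)^{\alpha/2}u(x)$ is well defined, and the equations are understood pointwise. *)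

theory Defs
  imports "HOL-Analysis.Analysis"
begin

definition L_space :: "real \<Rightarrow> (real ^ 'n \<Rightarrow> real) set" where
  "L_space \<alpha> = {u. u \<in> borel_measurable lebesgue \<and>
     integrable lebesgue (\<lambda>x. \<bar>u x\<bar> / (1 + norm x powr (real CARD('n) + \<alpha>)))}"

text \<open>Continuity of the gradient \<open>g\<close> is implied by its local Lipschitz continuity.\<close>

definition C11_loc :: "(real ^ 'n \<Rightarrow> real) set" where
  "C11_loc = {u. \<exists>g :: real ^ 'n \<Rightarrow> real ^ 'n. (\<forall>x. GDERIV u x :> g x) \<and>
     (\<forall>x. \<exists>\<delta>>0. \<exists>K. K-lipschitz_on (ball x \<delta>) g)}"

text \<open>The normalization constant is the parameter \<open>C\<close>. The limit exists whenever
  \<open>0 < \<alpha> < 2\<close> and \<open>u \<in> L_space \<alpha> \<inter> C11_loc\<close>; outside this class the total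
  operators \<open>Lim\<close> and \<open>LINT\<close> may return unspecified or default values.\<close>

definition frac_laplacian :: "real \<Rightarrow> real \<Rightarrow> (real ^ 'n \<Rightarrow> real) \<Rightarrow> real ^ 'n \<Rightarrow> real" where
  "frac_laplacian C \<alpha> u x = C * Lim (at_right 0)
     (\<lambda>\<epsilon>. LINT y:(UNIV - ball x \<epsilon>)|lebesgue.
        (u x - u y) / norm (x - y) powr (real CARD('n) + \<alpha>))"

definition radially_symmetric :: "(real ^ 'n \<Rightarrow> real) \<Rightarrow> bool" where
  "radially_symmetric u \<longleftrightarrow> (\<forall>x y. norm x = norm y \<longrightarrow> u x = u y)"

end

theory Submission
  imports Defs
begin

text \<open>
  If \<open>\<alpha> \<ge> n\<close>, the blow-up condition forces \<open>u\<close> itself to tend to infinity, so \<open>u\<close> attains its minimum;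
  there \<open>u(x) - u(y) \<le> 0\<close> for all \<open>y\<close>, the fractional Laplacian is strictly negative, and the equation
  is contradicted (\<open>no_blowup_solution\<close>).

  If \<open>\<alpha> < n\<close>, the exponents \<open>\<sigma>\<^sub>1\<close> and \<open>\<sigma>\<^sub>2\<close> are exactly those for which the Kelvin transforms
  \<open>U(x) = |x|\<^bsup>\<alpha>-n\<^esup> u(x/|x|\<^sup>2)\<close> and \<open>V(x) = |x|\<^bsup>\<alpha>-n\<^esup> v(x/|x|\<^sup>2)\<close> solve the system without weights,
  \<open>(-\<Delta>)\<^bsup>\<alpha>/2\<^esup>U = V\<^sup>q\<close> and \<open>(-\<Delta>)\<^bsup>\<alpha>/2\<^esup>V = U\<^sup>r\<close>, away from the origin (\<open>kelvin_pv\<close>, \<open>kelvin_equation\<close>). The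
  continuity of \<open>u, v\<close> at \<open>0\<close> becomes decay of order \<open>|x|\<^bsup>\<alpha>-n\<^esup>\<close> at infinity, and the hypothesis on
  \<open>|x|\<^bsup>n-\<alpha>\<^esup>u\<close> becomes \<open>U, V \<rightarrow> \<infinity>\<close> at the origin. Radial symmetry of \<open>U, V\<close> is then shown by moving planes.

  For a unit vector \<open>e\<close> and \<open>\<mu> < 0\<close>, write \<open>w(x) = U(x') - U(x)\<close> on \<open>{x. x \<bullet> e < \<mu>}\<close>, where \<open>x'\<close> is the mirror
  image of \<open>x\<close> in \<open>{x. x \<bullet> e = \<mu>}\<close>. The function \<open>w\<close> is odd under the reflection, tends to \<open>+\<infinity>\<close> at the
  mirror image of the origin and lies above any given negative level near infinity, so a negative infimum is attained.
  Folding the singular integral at such a minimum gives \<open>(-\<Delta>)\<^bsup>\<alpha>/2\<^esup>w(x) \<le> c w(x) d\<^bsup>-\<alpha>\<^esup>\<close> with \<open>d\<close> the distance to the plane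
  (\<open>antisymmetric_negative_minimum\<close>). Together with the equations this couples the minimum \<open>x\<close> for \<open>U\<close> with
  the minimum \<open>y\<close> for \<open>V\<close> by \<open>1 \<le> K \<cdot> d(x)\<^sup>\<alpha>V(x)\<^bsup>q-1\<^esup> \<cdot> d(y)\<^sup>\<alpha>U(y)\<^bsup>r-1\<^esup>\<close> (\<open>minima_estimate\<close>).
  The exponents \<open>q, r\<close> make \<open>|x|\<^sup>\<alpha>V\<^bsup>q-1\<^esup>\<close> and \<open>|x|\<^sup>\<alpha>U\<^bsup>r-1\<^esup>\<close> vanish at infinity, and \<open>d(x) \<le> |x|\<close>. Hence negative
  minima cannot occur for \<open>\<mu>\<close> near \<open>-\<infinity>\<close>; and along planes converging to a first critical position they stay
  bounded and away from the plane, so that a subsequence has a limit, where \<open>w \<le> 0\<close>. This contradicts the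
  strong maximum principle (\<open>antisymmetric_zero_minimum\<close>, \<open>gap_positive\<close>). So the plane reaches the origin from
  every direction (\<open>mirror_dominates_always\<close>), and \<open>U, V\<close> are invariant under all reflections through \<open>0\<close>.
\<close>

section \<open>Change of variables for conformal involutions\<close>

text \<open>The change of variables theorem \<open>has_absolute_integral_change_of_variables\<close> concerns Euclidean spaces
  whose index type is well-ordered. A copy of a finite type carries a well-order pulled back from the natural
  numbers, and renaming coordinates is a measure-preserving isometry; so the theorem reaches every finite index
  type, in a form that mentions no order.\<close>

typedef 'a wcopy = "UNIV :: 'a set"
  by blast

instance wcopy :: (finite) finite
proof
  have "finite (range (Rep_wcopy :: 'a wcopy \<Rightarrow> 'a))"
    by simp
  then show "finite (UNIV :: 'a wcopy set)"
    by (rule finite_imageD) (simp add: inj_on_def Rep_wcopy_inject)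
qed

definition wcopy_index :: "'a::finite wcopy \<Rightarrow> nat" where
  "wcopy_index = (SOME f. inj f)"

lemma inj_wcopy_index: "inj (wcopy_index :: 'a::finite wcopy \<Rightarrow> nat)"
  unfolding wcopy_index_def
proof (rule someI_ex[where P = inj])
  obtain f :: "'a wcopy \<Rightarrow> nat" and n where "f ` UNIV = {i. i < n}" "inj f"
    using finite_imp_inj_to_nat_seg[of "UNIV :: 'a wcopy set"] by auto
  then show "\<exists>f :: 'a wcopy \<Rightarrow> nat. inj f"
    by (intro exI)
qed

instantiation wcopy :: (finite) wellorder
begin

definition less_eq_wcopy :: "'a wcopy \<Rightarrow> 'a wcopy \<Rightarrow> bool" where
  "less_eq_wcopy x y \<longleftrightarrow> wcopy_index x \<le> wcopy_index y"

definition less_wcopy :: "'a wcopy \<Rightarrow> 'a wcopy \<Rightarrow> bool" where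
  "less_wcopy x y \<longleftrightarrow> wcopy_index x < wcopy_index y"

instance
proof
  fix x y :: "'a wcopy"
  assume "x \<le> y" "y \<le> x"
  then show "x = y"
    using inj_wcopy_index by (auto simp: less_eq_wcopy_def inj_def)
next
  fix P :: "'a wcopy \<Rightarrow> bool" and a :: "'a wcopy"
  assume step: "\<And>x. (\<And>y. y < x \<Longrightarrow> P y) \<Longrightarrow> P x"
  show "P a"
    by (induction a rule: measure_induct_rule[where f = wcopy_index])
      (auto simp: less_wcopy_def intro: step)
qed (auto simp: less_eq_wcopy_def less_wcopy_def)

end

definition reindex :: "('m \<Rightarrow> 'n) \<Rightarrow> real ^ 'n \<Rightarrow> real ^ 'm" where
  "reindex \<sigma> x = (\<chi> i. x $ \<sigma> i)"

lemma linear_reindex: "linear (reindex \<sigma>)"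
  by (rule linearI) (simp_all add: reindex_def vec_eq_iff)

lemma norm_reindex:
  fixes \<sigma> :: "'m::finite \<Rightarrow> 'n::finite"
  assumes "bij \<sigma>"
  shows "norm (reindex \<sigma> x) = norm x"
proof -
  have "(\<Sum>i\<in>UNIV. (x $ \<sigma> i)\<^sup>2) = (\<Sum>i\<in>UNIV. (x $ i)\<^sup>2)"
    using sum.reindex_bij_betw[OF assms, of "\<lambda>i. (x $ i)\<^sup>2"] by simp
  then show ?thesis
    by (simp add: reindex_def norm_vec_def L2_set_def)
qed

lemma reindex_inv:
  assumes "bij \<sigma>"
  shows "reindex \<sigma> (reindex (inv \<sigma>) x) = x" "reindex (inv \<sigma>) (reindex \<sigma> y) = y"
  using assms by (auto simp: reindex_def vec_eq_iff bij_is_inj bij_is_surj surj_f_inv_f)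

lemma lebesgue_distr_reindex:
  fixes \<sigma> :: "'m::finite \<Rightarrow> 'n::finite"
  assumes "bij \<sigma>"
  shows "reindex \<sigma> \<in> lebesgue \<rightarrow>\<^sub>M lebesgue" "distr lebesgue lebesgue (reindex \<sigma>) = lebesgue"
proof -
  let ?J = "reindex \<sigma> :: real ^ 'n \<Rightarrow> real ^ 'm" and ?K = "reindex (inv \<sigma>) :: real ^ 'm \<Rightarrow> real ^ 'n"
  have meas: "?J \<in> borel_measurable borel"
    by (intro borel_measurable_continuous_onI linear_continuous_on)
      (simp add: linear_conv_bounded_linear[symmetric] linear_reindex)
  have prod_cart: "(\<Prod>b\<in>Basis. (u - l) \<bullet> b) = (\<Prod>i\<in>UNIV. u $ i - l $ i)" for l u :: "real ^ 'k::finite"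
  proof -
    have Basis: "(Basis :: (real ^ 'k) set) = (\<lambda>i. axis i 1) ` UNIV"
      by (auto simp: Basis_vec_def)
    have "inj (\<lambda>i::'k. axis i (1::real))"
      by (auto simp: inj_def axis_eq_axis)
    then show ?thesis
      unfolding Basis by (subst prod.reindex) (simp_all add: inner_axis)
  qed
  have eq: "lborel = distr lborel borel ?J"
  proof (rule lborel_eqI)
    fix l u :: "real ^ 'm" assume le: "\<And>b. b \<in> Basis \<Longrightarrow> l \<bullet> b \<le> u \<bullet> b"
    have le': "l $ i \<le> u $ i" for i
      using le[of "axis i 1"] by (simp add: inner_axis axis_in_Basis_iff)
    have vim: "?J -` box l u = box (?K l) (?K u)"
    proof (intro set_eqI iffI)
      fix x assume "x \<in> ?J -` box l u"
      then have *: "l $ i < x $ \<sigma> i \<and> x $ \<sigma> i < u $ i" for i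
        by (auto simp: mem_box_cart reindex_def)
      show "x \<in> box (?K l) (?K u)"
        unfolding mem_box_cart reindex_def
        using *[of "inv \<sigma> j" for j] assms by (simp add: bij_is_surj surj_f_inv_f)
    next
      fix x assume "x \<in> box (?K l) (?K u)"
      then have *: "l $ inv \<sigma> j < x $ j \<and> x $ j < u $ inv \<sigma> j" for j
        by (auto simp: mem_box_cart reindex_def)
      show "x \<in> ?J -` box l u"
        unfolding vimage_eq mem_box_cart reindex_def
        using *[of "\<sigma> j" for j] assms by (simp add: bij_is_inj)
    qed
    have "emeasure (distr lborel borel ?J) (box l u) = emeasure lborel (box (?K l) (?K u))"
      using meas vim by (subst emeasure_distr) auto
    also have "\<dots> = (\<Prod>b\<in>Basis. (?K u - ?K l) \<bullet> b)"
      using le' by (subst emeasure_lborel_box_eq) (auto simp: Basis_vec_def inner_axis reindex_def)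
    also have "(\<Prod>b\<in>Basis. (?K u - ?K l) \<bullet> b) = (\<Prod>i\<in>UNIV. u $ inv \<sigma> i - l $ inv \<sigma> i)"
      by (simp only: prod_cart) (simp add: reindex_def)
    also have "\<dots> = (\<Prod>i\<in>UNIV. u $ i - l $ i)"
      using prod.reindex_bij_betw[OF bij_imp_bij_inv[OF assms], of "\<lambda>i. u $ i - l $ i"] by simp
    also have "\<dots> = (\<Prod>b\<in>Basis. (u - l) \<bullet> b)"
      by (simp only: prod_cart)
    finally show "emeasure (distr lborel borel ?J) (box l u) = (\<Prod>b\<in>Basis. (u - l) \<bullet> b)" .
  qed simp
  have "distr lborel lborel ?J = distr lborel borel ?J"
    by (rule distr_cong) auto
  then have eq': "distr lborel lborel ?J = lborel"
    using eq by simp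
  have meas': "?J \<in> lborel \<rightarrow>\<^sub>M lborel"
    using meas by simp
  have eq'': "distr lebesgue lborel ?J = lborel"
    using meas' eq' by (subst distr_completion) simp_all
  have null: "null_sets (distr lebesgue lborel ?J) = null_sets lborel"
    unfolding eq'' ..
  show "?J \<in> lebesgue \<rightarrow>\<^sub>M lebesgue"
    using meas' by (simp add: completion.measurable_completion2 measurable_completion null)
  show "distr lebesgue lebesgue ?J = lebesgue"
    using completion.completion_distr_eq[OF measurable_completion[OF meas'] null] eq'' by simp
qed

lemma integrable_reindex_iff:
  fixes \<sigma> :: "'m::finite \<Rightarrow> 'n::finite" and f :: "real ^ 'm \<Rightarrow> real"
  assumes "bij \<sigma>"
  shows "integrable lebesgue (\<lambda>x. f (reindex \<sigma> x)) \<longleftrightarrow> integrable lebesgue f"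
    and "(LINT x|lebesgue. f (reindex \<sigma> x)) = (LINT x|lebesgue. f x)"
proof -
  have dir: "integrable lebesgue (\<lambda>x. g (reindex \<tau> x)) \<and>
      (LINT x|lebesgue. g (reindex \<tau> x)) = (LINT x|lebesgue. g x)"
    if "integrable lebesgue g" "bij \<tau>"
    for \<tau> :: "'k::finite \<Rightarrow> 'l::finite" and g :: "real ^ 'k \<Rightarrow> real"
  proof -
    have m: "g \<in> borel_measurable lebesgue"
      using that(1) by auto
    have "integrable (distr lebesgue lebesgue (reindex \<tau>)) g"
      using that by (simp add: lebesgue_distr_reindex)
    then have "integrable lebesgue (\<lambda>x. g (reindex \<tau> x))"
      by (subst (asm) integrable_distr_eq) (use m lebesgue_distr_reindex[OF that(2)] in auto)
    moreover have "(LINT x|distr lebesgue lebesgue (reindex \<tau>). g x) = (LINT x|lebesgue. g (reindex \<tau> x))"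
      by (subst integral_distr) (use m lebesgue_distr_reindex[OF that(2)] in auto)
    ultimately show ?thesis
      using lebesgue_distr_reindex(2)[OF that(2)] by simp
  qed
  have rev: "integrable lebesgue f" if "integrable lebesgue (\<lambda>x. f (reindex \<sigma> x))"
    using dir[OF that bij_imp_bij_inv[OF assms]] by (simp add: reindex_inv[OF assms])
  show eqv: "integrable lebesgue (\<lambda>x. f (reindex \<sigma> x)) \<longleftrightarrow> integrable lebesgue f"
    using rev dir[OF _ assms] by blast
  show "(LINT x|lebesgue. f (reindex \<sigma> x)) = (LINT x|lebesgue. f x)"
    using dir[OF _ assms, of f] eqv by (cases "integrable lebesgue f") (auto simp: not_integrable_integral_eq)
qed

text \<open>After division by \<open>j\<close> the map is orthogonal.\<close>

lemma abs_det_conformal: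
  fixes L :: "real ^ 'm \<Rightarrow> real ^ 'm"
  assumes "linear L" "\<And>h. norm (L h) = j * norm h" "j > 0"
  shows "\<bar>det (matrix L)\<bar> = j ^ CARD('m)"
proof -
  define M where "M = (\<lambda>h. (1 / j) *\<^sub>R L h)"
  have lin: "linear M"
    unfolding M_def using assms(1) by (intro linear_compose_scale_right)
  have "orthogonal_transformation M"
    unfolding orthogonal_transformation using assms lin by (simp add: M_def)
  then have "\<bar>det (matrix M)\<bar> = 1"
    by simp
  moreover have "matrix L = (\<chi> i. j *s matrix M $ i)"
    using assms(3) by (simp add: M_def matrix_def vec_eq_iff)
  ultimately show ?thesis
    using assms(3) det_rows_mul[of "\<lambda>_. j" "\<lambda>i. matrix M $ i"] by (simp add: abs_mult power_abs)
qed

lemma conformal_involution_wo: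
  fixes T :: "real ^ 'm::{finite,wellorder} \<Rightarrow> real ^ 'm::_" and f :: "real ^ 'm::_ \<Rightarrow> real"
  assumes S: "S \<in> sets lebesgue"
    and inv: "\<And>x. x \<in> S \<Longrightarrow> T x \<in> S" "\<And>x. x \<in> S \<Longrightarrow> T (T x) = x"
    and der: "\<And>x. x \<in> S \<Longrightarrow> (T has_derivative T' x) (at x)"
    and conf: "\<And>x h. x \<in> S \<Longrightarrow> norm (T' x h) = j x * norm h" "\<And>x. x \<in> S \<Longrightarrow> j x > 0"
  shows "set_integrable lebesgue S (\<lambda>x. j x ^ CARD('m) * f (T x)) \<longleftrightarrow> set_integrable lebesgue S f"
    and "(LINT x:S|lebesgue. j x ^ CARD('m) * f (T x)) = (LINT x:S|lebesgue. f x)"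
proof -
  have TS: "T ` S = S"
    using inv by force
  have inj: "inj_on T S"
    using inv(2) by (metis inj_onI)
  let ?D = "\<lambda>x. j x ^ CARD('m) * f (T x)"
  have det: "\<bar>det (matrix (T' x))\<bar> = j x ^ CARD('m)" if "x \<in> S" for x
    using der[OF that] conf that by (intro abs_det_conformal) (auto simp: has_derivative_linear)
  have key: "?D absolutely_integrable_on S \<and> integral S ?D = b
      \<longleftrightarrow> f absolutely_integrable_on S \<and> integral S f = b" for b
  proof -
    have "(\<lambda>x. \<bar>det (matrix (T' x))\<bar> *\<^sub>R (vec (f (T x)) :: real ^ 1)) absolutely_integrable_on S \<and>
           integral S (\<lambda>x. \<bar>det (matrix (T' x))\<bar> *\<^sub>R (vec (f (T x)) :: real ^ 1)) = (vec b :: real ^ 1)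
         \<longleftrightarrow> (\<lambda>x. vec (f x) :: real ^ 1) absolutely_integrable_on (T ` S) \<and>
           integral (T ` S) (\<lambda>x. vec (f x)) = (vec b :: real ^ 1)"
      by (rule has_absolute_integral_change_of_variables[OF S has_derivative_at_withinI[OF der] inj])
    then have "(\<lambda>x. \<bar>det (matrix (T' x))\<bar> * f (T x)) absolutely_integrable_on S \<and>
           integral S (\<lambda>x. \<bar>det (matrix (T' x))\<bar> * f (T x)) = b
         \<longleftrightarrow> f absolutely_integrable_on S \<and> integral S f = b"
      unfolding TS by (simp add: absolutely_integrable_on_1_iff integral_on_1_eq)
    moreover have "(\<lambda>x. \<bar>det (matrix (T' x))\<bar> * f (T x)) absolutely_integrable_on S
        \<longleftrightarrow> ?D absolutely_integrable_on S"
      using det S by (intro set_integrable_cong) auto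
    moreover have "integral S (\<lambda>x. \<bar>det (matrix (T' x))\<bar> * f (T x)) = integral S ?D"
      using det by (intro Henstock_Kurzweil_Integration.integral_cong) auto
    ultimately show ?thesis
      by simp
  qed
  show eqv: "set_integrable lebesgue S ?D \<longleftrightarrow> set_integrable lebesgue S f"
    using key by blast
  show "(LINT x:S|lebesgue. ?D x) = (LINT x:S|lebesgue. f x)"
  proof (cases "set_integrable lebesgue S f")
    case True
    then have "integral S ?D = integral S f"
      using key by blast
    then show ?thesis
      using True eqv by (simp add: set_lebesgue_integral_eq_integral)
  next
    case False
    then show ?thesis
      using eqv unfolding set_integrable_def set_lebesgue_integral_def
      by (simp add: not_integrable_integral_eq)
  qed
qed

text \<open>Conformality replaces the determinant by a power of the dilation factor. The inversion, reflections in a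
  hyperplane and reflections in a point are all covered.\<close>

lemma conformal_involution:
  fixes T :: "real ^ 'n \<Rightarrow> real ^ 'n" and f :: "real ^ 'n \<Rightarrow> real"
  assumes S: "open S"
    and inv: "\<And>x. x \<in> S \<Longrightarrow> T x \<in> S" "\<And>x. x \<in> S \<Longrightarrow> T (T x) = x"
    and der: "\<And>x. x \<in> S \<Longrightarrow> (T has_derivative T' x) (at x)"
    and conf: "\<And>x h. x \<in> S \<Longrightarrow> norm (T' x h) = j x * norm h" "\<And>x. x \<in> S \<Longrightarrow> j x > 0"
  shows "set_integrable lebesgue S (\<lambda>x. j x ^ CARD('n) * f (T x)) \<longleftrightarrow> set_integrable lebesgue S f"
    and "(LINT x:S|lebesgue. j x ^ CARD('n) * f (T x)) = (LINT x:S|lebesgue. f x)"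
proof -
  define \<sigma> :: "'n wcopy \<Rightarrow> 'n" where "\<sigma> = Rep_wcopy"
  have bij: "bij \<sigma>"
    unfolding \<sigma>_def by (metis Abs_wcopy_inverse Rep_wcopy_inverse UNIV_I bijI')
  define J :: "real ^ 'n \<Rightarrow> real ^ 'n wcopy" where "J = reindex \<sigma>"
  define K :: "real ^ 'n wcopy \<Rightarrow> real ^ 'n" where "K = reindex (inv \<sigma>)"
  have card: "CARD('n wcopy) = CARD('n)"
    using bij_betw_same_card[OF bij] .
  have JK [simp]: "J (K y) = y" "K (J x) = x" for x y
    unfolding J_def K_def by (auto simp: reindex_inv[OF bij])
  have lin: "bounded_linear J" "bounded_linear K"
    unfolding J_def K_def by (simp_all add: linear_conv_bounded_linear[symmetric] linear_reindex)
  have nrm: "norm (J x) = norm x" "norm (K y) = norm y" for x y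
    unfolding J_def K_def by (simp_all add: norm_reindex bij bij_imp_bij_inv)
  let ?T = "\<lambda>y. J (T (K y))"
  let ?S = "K -` S"
  have S': "open ?S"
    using lin(2) S by (intro open_vimage) (auto intro: linear_continuous_on)
  then have S'': "?S \<in> sets lebesgue"
    by auto
  have der': "(?T has_derivative (\<lambda>h. J (T' (K y) (K h)))) (at y)" if "y \<in> ?S" for y
  proof -
    have "(K has_derivative K) (at y)"
      using bounded_linear_imp_has_derivative[OF lin(2)] .
    moreover have "(T has_derivative T' (K y)) (at (K y))"
      using der that by auto
    ultimately have "((\<lambda>y. T (K y)) has_derivative (\<lambda>h. T' (K y) (K h))) (at y)"
      by (rule has_derivative_compose)
    then show ?thesis
      by (rule bounded_linear.has_derivative[OF lin(1)])
  qed
  have set_iff: "set_integrable lebesgue ?S (\<lambda>y. g (K y)) \<longleftrightarrow> set_integrable lebesgue S g"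
    and set_eq: "(LINT y:?S|lebesgue. g (K y)) = (LINT x:S|lebesgue. g x)" for g :: "real ^ 'n \<Rightarrow> real"
    using integrable_reindex_iff[OF bij_imp_bij_inv[OF bij], of "\<lambda>x. indicator S x *\<^sub>R g x"]
    by (simp_all add: set_integrable_def set_lebesgue_integral_def K_def[symmetric] indicator_def)
  note wo = conformal_involution_wo[OF S'', of ?T "\<lambda>y h. J (T' (K y) (K h))" "\<lambda>y. j (K y)" "\<lambda>y. f (K y)"]
  have wo1: "set_integrable lebesgue ?S (\<lambda>y. j (K y) ^ CARD('n wcopy) * f (K (?T y)))
      \<longleftrightarrow> set_integrable lebesgue ?S (\<lambda>y. f (K y))"
    by (rule wo(1)) (use inv der' conf nrm in auto)
  have wo2: "(LINT y:?S|lebesgue. j (K y) ^ CARD('n wcopy) * f (K (?T y)))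
      = (LINT y:?S|lebesgue. f (K y))"
    by (rule wo(2)) (use inv der' conf nrm in auto)
  show "set_integrable lebesgue S (\<lambda>x. j x ^ CARD('n) * f (T x)) \<longleftrightarrow> set_integrable lebesgue S f"
    using wo1 set_iff[of f] set_iff[of "\<lambda>x. j x ^ CARD('n) * f (T x)"] by (simp add: card)
  show "(LINT x:S|lebesgue. j x ^ CARD('n) * f (T x)) = (LINT x:S|lebesgue. f x)"
    using wo2 set_eq[of f] set_eq[of "\<lambda>x. j x ^ CARD('n) * f (T x)"] by (simp add: card)
qed

section \<open>Inversion in a sphere\<close>

definition sph_inv :: "real \<Rightarrow> real ^ 'n \<Rightarrow> real ^ 'n" where
  "sph_inv \<rho> y = (\<rho>\<^sup>2 / (norm y)\<^sup>2) *\<^sub>R y"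

lemma norm_sph_inv:
  assumes "\<rho> > 0"
  shows "norm (sph_inv \<rho> y) = \<rho>\<^sup>2 / norm y"
  by (cases "y = 0") (auto simp: sph_inv_def power2_eq_square)

lemma sph_inv_sph_inv:
  assumes "\<rho> > 0"
  shows "sph_inv \<rho> (sph_inv \<rho> y) = y"
  using assms by (cases "y = 0") (auto simp: sph_inv_def power2_eq_square)

lemma norm_diff_sph_inv:
  assumes "\<rho> > 0" "x \<noteq> 0" "y \<noteq> 0"
  shows "norm (sph_inv \<rho> x - sph_inv \<rho> y) = \<rho>\<^sup>2 * norm (x - y) / (norm x * norm y)"
proof -
  have eq: "norm (a *\<^sub>R x - b *\<^sub>R y) ^ 2 = a\<^sup>2 * (norm x)\<^sup>2 - 2 * a * b * (x \<bullet> y) + b\<^sup>2 * (norm y)\<^sup>2" for a b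
    unfolding power2_norm_eq_inner
    by (simp add: inner_diff_left inner_diff_right inner_commute power2_eq_square algebra_simps)
  define X Y s where "X = norm x" "Y = norm y" "s = x \<bullet> y"
  have XY: "X \<noteq> 0" "Y \<noteq> 0"
    using assms by (auto simp: X_Y_s_def)
  have "(norm (sph_inv \<rho> x - sph_inv \<rho> y))\<^sup>2
      = (\<rho>\<^sup>2 / X\<^sup>2)\<^sup>2 * X\<^sup>2 - 2 * (\<rho>\<^sup>2 / X\<^sup>2) * (\<rho>\<^sup>2 / Y\<^sup>2) * s + (\<rho>\<^sup>2 / Y\<^sup>2)\<^sup>2 * Y\<^sup>2"
    unfolding sph_inv_def X_Y_s_def eq ..
  also have "\<dots> = (\<rho>\<^sup>2)\<^sup>2 * (X\<^sup>2 - 2 * s + Y\<^sup>2) / (X\<^sup>2 * Y\<^sup>2)"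
    using XY by (simp add: field_simps power2_eq_square)
  also have "X\<^sup>2 - 2 * s + Y\<^sup>2 = (norm (x - y))\<^sup>2"
    using eq[of 1 1] by (simp add: X_Y_s_def)
  finally have "(norm (sph_inv \<rho> x - sph_inv \<rho> y))\<^sup>2 = (\<rho>\<^sup>2 * norm (x - y) / (norm x * norm y))\<^sup>2"
    by (simp add: X_Y_s_def power_divide power_mult_distrib)
  then show ?thesis
    by (rule power2_eq_imp_eq) auto
qed

lemma sph_inv_has_derivative:
  fixes x :: "real ^ 'n"
  assumes "x \<noteq> 0"
  shows "(sph_inv \<rho> has_derivative
    (\<lambda>h. (\<rho>\<^sup>2 / (norm x)\<^sup>2) *\<^sub>R (h - (2 * (x \<bullet> h) / (norm x)\<^sup>2) *\<^sub>R x))) (at x)"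
proof -
  define X where "X = (norm x)\<^sup>2"
  have X: "X = x \<bullet> x" "X \<noteq> 0"
    using assms by (auto simp: X_def power2_norm_eq_inner)
  have sc: "((\<lambda>y. \<rho>\<^sup>2 / (y \<bullet> y)) has_derivative (\<lambda>h. - (\<rho>\<^sup>2 * (2 * (x \<bullet> h)) / X\<^sup>2))) (at x)"
  proof (rule has_derivative_eq_rhs)
    show "((\<lambda>y. \<rho>\<^sup>2 / (y \<bullet> y)) has_derivative
        (\<lambda>h. (0 * (x \<bullet> x) - \<rho>\<^sup>2 * (x \<bullet> h + h \<bullet> x)) / ((x \<bullet> x) * (x \<bullet> x)))) (at x)"
      by (rule has_derivative_divide' has_derivative_const has_derivative_inner has_derivative_ident | use assms in simp)+
  qed (simp add: X inner_commute power2_eq_square)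
  have "((\<lambda>y. (\<rho>\<^sup>2 / (y \<bullet> y)) *\<^sub>R y) has_derivative
      (\<lambda>h. (\<rho>\<^sup>2 / (x \<bullet> x)) *\<^sub>R h + (- (\<rho>\<^sup>2 * (2 * (x \<bullet> h)) / X\<^sup>2)) *\<^sub>R x)) (at x)"
    by (rule has_derivative_scaleR[OF sc has_derivative_ident])
  moreover have "(\<rho>\<^sup>2 / (x \<bullet> x)) *\<^sub>R h + (- (\<rho>\<^sup>2 * (2 * (x \<bullet> h)) / X\<^sup>2)) *\<^sub>R x
      = (\<rho>\<^sup>2 / X) *\<^sub>R (h - (2 * (x \<bullet> h) / X) *\<^sub>R x)" for h
    by (simp add: X(1) scaleR_diff_right power2_eq_square)
  moreover have "sph_inv \<rho> = (\<lambda>y :: real ^ 'n. (\<rho>\<^sup>2 / (y \<bullet> y)) *\<^sub>R y)"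
    by (simp add: sph_inv_def fun_eq_iff power2_norm_eq_inner)
  ultimately show ?thesis
    unfolding X_def[symmetric] by (simp only:)
qed

lemma sph_inv_derivative_conformal:
  assumes "x \<noteq> 0"
  shows "norm ((\<rho>\<^sup>2 / (norm x)\<^sup>2) *\<^sub>R (h - (2 * (x \<bullet> h) / (norm x)\<^sup>2) *\<^sub>R x)) = (\<rho> / norm x)\<^sup>2 * norm h"
proof -
  define c where "c = 2 * (x \<bullet> h) / (norm x)\<^sup>2"
  have c: "c * (norm x)\<^sup>2 = 2 * (x \<bullet> h)"
    using assms by (simp add: c_def)
  have "(norm (h - c *\<^sub>R x))\<^sup>2 = (norm h)\<^sup>2 - 2 * c * (x \<bullet> h) + c * (c * (norm x)\<^sup>2)"
    unfolding power2_norm_eq_inner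
    by (simp add: inner_diff_left inner_diff_right inner_commute algebra_simps)
  then have "(norm (h - c *\<^sub>R x))\<^sup>2 = (norm h)\<^sup>2"
    unfolding c by simp
  then have "norm (h - c *\<^sub>R x) = norm h"
    by simp
  then show ?thesis
    by (simp add: c_def power_divide)
qed

lemma AE_lebesgue_neq: "AE x in lebesgue. x \<noteq> (a :: 'a::euclidean_space)"
proof -
  have "{a} \<in> null_sets lebesgue"
    by (simp add: null_sets_completionI)
  then show ?thesis
    by (rule AE_I') auto
qed

lemma integrable_cong_AE_neq:
  fixes f g :: "'a::euclidean_space \<Rightarrow> real"
  assumes "\<And>x. x \<noteq> a \<Longrightarrow> f x = g x"
  shows "integrable lebesgue f \<longleftrightarrow> integrable lebesgue g"
    and "(LINT x|lebesgue. f x) = (LINT x|lebesgue. g x)"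
proof -
  have ae: "AE x in lebesgue. f x = g x"
    using AE_lebesgue_neq[of a] by eventually_elim (rule assms)
  have m: "f \<in> borel_measurable lebesgue" if g: "g \<in> borel_measurable lebesgue"
    and eq: "\<And>x. x \<noteq> a \<Longrightarrow> f x = g x" for f g :: "'a \<Rightarrow> real"
  proof -
    have "f = (\<lambda>x. if x = a then f a else g x)"
      using eq by (intro ext) (simp split: if_split)
    moreover have "(\<lambda>x. if x = a then f a else g x) \<in> borel_measurable lebesgue"
      using g by (intro measurable_If) auto
    ultimately show ?thesis
      by simp
  qed
  have m': "f \<in> borel_measurable lebesgue \<longleftrightarrow> g \<in> borel_measurable lebesgue"
    using m[of g f] m[of f g] assms by metis
  show eqv: "integrable lebesgue f \<longleftrightarrow> integrable lebesgue g"
    using integrable_cong_AE[of f lebesgue g] ae m' by (meson borel_measurable_integrable)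
  show "(LINT x|lebesgue. f x) = (LINT x|lebesgue. g x)"
  proof (cases "integrable lebesgue f")
    case True
    then show ?thesis
      using eqv ae by (intro integral_cong_AE) auto
  qed (use eqv in \<open>simp add: not_integrable_integral_eq\<close>)
qed

lemma inversion_integral:
  fixes f :: "real ^ 'n \<Rightarrow> real"
  assumes "\<rho> > 0"
  shows "integrable lebesgue (\<lambda>x. (\<rho> / norm x) powr (2 * real CARD('n)) * f (sph_inv \<rho> x)) \<longleftrightarrow> integrable lebesgue f"
    and "(LINT x|lebesgue. (\<rho> / norm x) powr (2 * real CARD('n)) * f (sph_inv \<rho> x)) = (LINT x|lebesgue. f x)"
proof -
  have op: "open (- {0} :: (real ^ 'n) set)"
    by auto
  have nz: "sph_inv \<rho> x \<noteq> 0" if "x \<noteq> 0" for x :: "real ^ 'n"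
    using that assms by (simp add: sph_inv_def)
  have powr_eq: "(\<rho> / norm x) powr (2 * real CARD('n)) = ((\<rho> / norm x)\<^sup>2) ^ CARD('n)"
    if "x \<noteq> 0" for x :: "real ^ 'n"
  proof -
    have "(\<rho> / norm x) powr (2 * real CARD('n)) = (\<rho> / norm x) powr real (2 * CARD('n))"
      by simp
    also have "\<dots> = (\<rho> / norm x) ^ (2 * CARD('n))"
      using that assms by (intro powr_realpow) auto
    finally show ?thesis
      by (simp add: power_mult)
  qed
  note cov = conformal_involution[OF op, of "sph_inv \<rho>" "\<lambda>x h. (\<rho>\<^sup>2 / (norm x)\<^sup>2) *\<^sub>R (h - (2 * (x \<bullet> h) / (norm x)\<^sup>2) *\<^sub>R x)"
      "\<lambda>x. (\<rho> / norm x)\<^sup>2" f, OF _ _ sph_inv_has_derivative sph_inv_derivative_conformal]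
  have 1: "set_integrable lebesgue (- {0}) (\<lambda>x. ((\<rho> / norm x)\<^sup>2) ^ CARD('n) * f (sph_inv \<rho> x))
      \<longleftrightarrow> set_integrable lebesgue (- {0}) f"
    by (rule cov(1)) (use assms nz in \<open>auto simp: sph_inv_sph_inv\<close>)
  have 2: "(LINT x:- {0}|lebesgue. ((\<rho> / norm x)\<^sup>2) ^ CARD('n) * f (sph_inv \<rho> x))
      = (LINT x:- {0}|lebesgue. f x)"
    by (rule cov(2)) (use assms nz in \<open>auto simp: sph_inv_sph_inv\<close>)
  note ae = integrable_cong_AE_neq[of 0]
  have f0: "integrable lebesgue f \<longleftrightarrow> integrable lebesgue (\<lambda>x. indicator (- {0}) x *\<^sub>R f x)"
    "(LINT x|lebesgue. f x) = (LINT x|lebesgue. indicator (- {0}) x *\<^sub>R f x)"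
    by (rule ae, simp)+
  let ?g = "\<lambda>x. (\<rho> / norm x) powr (2 * real CARD('n)) * f (sph_inv \<rho> x)"
  let ?h = "\<lambda>x. indicator (- {0}) x *\<^sub>R (((\<rho> / norm x)\<^sup>2) ^ CARD('n) * f (sph_inv \<rho> x))"
  have g0: "integrable lebesgue ?g \<longleftrightarrow> integrable lebesgue ?h"
    "(LINT x|lebesgue. ?g x) = (LINT x|lebesgue. ?h x)"
    by (rule ae, simp add: powr_eq)+
  show "integrable lebesgue ?g \<longleftrightarrow> integrable lebesgue f"
    using 1 unfolding set_integrable_def f0(1)[symmetric] g0(1)[symmetric] .
  show "(LINT x|lebesgue. ?g x) = (LINT x|lebesgue. f x)"
    using 2 unfolding set_lebesgue_integral_def f0(2)[symmetric] g0(2)[symmetric] .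
qed

lemma isometric_involution_integral:
  fixes f :: "real ^ 'n \<Rightarrow> real"
  assumes "\<And>x. T (T x) = x" "linear L" "\<And>h. norm (L h) = norm h" "\<And>x. T x = a + L x"
  shows "integrable lebesgue (\<lambda>x. f (T x)) \<longleftrightarrow> integrable lebesgue f"
    and "(LINT x|lebesgue. f (T x)) = (LINT x|lebesgue. f x)"
proof -
  have T: "T = (\<lambda>x. a + L x)"
    using assms(4) by auto
  have der: "(T has_derivative L) (at x)" for x
    unfolding T using assms(2)
    by (auto intro!: derivative_eq_intros linear_imp_has_derivative)
  have "set_integrable lebesgue UNIV (\<lambda>x. 1 ^ CARD('n) * f (T x)) \<longleftrightarrow> set_integrable lebesgue UNIV f"
    by (rule conformal_involution(1)[where T' = "\<lambda>_. L"]) (use assms(1,3) der in auto)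
  moreover have "(LINT x:UNIV|lebesgue. 1 ^ CARD('n) * f (T x)) = (LINT x:UNIV|lebesgue. f x)"
    by (rule conformal_involution(2)[where T' = "\<lambda>_. L"]) (use assms(1,3) der in auto)
  ultimately show "integrable lebesgue (\<lambda>x. f (T x)) \<longleftrightarrow> integrable lebesgue f"
    "(LINT x|lebesgue. f (T x)) = (LINT x|lebesgue. f x)"
    by (simp_all add: set_integrable_def set_lebesgue_integral_def)
qed

lemma point_reflection_integral:
  fixes f :: "real ^ 'n \<Rightarrow> real"
  shows "integrable lebesgue (\<lambda>x. f (a - x)) \<longleftrightarrow> integrable lebesgue f"
    and "(LINT x|lebesgue. f (a - x)) = (LINT x|lebesgue. f x)"
proof -
  have lin: "linear (uminus :: real ^ 'n \<Rightarrow> real ^ 'n)"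
    by (rule linearI) simp_all
  note iso = isometric_involution_integral[where T = "\<lambda>x. a - x" and L = uminus and a = a and f = f, OF _ lin]
  show "integrable lebesgue (\<lambda>x. f (a - x)) \<longleftrightarrow> integrable lebesgue f"
    by (rule iso(1)) auto
  show "(LINT x|lebesgue. f (a - x)) = (LINT x|lebesgue. f x)"
    by (rule iso(2)) auto
qed

section \<open>Integrability and existence of the principal value\<close>

text \<open>On the dyadic shell where \<open>|z|\<close> is comparable to \<open>2\<^bsup>-k\<^esup>\<close>, the integrand is at most a constant times
  \<open>2\<^bsup>ak\<^esup>\<close>, while the volume is of order \<open>2\<^bsup>-nk\<^esup>\<close>; the resulting geometric series converges because \<open>a < n\<close>.\<close>

lemma integrable_norm_powr_unit_ball:
  assumes a: "a < real CARD('n)"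
  shows "set_integrable lebesgue (ball 0 1) (\<lambda>z :: real ^ 'n. norm z powr (- a))"
proof -
  define w where "w = 2 powr \<bar>a\<bar>"
  define s where "s k = ennreal (w * (2 powr a) ^ k)" for k :: nat
  let ?B = "\<lambda>k. ball (0 :: real ^ 'n) ((1/2) ^ k)"
  have meas: "(\<lambda>z. indicator (ball 0 1) z *\<^sub>R norm (z :: real ^ 'n) powr (- a)) \<in> borel_measurable lebesgue"
    by (intro measurable_completion borel_measurable_scaleR borel_measurable_indicator
        powr_real_measurable borel_measurable_norm) auto
  have bound: "ennreal (norm (indicator (ball 0 1) z *\<^sub>R norm z powr (- a)))
      \<le> (\<Sum>k. s k * indicator (?B k) z)" for z :: "real ^ 'n"
  proof (cases "z \<in> ball 0 1 \<and> z \<noteq> 0")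
    case True
    define P where "P k \<longleftrightarrow> (1/2::real) ^ Suc k \<le> norm z" for k
    obtain m where "(1/2::real) ^ m < norm z"
      using real_arch_pow_inv[of "norm z" "1/2"] True by auto
    then have "(1/2::real) ^ m \<le> 2 * norm z"
      using norm_ge_zero[of z] by linarith
    then have "P m"
      unfolding P_def by simp
    then have Pk: "P (LEAST k. P k)"
      by (rule LeastI)
    define k where "k = (LEAST k. P k)"
    have lo: "(1/2::real) ^ Suc k \<le> norm z"
      using Pk unfolding k_def P_def .
    have hi: "norm z < (1/2) ^ k"
    proof (cases k)
      case 0
      then show ?thesis
        using True by simp
    next
      case (Suc j)
      then have "\<not> P j"
        unfolding k_def by (metis lessI not_less_Least)
      then show ?thesis
        unfolding P_def Suc by simp
    qed
    have half: "(1/2::real) ^ i = 2 powr (- real i)" for i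
      by (simp add: powr_minus powr_realpow power_one_over inverse_eq_divide)
    have "norm z powr (- a) \<le> w * (2 powr a) ^ k"
    (* the factor w absorbs the ratio of the two radii of the shell, whichever of them is the worse *)
    proof (cases "a \<ge> 0")
      case True
      have "norm z powr (- a) \<le> ((1/2) ^ Suc k) powr (- a)"
        using lo True by (intro powr_mono2') auto
      also have "\<dots> = 2 powr (a * (1 + real k))"
        unfolding half by (simp add: powr_powr algebra_simps)
      also have "\<dots> = w * (2 powr a) ^ k"
        using True by (simp add: w_def powr_add[symmetric] powr_realpow[symmetric] powr_powr algebra_simps)
      finally show ?thesis .
    next
      case False
      have "norm z powr (- a) \<le> ((1/2) ^ k) powr (- a)"
        using hi False by (intro powr_mono2) auto
      also have "\<dots> = 2 powr (a * real k)"
        unfolding half by (simp add: powr_powr algebra_simps)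
      also have "\<dots> = (2 powr a) ^ k"
        by (simp add: powr_realpow[symmetric] powr_powr)
      also have "\<dots> \<le> w * (2 powr a) ^ k"
        by (simp add: w_def ge_one_powr_ge_zero)
      finally show ?thesis .
    qed
    then have "ennreal (norm (indicator (ball 0 1) z *\<^sub>R norm z powr (- a))) \<le> s k * indicator (?B k) z"
      using True hi by (simp add: s_def ennreal_leI)
    also have "\<dots> = (\<Sum>i\<in>{k}. s i * indicator (?B i) z)"
      by (simp only: sum.insert_if finite.emptyI empty_iff if_False sum.empty add_0_right)
    also have "\<dots> \<le> (\<Sum>k. s k * indicator (?B k) z)"
      by (rule sum_le_suminf) auto
    finally show ?thesis .
  qed auto
  define r where "r = 2 powr (a - real CARD('n))"
  have r: "0 \<le> r" "r < 1"
    using a by (auto simp: r_def powr_less_one)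
  define V where "V = measure lebesgue (ball (0 :: real ^ 'n) 1)"
  have summand: "s k * emeasure lebesgue (?B k) = ennreal (w * V * r ^ k)" for k
  proof -
    have "emeasure lebesgue (?B k) = ennreal (measure lebesgue (?B k))"
      by (rule emeasure_eq_measure2[symmetric, THEN sym] emeasure_eq_ennreal_measure) auto
    also have "measure lebesgue (?B k) = ((1/2) ^ k) ^ CARD('n) * V"
      unfolding V_def using content_ball_conv_unit_ball[of "(1/2) ^ k" "0 :: real ^ 'n"] by simp
    finally have "s k * emeasure lebesgue (?B k)
        = ennreal (w * (2 powr a) ^ k * (((1/2) ^ k) ^ CARD('n) * V))"
      unfolding s_def w_def by (subst ennreal_mult) (auto simp: V_def)
    also have "w * (2 powr a) ^ k * (((1/2) ^ k) ^ CARD('n) * V) = w * V * r ^ k"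
    proof -
      have "r = 2 powr a * (1/2) ^ CARD('n)"
        unfolding r_def powr_diff by (simp add: powr_realpow power_one_over)
      then have "r ^ k = (2 powr a) ^ k * ((1/2) ^ k) ^ CARD('n)"
        by (simp add: power_mult_distrib power_mult[symmetric] mult.commute del: power_one_over)
      then show ?thesis
        by simp
    qed
    finally show ?thesis .
  qed
  have "(\<integral>\<^sup>+z. ennreal (norm (indicator (ball 0 1) z *\<^sub>R norm (z :: real ^ 'n) powr (- a))) \<partial>lebesgue)
      \<le> (\<integral>\<^sup>+z. (\<Sum>k. s k * indicator (?B k) z) \<partial>lebesgue)"
    by (intro nn_integral_mono bound)
  also have "\<dots> = (\<Sum>k. s k * emeasure lebesgue (?B k))"
  proof -
    have "(\<lambda>z :: real ^ 'n. s k * indicator (?B k) z) \<in> borel_measurable lebesgue" for k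
      by (intro borel_measurable_times_ennreal borel_measurable_const borel_measurable_indicator) simp
    then have "(\<integral>\<^sup>+z. (\<Sum>k. s k * indicator (?B k) z) \<partial>lebesgue) = (\<Sum>k. \<integral>\<^sup>+z. s k * indicator (?B k) z \<partial>lebesgue)"
      by (rule nn_integral_suminf)
    also have "\<dots> = (\<Sum>k. s k * emeasure lebesgue (?B k))"
      by (subst nn_integral_cmult_indicator) simp_all
    finally show ?thesis .
  qed
  also have "\<dots> = (\<Sum>k. ennreal (w * V * r ^ k))"
    unfolding summand ..
  also have "\<dots> = ennreal (\<Sum>k. w * V * r ^ k)"
    using r by (intro suminf_ennreal2) (auto simp: w_def V_def intro!: summable_mult summable_geometric)
  also have "\<dots> < \<infinity>"
    by simp
  finally show ?thesis
    unfolding set_integrable_def using meas by (intro integrableI_bounded)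
qed

text \<open>The inversion turns integrability of \<open>|y|\<^bsup>-n-\<alpha>\<^esup>\<close> near infinity into that of \<open>|x|\<^bsup>\<alpha>-n\<^esup>\<close> near the origin.\<close>

lemma L_space_const:
  assumes "\<alpha> > 0"
  shows "(\<lambda>_ :: real ^ 'n. c) \<in> L_space \<alpha>"
proof -
  let ?p = "real CARD('n) + \<alpha>"
  define g where "g y = indicator (- cball 0 1) y * norm (y :: real ^ 'n) powr (- ?p)" for y
  have "integrable lebesgue (\<lambda>x :: real ^ 'n. indicator (ball 0 1) x *\<^sub>R norm x powr (- (real CARD('n) - \<alpha>)))"
    using integrable_norm_powr_unit_ball[of "real CARD('n) - \<alpha>", where 'n = 'n] assms
    unfolding set_integrable_def by auto
  also have "?this \<longleftrightarrow> integrable lebesgue (\<lambda>x. (1 / norm x) powr (2 * real CARD('n)) * g (sph_inv 1 x))"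
  proof (rule integrable_cong_AE_neq[of 0])
    fix x :: "real ^ 'n" assume x: "x \<noteq> 0"
    have "(1 / norm x) powr (2 * real CARD('n)) * (1 / norm x) powr (- ?p)
        = (1 / norm x) powr (real CARD('n) - \<alpha>)"
      by (simp add: powr_add[symmetric])
    also have "\<dots> = norm x powr (- (real CARD('n) - \<alpha>))"
      unfolding powr_minus_divide by (simp add: powr_divide)
    finally show "indicator (ball 0 1) x *\<^sub>R norm x powr (- (real CARD('n) - \<alpha>))
        = (1 / norm x) powr (2 * real CARD('n)) * g (sph_inv 1 x)"
      using x by (auto simp: g_def indicator_def norm_sph_inv)
  qed
  also have "\<dots> \<longleftrightarrow> integrable lebesgue g"
    by (rule inversion_integral(1)) simp
  finally have g: "integrable lebesgue g" .
  have one: "integrable lebesgue (indicator (cball 0 1) :: real ^ 'n \<Rightarrow> real)"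
    by (intro integrable_real_indicator) (use emeasure_lborel_cball_finite[of "0 :: real ^ 'n" 1] in auto)
  have "integrable lebesgue (\<lambda>x :: real ^ 'n. \<bar>c\<bar> / (1 + norm x powr ?p))"
  proof (rule Bochner_Integration.integrable_bound)
    show "integrable lebesgue (\<lambda>x :: real ^ 'n. \<bar>c\<bar> * (indicator (cball 0 1) x + g x))"
      using g one by auto
    show "(\<lambda>x :: real ^ 'n. \<bar>c\<bar> / (1 + norm x powr ?p)) \<in> borel_measurable lebesgue"
      by (intro measurable_completion) measurable
    have "1 / (1 + norm x powr ?p) \<le> indicator (cball 0 1) x + g x" for x :: "real ^ 'n"
    proof (cases "norm x \<le> 1")
      case True
      then have "indicator (cball 0 1) x + g x = 1"
        by (simp add: g_def)
      then show ?thesis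
        by (simp add: divide_le_eq_1 add_pos_nonneg)
    next
      case False
      then have "indicator (cball 0 1) x + g x = norm x powr (- ?p)"
        by (simp add: g_def)
      moreover have "norm x powr ?p > 0"
        using False by auto
      ultimately show ?thesis
        unfolding powr_minus_divide by (simp add: frac_le)
    qed
    then have "\<bar>c\<bar> / (1 + norm x powr ?p) \<le> \<bar>c\<bar> * (indicator (cball 0 1) x + g x)" for x :: "real ^ 'n"
      using mult_left_mono[of "1 / (1 + norm x powr ?p)" "indicator (cball 0 1) x + g x" "\<bar>c\<bar>"] by simp
    then show "AE x :: real ^ 'n in lebesgue. norm (\<bar>c\<bar> / (1 + norm x powr ?p))
        \<le> norm (\<bar>c\<bar> * (indicator (cball 0 1) x + g x))"
      by (intro AE_I2) (smt (verit) real_norm_def divide_nonneg_nonneg powr_ge_zero abs_ge_zero)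
  qed
  then show ?thesis
    by (simp add: L_space_def)
qed

definition dq :: "real \<Rightarrow> (real ^ 'n \<Rightarrow> real) \<Rightarrow> real ^ 'n \<Rightarrow> real ^ 'n \<Rightarrow> real" where
  "dq \<alpha> f x y = (f x - f y) / norm (x - y) powr (real CARD('n) + \<alpha>)"

abbreviation has_pv :: "real \<Rightarrow> (real ^ 'n \<Rightarrow> real) \<Rightarrow> real ^ 'n \<Rightarrow> real \<Rightarrow> bool" where
  "has_pv \<alpha> f x L \<equiv> ((\<lambda>eps. LINT y:(UNIV - ball x eps)|lebesgue. dq \<alpha> f x y) \<longlongrightarrow> L) (at_right 0)"

lemma frac_laplacian_dq:
  "frac_laplacian C \<alpha> u x = C * Lim (at_right 0) (\<lambda>eps. LINT y:(UNIV - ball x eps)|lebesgue. dq \<alpha> u x y)"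
  by (simp add: frac_laplacian_def dq_def)

lemma L_space_measurable: "f \<in> L_space \<alpha> \<Longrightarrow> f \<in> borel_measurable lebesgue"
  by (simp add: L_space_def)

lemma dq_measurable:
  fixes f :: "real ^ 'n \<Rightarrow> real"
  assumes "f \<in> borel_measurable lebesgue"
  shows "dq \<alpha> f x \<in> borel_measurable lebesgue"
proof -
  have "(\<lambda>y. norm (x - y) powr (real CARD('n) + \<alpha>)) \<in> borel_measurable lebesgue"
    by (intro measurable_completion) measurable
  then show ?thesis
    unfolding dq_def using assms by (intro borel_measurable_divide borel_measurable_diff) auto
qed

lemma L_space_dq_integrable:
  fixes f :: "real ^ 'n \<Rightarrow> real"
  assumes f: "f \<in> L_space \<alpha>" and "\<alpha> > 0" "eps > 0" "A \<in> sets lebesgue"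
    and A: "\<And>y. y \<in> A \<Longrightarrow> norm (x - y) \<ge> eps"
  shows "set_integrable lebesgue A (dq \<alpha> f x)"
proof -
  let ?p = "real CARD('n) + \<alpha>"
  define C where "C = (1 / eps) powr ?p + (norm x / eps + 1) powr ?p"
  have p: "?p \<ge> 0"
    using assms by simp
  have fx: "(\<lambda>_. f x) \<in> L_space \<alpha>"
    using L_space_const assms by blast
  show ?thesis
    unfolding set_integrable_def
  proof (rule Bochner_Integration.integrable_bound)
    show "integrable lebesgue (\<lambda>y. C * (\<bar>f x\<bar> / (1 + norm y powr ?p) + \<bar>f y\<bar> / (1 + norm y powr ?p)))"
      using f fx unfolding L_space_def by auto
    show "(\<lambda>y. indicator A y *\<^sub>R dq \<alpha> f x y) \<in> borel_measurable lebesgue"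
      using dq_measurable[OF L_space_measurable[OF f]] assms by auto
    show "AE y in lebesgue. norm (indicator A y *\<^sub>R dq \<alpha> f x y)
        \<le> norm (C * (\<bar>f x\<bar> / (1 + norm y powr ?p) + \<bar>f y\<bar> / (1 + norm y powr ?p)))"
    proof (rule AE_I2)
      fix y
      show "norm (indicator A y *\<^sub>R dq \<alpha> f x y)
          \<le> norm (C * (\<bar>f x\<bar> / (1 + norm y powr ?p) + \<bar>f y\<bar> / (1 + norm y powr ?p)))"
      proof (cases "y \<in> A")
        case True
        define d where "d = norm (x - y)"
        have d: "d \<ge> eps" "d > 0"
          using A[OF True] assms by (auto simp: d_def)
        have "1 \<le> (d / eps) powr ?p"
          using d assms p by (intro ge_one_powr_ge_zero) auto
        moreover have "norm y powr ?p \<le> ((norm x / eps + 1) * d) powr ?p"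
        proof (rule powr_mono2)
          have "norm y \<le> norm x + d"
            unfolding d_def using norm_triangle_ineq4[of x "x - y"] by simp
          also have "norm x \<le> norm x / eps * d"
            using d assms mult_left_mono[of eps d "norm x / eps"] by (simp add: field_simps)
          finally show "norm y \<le> (norm x / eps + 1) * d"
            by (simp add: algebra_simps)
        qed (use p in auto)
        then have "norm y powr ?p \<le> (norm x / eps + 1) powr ?p * d powr ?p"
          unfolding powr_mult .
        ultimately have "1 + norm y powr ?p \<le> C * d powr ?p"
          unfolding powr_divide C_def distrib_right by (simp add: powr_divide)
        then have le: "1 / d powr ?p \<le> C / (1 + norm y powr ?p)"
          using d by (simp add: field_simps add_pos_nonneg)
        have "norm (indicator A y *\<^sub>R dq \<alpha> f x y) = \<bar>f x - f y\<bar> * (1 / d powr ?p)"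
          using True by (simp add: dq_def d_def abs_divide)
        also have "\<dots> \<le> (\<bar>f x\<bar> + \<bar>f y\<bar>) * (C / (1 + norm y powr ?p))"
          using le by (intro mult_mono) auto
        also have "\<dots> = C * (\<bar>f x\<bar> / (1 + norm y powr ?p) + \<bar>f y\<bar> / (1 + norm y powr ?p))"
          by (simp add: add_divide_distrib algebra_simps)
        finally show ?thesis
          by simp
      qed simp
    qed
  qed
qed

text \<open>The pointwise content of being \<open>C\<^sup>1\<^sup>,\<^sup>1\<close> near \<open>x\<close>. It suffices for the principal value at \<open>x\<close>, and, unlike a
  condition on gradients, it passes through products and compositions by a direct estimate.\<close>

definition quadratic_at :: "('a::real_normed_vector \<Rightarrow> 'b::real_normed_vector) \<Rightarrow> 'a \<Rightarrow> bool" where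
  "quadratic_at f x \<longleftrightarrow> (\<exists>L K. bounded_linear L \<and>
     (\<forall>\<^sub>F y in nhds x. norm (f y - f x - L (y - x)) \<le> K * (norm (y - x))\<^sup>2))"

lemma quadratic_at_lipschitz_gradient:
  fixes u :: "'a::real_inner \<Rightarrow> real"
  assumes "\<delta> > 0"
    and u: "\<And>z. z \<in> ball x \<delta> \<Longrightarrow> GDERIV u z :> g z"
    and g: "\<And>z. z \<in> ball x \<delta> \<Longrightarrow> norm (g z - g x) \<le> K * norm (z - x)"
    and K: "K \<ge> 0"
  shows "quadratic_at u x"
proof -
  have "norm (u y - u x - g x \<bullet> (y - x)) \<le> K * (norm (y - x))\<^sup>2" if y: "y \<in> ball x \<delta>" for y
  proof -
    define r where "r = norm (y - x)"
    define F where "F z = u z - g x \<bullet> (z - x)" for z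
    have sub: "cball x r \<subseteq> ball x \<delta>"
      using y by (auto simp: r_def dist_norm norm_minus_commute)
    have der: "(F has_derivative (\<lambda>h. h \<bullet> (g z - g x))) (at z within cball x r)" if "z \<in> cball x r" for z
    proof -
      have "(u has_derivative (\<lambda>h. h \<bullet> g z)) (at z within cball x r)"
        using u[of z] sub that unfolding gderiv_def by (blast intro: has_derivative_at_withinI)
      then have "(F has_derivative (\<lambda>h. h \<bullet> g z - g x \<bullet> (h - 0))) (at z within cball x r)"
        unfolding F_def
        by (intro has_derivative_diff has_derivative_inner_right has_derivative_ident has_derivative_const)
      then show ?thesis
        by (simp add: inner_diff_right inner_commute)
    qed
    have "norm (F y - F x) \<le> (K * r) * norm (y - x)"
    proof (rule differentiable_bound[OF convex_cball[of x r] der])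
      fix z assume z: "z \<in> cball x r"
      have "norm (g z - g x) \<le> K * norm (z - x)"
        using g z sub by auto
      also have "\<dots> \<le> K * r"
        using z K by (intro mult_left_mono) (auto simp: dist_norm norm_minus_commute)
      finally have gz: "norm (g z - g x) \<le> K * r" .
      show "onorm (\<lambda>h. h \<bullet> (g z - g x)) \<le> K * r"
      proof (rule onorm_bound)
        show "0 \<le> K * r"
          using K by (simp add: r_def)
        next
        fix h
        have "norm (h \<bullet> (g z - g x)) \<le> norm h * norm (g z - g x)"
          by (simp add: Cauchy_Schwarz_ineq2)
        also have "\<dots> \<le> norm h * (K * r)"
          using gz by (intro mult_left_mono) auto
        finally show "norm (h \<bullet> (g z - g x)) \<le> K * r * norm h"
          by (simp add: mult.commute)
      qed
    qed (auto simp: r_def dist_norm norm_minus_commute)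
    then show ?thesis
      by (simp add: F_def r_def power2_eq_square)
  qed
  then have "\<forall>\<^sub>F y in nhds x. norm (u y - u x - g x \<bullet> (y - x)) \<le> K * (norm (y - x))\<^sup>2"
    using \<open>\<delta> > 0\<close> unfolding eventually_nhds_metric by (auto simp: dist_commute)
  then show ?thesis
    unfolding quadratic_at_def using bounded_linear_inner_right by blast
qed

lemma C11_loc_quadratic_at:
  assumes "u \<in> C11_loc"
  shows "quadratic_at u x"
proof -
  obtain g where g: "\<And>x. GDERIV u x :> g x" "\<And>x. \<exists>\<delta>>0. \<exists>K. K-lipschitz_on (ball x \<delta>) g"
    using assms by (auto simp: C11_loc_def)
  obtain \<delta> K where \<delta>: "\<delta> > 0" and K: "K-lipschitz_on (ball x \<delta>) g"
    using g(2) by blast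
  show ?thesis
    using lipschitz_onD[OF K, of _ x] \<delta> g(1) lipschitz_on_nonneg[OF K]
    by (intro quadratic_at_lipschitz_gradient[OF \<delta>]) (auto simp: dist_norm)
qed

text \<open>Averaging the integrand with its point reflection about \<open>x\<close> leaves the truncated integrals unchanged but
  cancels the linear part, so that the integrand becomes of order \<open>|x - y|\<^bsup>2-n-\<alpha>\<^esup>\<close>, which is integrable at \<open>x\<close>.\<close>

lemma pv_exists:
  fixes u :: "real ^ 'n \<Rightarrow> real"
  assumes u: "u \<in> L_space \<alpha>" and q: "quadratic_at u x" and \<alpha>: "0 < \<alpha>" "\<alpha> < 2"
  shows "\<exists>L. has_pv \<alpha> u x L"
proof -
  let ?p = "real CARD('n) + \<alpha>"
  obtain G K1 where lin: "bounded_linear G" and "\<forall>\<^sub>F y in nhds x. \<bar>u y - u x - G (y - x)\<bar> \<le> K1 * (norm (y - x))\<^sup>2"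
    using q unfolding quadratic_at_def real_norm_def by blast
  then obtain \<delta>0 where \<delta>0: "\<delta>0 > 0"
    and K0: "\<And>y. dist y x < \<delta>0 \<Longrightarrow> \<bar>u y - u x - G (y - x)\<bar> \<le> K1 * (norm (y - x))\<^sup>2"
    unfolding eventually_nhds_metric by blast
  define \<delta> where "\<delta> = min \<delta>0 1"
  define K where "K = \<bar>K1\<bar>"
  have \<delta>: "\<delta> > 0" "\<delta> \<le> 1"
    using \<delta>0 by (auto simp: \<delta>_def)
  have K: "\<bar>u y - u x - G (y - x)\<bar> \<le> K * (norm (x - y))\<^sup>2" if "norm (x - y) < \<delta>" for y
  proof -
    have "\<bar>u y - u x - G (y - x)\<bar> \<le> K1 * (norm (x - y))\<^sup>2"
      using K0[of y] that by (simp add: \<delta>_def dist_norm norm_minus_commute)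
    also have "\<dots> \<le> K * (norm (x - y))\<^sup>2"
      unfolding K_def by (intro mult_right_mono) auto
    finally show ?thesis .
  qed
  define W where "W y = (dq \<alpha> u x y + dq \<alpha> u x (2 *\<^sub>R x - y)) / 2" for y
  have W_eq: "W y = (2 * u x - u y - u (2 *\<^sub>R x - y)) / 2 / norm (x - y) powr ?p" for y
  proof -
    have "norm (x - (2 *\<^sub>R x - y)) = norm (x - y)"
      by (simp add: scaleR_2 norm_minus_commute)
    then show ?thesis
      unfolding W_def dq_def by (simp add: add_divide_distrib diff_divide_distrib)
  qed
  have intu: "set_integrable lebesgue (UNIV - ball x eps) (dq \<alpha> u x)" if "eps > 0" for eps
    by (rule L_space_dq_integrable[OF u \<alpha>(1) that]) (auto simp: dist_norm)
  have refl_ind: "indicator (UNIV - ball x eps) (2 *\<^sub>R x - y) = (indicator (UNIV - ball x eps) y :: real)" for eps y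
    by (simp add: indicator_def dist_norm scaleR_2 norm_minus_commute)
  have intu': "integrable lebesgue (\<lambda>y. indicator (UNIV - ball x eps) y *\<^sub>R dq \<alpha> u x (2 *\<^sub>R x - y))"
    and equ': "(LINT y|lebesgue. indicator (UNIV - ball x eps) y *\<^sub>R dq \<alpha> u x (2 *\<^sub>R x - y))
      = (LINT y|lebesgue. indicator (UNIV - ball x eps) y *\<^sub>R dq \<alpha> u x y)" if "eps > 0" for eps
    using point_reflection_integral[of "\<lambda>y. indicator (UNIV - ball x eps) y *\<^sub>R dq \<alpha> u x y" "2 *\<^sub>R x"]
      intu[OF that] unfolding refl_ind set_integrable_def by auto
  have intW: "set_integrable lebesgue (UNIV - ball x eps) W"
    and eqW: "(LINT y:(UNIV - ball x eps)|lebesgue. dq \<alpha> u x y) = (LINT y:(UNIV - ball x eps)|lebesgue. W y)"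
    if "eps > 0" for eps
  proof -
    let ?i = "\<lambda>y. indicator (UNIV - ball x eps) y :: real"
    have split: "?i y *\<^sub>R W y = (?i y *\<^sub>R dq \<alpha> u x y + ?i y *\<^sub>R dq \<alpha> u x (2 *\<^sub>R x - y)) / 2" for y
      by (simp add: W_def algebra_simps)
    show "set_integrable lebesgue (UNIV - ball x eps) W"
      unfolding set_integrable_def split using intu[OF that] intu'[OF that]
      unfolding set_integrable_def by auto
    show "(LINT y:(UNIV - ball x eps)|lebesgue. dq \<alpha> u x y) = (LINT y:(UNIV - ball x eps)|lebesgue. W y)"
      unfolding set_lebesgue_integral_def split using intu[OF that] intu'[OF that] equ'[OF that]
      unfolding set_integrable_def by simp
  qed
  have Wm: "W \<in> borel_measurable lebesgue"
  proof -
    have 1: "dq \<alpha> u x \<in> borel_measurable lebesgue"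
      by (rule dq_measurable[OF L_space_measurable[OF u]])
    have "(\<lambda>y. 2 *\<^sub>R x + (\<Sum>j\<in>Basis. (- 1 * (y \<bullet> j)) *\<^sub>R j)) \<in> lebesgue \<rightarrow>\<^sub>M lebesgue"
      by (rule lebesgue_affine_measurable[where c = "\<lambda>_. - 1"]) auto
    moreover have "(\<lambda>y. 2 *\<^sub>R x + (\<Sum>j\<in>Basis. (- 1 * (y \<bullet> j)) *\<^sub>R j)) = (\<lambda>y. 2 *\<^sub>R x - y)"
      by (simp add: fun_eq_iff sum_negf euclidean_representation)
    ultimately have "(\<lambda>y. 2 *\<^sub>R x - y) \<in> lebesgue \<rightarrow>\<^sub>M lebesgue"
      by simp
    from measurable_compose[OF this 1] have 2: "(\<lambda>y. dq \<alpha> u x (2 *\<^sub>R x - y)) \<in> borel_measurable lebesgue" .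
    have W: "W = (\<lambda>y. (dq \<alpha> u x y + dq \<alpha> u x (2 *\<^sub>R x - y)) / 2)"
      by (simp add: W_def fun_eq_iff)
    show ?thesis
      unfolding W using 1 2 by measurable
  qed
  let ?a = "?p - 2"
  (* the dominating function: the quadratic bound near x, the averaged integrand itself elsewhere *)
  define D where "D y = indicator (ball 0 1) (x - y) *\<^sub>R (norm (x - y) powr (- ?a)) * K
      + indicator (UNIV - ball x \<delta>) y *\<^sub>R \<bar>W y\<bar>" for y
  have Dint: "integrable lebesgue D"
  proof -
    have "integrable lebesgue (\<lambda>z :: real ^ 'n. indicator (ball 0 1) z *\<^sub>R norm z powr (- ?a))"
      using integrable_norm_powr_unit_ball[of ?a, where 'n = 'n] \<alpha> unfolding set_integrable_def by simp
    then have "integrable lebesgue (\<lambda>y. indicator (ball 0 1) (x - y) *\<^sub>R norm (x - y) powr (- ?a))"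
      using point_reflection_integral(1)[of "\<lambda>z. indicator (ball 0 1) z *\<^sub>R norm z powr (- ?a)" x] by simp
    moreover have "integrable lebesgue (\<lambda>y. indicator (UNIV - ball x \<delta>) y *\<^sub>R \<bar>W y\<bar>)"
      using set_integrable_abs[OF intW[OF \<delta>(1)]] unfolding set_integrable_def .
    ultimately show ?thesis
      unfolding D_def by auto
  qed
  have near: "\<bar>W y\<bar> \<le> K * norm (x - y) powr (- ?a)" if y: "norm (x - y) < \<delta>" for y
  proof (cases "y = x")
    case False
    have eq: "2 *\<^sub>R x - y - x = - (y - x)" "norm (x - (2 *\<^sub>R x - y)) = norm (x - y)"
      by (simp_all add: scaleR_2 norm_minus_commute)
    have "\<bar>u (2 *\<^sub>R x - y) - u x - G (2 *\<^sub>R x - y - x)\<bar> \<le> K * (norm (x - y))\<^sup>2"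
      using K[of "2 *\<^sub>R x - y"] y unfolding eq by simp
    then have "\<bar>u (2 *\<^sub>R x - y) - u x + G (y - x)\<bar> \<le> K * (norm (x - y))\<^sup>2"
      unfolding eq by (simp only: linear_neg[OF bounded_linear.linear[OF lin]] diff_minus_eq_add)
    moreover have "\<bar>(2 * b - a - e) / 2\<bar> \<le> k" if "\<bar>a - b - c\<bar> \<le> k" "\<bar>e - b + c\<bar> \<le> k" for a b c e k :: real
    proof -
      have "\<bar>2 * b - a - e\<bar> \<le> 2 * k"
        using that by linarith
      then show ?thesis
        by simp
    qed
    ultimately have num: "\<bar>(2 * u x - u y - u (2 *\<^sub>R x - y)) / 2\<bar> \<le> K * (norm (x - y))\<^sup>2"
      using K[OF y] by blast
    have "\<bar>W y\<bar> = \<bar>(2 * u x - u y - u (2 *\<^sub>R x - y)) / 2\<bar> / norm (x - y) powr ?p"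
      unfolding W_eq by (simp add: abs_divide)
    also have "\<dots> \<le> K * (norm (x - y))\<^sup>2 / norm (x - y) powr ?p"
      using num by (intro divide_right_mono) auto
    also have "\<dots> = K * (norm (x - y) powr 2 / norm (x - y) powr ?p)"
      using False by (simp add: powr_numeral)
    also have "\<dots> = K * norm (x - y) powr (- ?a)"
      unfolding powr_diff[symmetric] by simp
    finally show ?thesis .
  qed (simp add: W_def dq_def scaleR_2)
  have dom: "\<bar>W y\<bar> \<le> D y" for y
  proof (cases "norm (x - y) < \<delta>")
    case True
    then show ?thesis
      using near[OF True] \<delta> by (auto simp: D_def indicator_def dist_norm norm_minus_commute[of x y] mult.commute)
  next
    case False
    then show ?thesis
      by (simp add: D_def K_def dist_norm)
  qed
  have "has_pv \<alpha> u x ((LINT y|lebesgue. W y))"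
    unfolding tendsto_at_iff_sequentially comp_def
  proof (intro allI impI)
    fix X :: "nat \<Rightarrow> real"
    assume X: "\<forall>i. X i \<in> {0<..} - {0}" and X0: "X \<longlonglongrightarrow> 0"
    have "(\<lambda>i. LINT y|lebesgue. indicator (UNIV - ball x (X i)) y *\<^sub>R W y) \<longlonglongrightarrow> (LINT y|lebesgue. W y)"
    proof (rule integral_dominated_convergence[where w = D])
      show "AE y in lebesgue. (\<lambda>i. indicator (UNIV - ball x (X i)) y *\<^sub>R W y) \<longlonglongrightarrow> W y"
        using AE_lebesgue_neq[of x]
      proof eventually_elim
        case (elim y)
        then have "\<forall>\<^sub>F i in sequentially. X i < norm (x - y)"
          using X0 by (intro order_tendstoD) auto
        then have "\<forall>\<^sub>F i in sequentially. indicator (UNIV - ball x (X i)) y *\<^sub>R W y = W y"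
          by eventually_elim (simp add: dist_norm)
        then show ?case
          by (rule tendsto_eventually)
      qed
      show "AE y in lebesgue. norm (indicator (UNIV - ball x (X i)) y *\<^sub>R W y) \<le> D y" for i
        using dom by (intro AE_I2) (auto simp: indicator_def intro: order_trans[OF abs_ge_zero])
      show "(\<lambda>y. indicator (UNIV - ball x (X i)) y *\<^sub>R W y) \<in> borel_measurable lebesgue" for i
        by (intro borel_measurable_scaleR borel_measurable_indicator Wm) auto
    qed (use Wm Dint in auto)
    then show "(\<lambda>i. LINT y:(UNIV - ball x (X i))|lebesgue. dq \<alpha> u x y) \<longlonglongrightarrow> (LINT y|lebesgue. W y)"
      using X eqW[of "X i" for i] by (simp add: set_lebesgue_integral_def)
  qed
  then show ?thesis
    by blast
qed

section \<open>Calculus of quadratic approximation\<close>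

lemma quadratic_at_locally_lipschitz:
  assumes "quadratic_at f x"
  shows "\<exists>M>0. \<forall>\<^sub>F y in nhds x. norm (f y - f x) \<le> M * norm (y - x)"
proof -
  obtain L K where L: "bounded_linear L"
    and K: "\<forall>\<^sub>F y in nhds x. norm (f y - f x - L (y - x)) \<le> K * (norm (y - x))\<^sup>2"
    using assms unfolding quadratic_at_def by blast
  obtain B where B: "B > 0" "\<And>h. norm (L h) \<le> norm h * B"
    using bounded_linear.pos_bounded[OF L] by blast
  have near: "\<forall>\<^sub>F y in nhds x. norm (y - x) < 1"
    unfolding eventually_nhds_metric by (intro exI[of _ 1]) (auto simp: dist_norm)
  have "\<forall>\<^sub>F y in nhds x. norm (f y - f x) \<le> (\<bar>K\<bar> + B) * norm (y - x)"
    using K near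
  proof eventually_elim
    case (elim y)
    have "norm (f y - f x) \<le> norm (f y - f x - L (y - x)) + norm (L (y - x))"
      using norm_triangle_ineq[of "f y - f x - L (y - x)" "L (y - x)"] by simp
    also have "norm (f y - f x - L (y - x)) \<le> \<bar>K\<bar> * (norm (y - x))\<^sup>2"
      using elim(1) by (rule order_trans) (intro mult_right_mono; simp)
    also have "\<bar>K\<bar> * (norm (y - x))\<^sup>2 \<le> \<bar>K\<bar> * norm (y - x)"
      using elim(2) by (intro mult_left_mono) (auto simp: power2_eq_square mult_left_le_one_le)
    also have "norm (L (y - x)) \<le> norm (y - x) * B"
      by (rule B)
    finally show ?case
      by (simp add: algebra_simps)
  qed
  then show ?thesis
    using B by (intro exI[of _ "\<bar>K\<bar> + B"]) auto
qed

lemma quadratic_at_continuous: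
  assumes "quadratic_at f x"
  shows "isCont f x"
proof -
  obtain M where "\<forall>\<^sub>F y in nhds x. norm (f y - f x) \<le> M * norm (y - x)"
    using quadratic_at_locally_lipschitz[OF assms] by blast
  then have ev: "\<forall>\<^sub>F y in at x. norm (f y - f x) \<le> M * norm (y - x)"
    by (simp add: eventually_at_filter eventually_mono)
  have "((\<lambda>y. M * norm (y - x)) \<longlongrightarrow> M * norm (x - x)) (at x)"
    by (intro tendsto_intros)
  then have "((\<lambda>y. f y - f x) \<longlongrightarrow> 0) (at x)"
    by (intro Lim_null_comparison[OF ev]) simp
  then show ?thesis
    by (simp add: isCont_def LIM_zero_iff)
qed

lemma quadratic_at_const: "quadratic_at (\<lambda>_. c) x"
  unfolding quadratic_at_def by (intro exI[of _ "\<lambda>_. 0"] exI[of _ 0]) simp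

lemma quadratic_at_ident: "quadratic_at (\<lambda>y. y) x"
  unfolding quadratic_at_def by (intro exI[of _ "\<lambda>h. h"] exI[of _ 0]) simp

lemma quadratic_at_inner_self: "quadratic_at (\<lambda>y :: 'a::real_inner. y \<bullet> y) x"
  unfolding quadratic_at_def
proof (intro exI conjI)
  show "bounded_linear (\<lambda>h. 2 * (x \<bullet> h))"
    by (intro bounded_linear_mult_right[THEN bounded_linear_compose] bounded_linear_inner_right)
  have "y \<bullet> y - x \<bullet> x - 2 * (x \<bullet> (y - x)) = (norm (y - x))\<^sup>2" for y
    by (simp add: power2_norm_eq_inner inner_diff_left inner_diff_right inner_commute)
  then show "\<forall>\<^sub>F y in nhds x. norm (y \<bullet> y - x \<bullet> x - 2 * (x \<bullet> (y - x))) \<le> 1 * (norm (y - x))\<^sup>2"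
    by simp
qed

lemma quadratic_at_compose:
  assumes f: "quadratic_at f x" and g: "quadratic_at g (f x)"
  shows "quadratic_at (\<lambda>y. g (f y)) x"
proof -
  obtain L K where L: "bounded_linear L"
    and K: "\<forall>\<^sub>F y in nhds x. norm (f y - f x - L (y - x)) \<le> K * (norm (y - x))\<^sup>2"
    using f unfolding quadratic_at_def by blast
  obtain L' K' where L': "bounded_linear L'"
    and K': "\<forall>\<^sub>F z in nhds (f x). norm (g z - g (f x) - L' (z - f x)) \<le> K' * (norm (z - f x))\<^sup>2"
    using g unfolding quadratic_at_def by blast
  obtain B where B: "B > 0" "\<And>h. norm (L' h) \<le> norm h * B"
    using bounded_linear.pos_bounded[OF L'] by blast
  obtain M where M: "M > 0" "\<forall>\<^sub>F y in nhds x. norm (f y - f x) \<le> M * norm (y - x)"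
    using quadratic_at_locally_lipschitz[OF f] by blast
  have "filterlim f (nhds (f x)) (nhds x)"
    using quadratic_at_continuous[OF f] by (simp add: continuous_at tendsto_at_iff_tendsto_nhds)
  then have K'': "\<forall>\<^sub>F y in nhds x. norm (g (f y) - g (f x) - L' (f y - f x)) \<le> K' * (norm (f y - f x))\<^sup>2"
    by (rule eventually_compose_filterlim[OF K'])
  have "\<forall>\<^sub>F y in nhds x. norm (g (f y) - g (f x) - L' (L (y - x))) \<le> (\<bar>K'\<bar> * M\<^sup>2 + K * B) * (norm (y - x))\<^sup>2"
    using K K'' M(2)
  proof eventually_elim
    case (elim y)
    have eq: "g (f y) - g (f x) - L' (L (y - x)) = (g (f y) - g (f x) - L' (f y - f x)) + L' (f y - f x - L (y - x))"
      by (simp add: linear_diff[OF bounded_linear.linear[OF L']])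
    have "norm (g (f y) - g (f x) - L' (f y - f x)) \<le> \<bar>K'\<bar> * (norm (f y - f x))\<^sup>2"
      using elim(2) by (rule order_trans) (intro mult_right_mono; simp)
    also have "\<dots> \<le> \<bar>K'\<bar> * (M * norm (y - x))\<^sup>2"
      using elim(3) by (intro mult_left_mono power_mono) auto
    finally have 1: "norm (g (f y) - g (f x) - L' (f y - f x)) \<le> \<bar>K'\<bar> * M\<^sup>2 * (norm (y - x))\<^sup>2"
      by (simp add: power_mult_distrib)
    have "norm (L' (f y - f x - L (y - x))) \<le> norm (f y - f x - L (y - x)) * B"
      by (rule B)
    also have "\<dots> \<le> K * (norm (y - x))\<^sup>2 * B"
      using elim(1) B by (intro mult_right_mono) auto
    finally have 2: "norm (L' (f y - f x - L (y - x))) \<le> K * B * (norm (y - x))\<^sup>2"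
      by (simp add: algebra_simps)
    show ?case
      unfolding eq using norm_triangle_mono[OF 1 2] by (simp add: algebra_simps)
  qed
  moreover have "bounded_linear (\<lambda>h. L' (L h))"
    using bounded_linear_compose[OF L' L] by simp
  ultimately show ?thesis
    unfolding quadratic_at_def by blast
qed

lemma quadratic_at_scaleR:
  fixes f :: "'a::real_normed_vector \<Rightarrow> real"
  assumes f: "quadratic_at f x" and g: "quadratic_at g x"
  shows "quadratic_at (\<lambda>y. f y *\<^sub>R g y) x"
proof -
  obtain L K where L: "bounded_linear L"
    and K: "\<forall>\<^sub>F y in nhds x. norm (f y - f x - L (y - x)) \<le> K * (norm (y - x))\<^sup>2"
    using f unfolding quadratic_at_def by blast
  obtain L' K' where L': "bounded_linear L'"
    and K': "\<forall>\<^sub>F y in nhds x. norm (g y - g x - L' (y - x)) \<le> K' * (norm (y - x))\<^sup>2"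
    using g unfolding quadratic_at_def by blast
  obtain M where M: "M > 0" "\<forall>\<^sub>F y in nhds x. norm (f y - f x) \<le> M * norm (y - x)"
    using quadratic_at_locally_lipschitz[OF f] by blast
  obtain M' where M': "M' > 0" "\<forall>\<^sub>F y in nhds x. norm (g y - g x) \<le> M' * norm (y - x)"
    using quadratic_at_locally_lipschitz[OF g] by blast
  define D where "D h = f x *\<^sub>R L' h + L h *\<^sub>R g x" for h
  have "\<forall>\<^sub>F y in nhds x. norm (f y *\<^sub>R g y - f x *\<^sub>R g x - D (y - x))
      \<le> (M * M' + \<bar>f x\<bar> * K' + K * norm (g x)) * (norm (y - x))\<^sup>2"
    using K K' M(2) M'(2)
  proof eventually_elim
    case (elim y)
    have eq: "f y *\<^sub>R g y - f x *\<^sub>R g x - D (y - x) = (f y - f x) *\<^sub>R (g y - g x)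
        + f x *\<^sub>R (g y - g x - L' (y - x)) + (f y - f x - L (y - x)) *\<^sub>R g x"
      by (simp add: D_def algebra_simps)
    have 1: "norm ((f y - f x) *\<^sub>R (g y - g x)) \<le> M * M' * (norm (y - x))\<^sup>2"
      using mult_mono[OF elim(3,4)] M by (simp add: power2_eq_square mult_ac)
    have 2: "norm (f x *\<^sub>R (g y - g x - L' (y - x))) \<le> \<bar>f x\<bar> * K' * (norm (y - x))\<^sup>2"
      using mult_left_mono[OF elim(2), of "\<bar>f x\<bar>"] by (simp add: mult_ac)
    have 3: "norm ((f y - f x - L (y - x)) *\<^sub>R g x) \<le> K * norm (g x) * (norm (y - x))\<^sup>2"
      using mult_right_mono[OF elim(1), of "norm (g x)"] by (simp add: mult_ac)
    show ?case
      unfolding eq using norm_triangle_mono[OF norm_triangle_mono[OF 1 2] 3] by (simp add: algebra_simps)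
  qed
  moreover have "bounded_linear D"
    unfolding D_def
    by (intro bounded_linear_add bounded_linear_scaleR_right[THEN bounded_linear_compose]
        bounded_linear_scaleR_left[THEN bounded_linear_compose] L L')
  ultimately show ?thesis
    unfolding quadratic_at_def by blast
qed

lemma quadratic_at_powr:
  fixes t :: real
  assumes "t > 0"
  shows "quadratic_at (\<lambda>z. z powr s) t"
proof -
  define g where "g z = s * z powr (s - 1)" for z :: real
  have "(g has_real_derivative s * ((s - 1) * t powr (s - 1 - 1))) (at t)"
    unfolding g_def using assms by (auto intro!: derivative_eq_intros)
  then obtain D where "((\<lambda>z. (g z - g t) / (z - t)) \<longlongrightarrow> D) (at t)"
    unfolding has_field_derivative_iff by blast
  then have "\<forall>\<^sub>F z in at t. norm ((g z - g t) / (z - t)) < \<bar>D\<bar> + 1"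
    by (intro order_tendstoD(2)[OF tendsto_norm]) auto
  then obtain d where d: "d > 0" "\<And>z. z \<noteq> t \<Longrightarrow> dist z t < d \<Longrightarrow> norm ((g z - g t) / (z - t)) < \<bar>D\<bar> + 1"
    unfolding eventually_at by blast
  show ?thesis
  proof (rule quadratic_at_lipschitz_gradient)
    show "min d t > 0"
      using d assms by simp
    fix z assume z: "z \<in> ball t (min d t)"
    then have "z > 0"
      by (auto simp: dist_real_def)
    then show "GDERIV (\<lambda>z. z powr s) z :> g z"
      unfolding gderiv_def g_def has_field_derivative_def[symmetric]
      by (auto intro!: derivative_eq_intros has_derivative_eq_rhs[OF has_field_derivative_imp_has_derivative])
    show "norm (g z - g t) \<le> (\<bar>D\<bar> + 1) * norm (z - t)"
    proof (cases "z = t")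
      case False
      then have "norm (g z - g t) / norm (z - t) \<le> \<bar>D\<bar> + 1"
        using d(2)[of z] z by (simp add: dist_commute norm_divide)
      then show ?thesis
        using False by (simp add: divide_le_eq)
    qed simp
  qed simp
qed

lemma norm_powr_inner: "norm y powr s = (y \<bullet> y) powr (s / 2)" for y :: "'a::real_inner"
proof -
  have "y \<bullet> y = norm y powr 2"
    by (cases "y = 0") (simp_all add: power2_norm_eq_inner[symmetric] powr_numeral)
  then show ?thesis
    by (simp only: powr_powr) simp
qed

lemma quadratic_at_norm_powr:
  fixes x :: "'a::real_inner"
  assumes "x \<noteq> 0"
  shows "quadratic_at (\<lambda>y. norm y powr s) x"
  unfolding norm_powr_inner using assms
  by (intro quadratic_at_compose[OF quadratic_at_inner_self quadratic_at_powr]) simp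

lemma quadratic_at_sph_inv:
  fixes x :: "real ^ 'n"
  assumes "x \<noteq> 0"
  shows "quadratic_at (sph_inv 1) x"
proof -
  have "sph_inv 1 = (\<lambda>y :: real ^ 'n. norm y powr (-2) *\<^sub>R y)"
    by (rule ext) (simp add: sph_inv_def powr_minus_divide powr_numeral)
  then show ?thesis
    using quadratic_at_scaleR[OF quadratic_at_norm_powr[OF assms, of "-2"] quadratic_at_ident] by simp
qed

section \<open>The Kelvin transform\<close>

definition kelvin :: "real \<Rightarrow> (real ^ 'n \<Rightarrow> real) \<Rightarrow> real ^ 'n \<Rightarrow> real" where
  "kelvin \<alpha> u y = norm y powr (\<alpha> - real CARD('n)) * u (sph_inv 1 y)"

lemma quadratic_at_kelvin:
  assumes "x \<noteq> 0" "quadratic_at u (sph_inv 1 x)"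
  shows "quadratic_at (kelvin \<alpha> u) x"
  using quadratic_at_scaleR[OF quadratic_at_norm_powr[OF assms(1)]
      quadratic_at_compose[OF quadratic_at_sph_inv[OF assms(1)] assms(2)]]
  unfolding kelvin_def by simp

lemma L_space_kelvin:
  fixes u :: "real ^ 'n \<Rightarrow> real"
  assumes u: "u \<in> L_space \<alpha>"
  shows "kelvin \<alpha> u \<in> L_space \<alpha>"
proof -
  let ?p = "real CARD('n) + \<alpha>"
  have meas: "(\<lambda>x :: real ^ 'n. 1 + norm x powr ?p) \<in> borel_measurable lebesgue"
    by (intro measurable_completion) measurable
  have pos: "1 + norm x powr ?p > 0" for x :: "real ^ 'n"
    by (simp add: add_pos_nonneg)
  have "integrable lebesgue (\<lambda>z. u z / (1 + norm z powr ?p))"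
  proof (rule Bochner_Integration.integrable_bound)
    show "integrable lebesgue (\<lambda>z. \<bar>u z\<bar> / (1 + norm z powr ?p))"
      using u by (simp add: L_space_def)
    show "(\<lambda>z. u z / (1 + norm z powr ?p)) \<in> borel_measurable lebesgue"
      using u meas unfolding L_space_def by auto
  qed (auto simp: abs_divide)
  then have "integrable lebesgue (\<lambda>x. (1 / norm x) powr (2 * real CARD('n)) *
      (u (sph_inv 1 x) / (1 + norm (sph_inv 1 x) powr ?p)))"
    by (subst inversion_integral(1)) auto
  also have "?this \<longleftrightarrow> integrable lebesgue (\<lambda>x. kelvin \<alpha> u x / (1 + norm x powr ?p))"
  proof (rule integrable_cong_AE_neq(1)[of 0])
    fix x :: "real ^ 'n" assume x: "x \<noteq> 0"
    define t where "t = norm x"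
    have t: "t > 0"
      using x by (simp add: t_def)
    have "(1 / t) powr (2 * real CARD('n)) / (1 + (1 / t) powr ?p) = t powr (- 2 * real CARD('n)) * t powr ?p / (1 + t powr ?p)"
      using t by (simp add: powr_divide powr_minus_divide divide_simps add_pos_nonneg)
    also have "t powr (- 2 * real CARD('n)) * t powr ?p = t powr (\<alpha> - real CARD('n))"
      by (simp add: powr_add[symmetric])
    finally have "(1 / t) powr (2 * real CARD('n)) / (1 + (1 / t) powr ?p) * u (sph_inv 1 x)
        = t powr (\<alpha> - real CARD('n)) / (1 + t powr ?p) * u (sph_inv 1 x)"
      by simp
    then show "(1 / norm x) powr (2 * real CARD('n)) * (u (sph_inv 1 x) / (1 + norm (sph_inv 1 x) powr ?p))
        = kelvin \<alpha> u x / (1 + norm x powr ?p)"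
      by (simp add: kelvin_def norm_sph_inv t_def)
  qed
  finally have int: "integrable lebesgue (\<lambda>x. kelvin \<alpha> u x / (1 + norm x powr ?p))" .
  have "(\<lambda>x. kelvin \<alpha> u x / (1 + norm x powr ?p) * (1 + norm x powr ?p)) \<in> borel_measurable lebesgue"
    using borel_measurable_integrable[OF int] meas by (intro borel_measurable_times)
  moreover have "kelvin \<alpha> u x / (1 + norm x powr ?p) * (1 + norm x powr ?p) = kelvin \<alpha> u x" for x
    using pos[of x] by simp
  ultimately have "kelvin \<alpha> u \<in> borel_measurable lebesgue"
    by simp
  moreover have "integrable lebesgue (\<lambda>x. \<bar>kelvin \<alpha> u x\<bar> / (1 + norm x powr ?p))"
    using integrable_abs[OF int] pos by (simp add: abs_divide add_nonneg_nonneg)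
  ultimately show ?thesis
    by (simp add: L_space_def)
qed

text \<open>The image, under the inversion, of the complement of a ball about \<open>x/|x|\<^sup>2\<close> of radius \<open>eps/|x|\<^sup>2\<close>; it is also
  the image of the complement of the ball about \<open>x\<close> of radius \<open>eps\<close> under the inversion in the sphere through \<open>x\<close>.
  It differs from the complement of the ball of radius \<open>eps\<close> about \<open>x\<close> only in a shell of thickness of order \<open>eps\<^sup>2\<close>.\<close>

definition kelvin_region :: "real ^ 'n \<Rightarrow> real \<Rightarrow> (real ^ 'n) set" where
  "kelvin_region x eps = {y. eps * norm y \<le> norm x * norm (x - y)}"

lemma power_diff_le:
  fixes a b :: real
  assumes "0 \<le> a" "a \<le> b"
  shows "b ^ n - a ^ n \<le> real n * (b - a) * b ^ (n - 1)"
proof (induction n)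
  case (Suc n)
  have "b ^ Suc n - a ^ Suc n = b * (b ^ n - a ^ n) + a ^ n * (b - a)"
    by (simp add: algebra_simps)
  also have "\<dots> \<le> b * (real n * (b - a) * b ^ (n - 1)) + b ^ n * (b - a)"
    using Suc assms by (intro add_mono mult_left_mono mult_right_mono power_mono) auto
  also have "b * (real n * (b - a) * b ^ (n - 1)) = real n * (b - a) * b ^ n"
    by (cases n) simp_all
  finally show ?case
    by (simp add: algebra_simps)
qed simp

lemma measure_ball_shell_le:
  fixes x :: "'a::euclidean_space"
  assumes "0 \<le> a" "a \<le> b"
  shows "measure lebesgue (ball x b - ball x a)
    \<le> measure lebesgue (ball (0::'a) 1) * (real DIM('a) * (b - a) * b ^ (DIM('a) - 1))"
proof -
  have eq: "measure lebesgue (ball x r) = r ^ DIM('a) * measure lebesgue (ball (0::'a) 1)" if "r \<ge> 0" for r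
    using content_ball_conv_unit_ball[OF that, of x] by simp
  have "measure lebesgue (ball x b - ball x a) = measure lebesgue (ball x b) - measure lebesgue (ball x a)"
    using assms by (intro measurable_measure_Diff) (auto intro: subset_ball)
  also have "\<dots> = measure lebesgue (ball (0::'a) 1) * (b ^ DIM('a) - a ^ DIM('a))"
    unfolding eq[OF assms(1)] eq[OF order_trans[OF assms]]
    by (simp only: left_diff_distrib[symmetric] mult.commute)
  also have "\<dots> \<le> measure lebesgue (ball (0::'a) 1) * (real DIM('a) * (b - a) * b ^ (DIM('a) - 1))"
    by (intro mult_left_mono power_diff_le assms) simp
  finally show ?thesis .
qed

lemma kelvin_region_measurable: "kelvin_region x eps \<in> sets lebesgue"
proof -
  have "closed (kelvin_region x eps)"
    unfolding kelvin_region_def by (intro closed_Collect_le continuous_intros)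
  then show ?thesis
    by auto
qed

lemma kelvin_region_dist:
  assumes x: "x \<noteq> 0" and eps: "0 < eps" "eps \<le> norm x / 4" and y: "y \<in> kelvin_region x eps"
  shows "norm (x - y) \<ge> eps - 2 * eps\<^sup>2 / norm x"
proof (cases "norm (x - y) < eps")
  case True
  have "norm y \<ge> norm x - norm (x - y)"
    using norm_triangle_ineq2[of x "x - y"] by simp
  then have "norm y \<ge> norm x - eps"
    using True by simp
  then have "eps * (norm x - eps) \<le> eps * norm y"
    using eps by (intro mult_left_mono) auto
  also have "\<dots> \<le> norm x * norm (x - y)"
    using y by (simp add: kelvin_region_def)
  finally have "eps * (norm x - eps) \<le> norm x * norm (x - y)" .
  then have "eps * (norm x - eps) / norm x \<le> norm (x - y)"
    using x by (simp add: divide_le_eq mult.commute)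
  then have "eps - eps\<^sup>2 / norm x \<le> norm (x - y)"
    using x by (simp add: right_diff_distrib diff_divide_distrib power2_eq_square)
  moreover have "eps\<^sup>2 / norm x \<ge> 0"
    by simp
  ultimately show ?thesis
    by linarith
next
  case False
  moreover have "eps\<^sup>2 / norm x \<ge> 0"
    by simp
  ultimately show ?thesis
    by linarith
qed

lemma not_kelvin_region_dist:
  assumes x: "x \<noteq> 0" and eps: "0 < eps" "eps \<le> norm x / 4" and y: "y \<notin> kelvin_region x eps"
  shows "norm (x - y) < eps + 2 * eps\<^sup>2 / norm x"
proof -
  define t where "t = norm (x - y)"
  have nx: "norm x > 0"
    using x by simp
  have "norm y \<le> norm x + t"
    using norm_triangle_ineq4[of x "x - y"] by (simp add: t_def)
  then have "eps * norm y \<le> eps * (norm x + t)"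
    using eps by (intro mult_left_mono) auto
  then have 1: "norm x * t < eps * norm x + eps * t"
    using y by (simp add: kelvin_region_def t_def distrib_left)
  have "eps * t \<le> norm x / 4 * t"
    using eps by (intro mult_right_mono) (auto simp: t_def)
  then have "norm x * t < norm x * (2 * eps)"
    using 1 mult_pos_pos[OF eps(1) nx] by (simp add: algebra_simps)
  then have "t < 2 * eps"
    using nx by simp
  then have "eps * t < eps * (2 * eps)"
    using eps by (intro mult_strict_left_mono) auto
  with 1 have "norm x * t < eps * norm x + eps * (2 * eps)"
    by linarith
  then show ?thesis
    using nx by (simp add: t_def field_simps power2_eq_square)
qed

lemma eventually_at_right_0_less:
  "d > 0 \<Longrightarrow> \<forall>\<^sub>F eps in at_right (0::real). 0 < eps \<and> eps < d"
  unfolding eventually_at_right_field by blast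

text \<open>The two domains differ inside a shell of volume of order \<open>eps\<^bsup>n+1\<^esup>\<close>, on which the integrand is of order
  \<open>eps\<^bsup>1-n-\<alpha>\<^esup>\<close>. The product \<open>eps\<^bsup>2-\<alpha>\<^esup>\<close> tends to zero, so a principal value may be computed with either truncation.\<close>

lemma pv_kelvin_region:
  fixes f :: "real ^ 'n \<Rightarrow> real"
  assumes f: "f \<in> L_space \<alpha>" "quadratic_at f x" and x: "x \<noteq> 0" and \<alpha>: "0 < \<alpha>" "\<alpha> < 2"
  shows "((\<lambda>eps. (LINT y:kelvin_region x eps|lebesgue. dq \<alpha> f x y)
      - (LINT y:(UNIV - ball x eps)|lebesgue. dq \<alpha> f x y)) \<longlongrightarrow> 0) (at_right 0)"
proof -
  let ?n = "real CARD('n)"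
  let ?p = "?n + \<alpha>"
  define \<rho> where "\<rho> = norm x"
  have \<rho>: "\<rho> > 0"
    using x by (simp add: \<rho>_def)
  obtain M where M: "M > 0" "\<forall>\<^sub>F y in nhds x. norm (f y - f x) \<le> M * norm (y - x)"
    using quadratic_at_locally_lipschitz[OF f(2)] by blast
  then obtain \<delta> where \<delta>: "\<delta> > 0" "\<And>y. dist y x < \<delta> \<Longrightarrow> norm (f y - f x) \<le> M * norm (y - x)"
    unfolding eventually_nhds_metric by blast
  define V where "V = measure lebesgue (ball (0 :: real ^ 'n) 1)"
  define c where "c = (M * 2 * 2 powr ?p) * (V * (?n * (4 / \<rho>) * 2 powr (?n - 1)))"
  have bound: "norm ((LINT y:kelvin_region x eps|lebesgue. dq \<alpha> f x y)
      - (LINT y:(UNIV - ball x eps)|lebesgue. dq \<alpha> f x y)) \<le> c * eps powr (2 - \<alpha>)"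
    if eps: "0 < eps" "eps < min (\<rho> / 4) (\<delta> / 2)" for eps
  proof -
    define lo hi where "lo = eps - 2 * eps\<^sup>2 / \<rho>" "hi = eps + 2 * eps\<^sup>2 / \<rho>"
    have "2 * eps\<^sup>2 / \<rho> = eps * (2 * eps / \<rho>)"
      by (simp add: power2_eq_square)
    also have "\<dots> \<le> eps * (1 / 2)"
      using eps \<rho> by (intro mult_left_mono) (auto simp: field_simps)
    finally have lohi: "lo \<ge> eps / 2" "hi \<le> 2 * eps" "lo \<le> hi" "hi - lo = 4 / \<rho> * eps\<^sup>2" "hi \<ge> eps"
      using eps \<rho> unfolding lo_hi_def by auto
    define P Q D where "P = kelvin_region x eps" "Q = UNIV - ball x eps" "D = ball x hi - ball x lo"
    have Pm: "P \<in> sets lebesgue" "Q \<in> sets lebesgue" "D \<in> sets lebesgue"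
      by (auto simp: P_Q_D_def kelvin_region_measurable)
    define B where "B = M * (2 * eps) * (2 powr ?p * eps powr (- ?p))"
    have intP: "integrable lebesgue (\<lambda>y. indicator P y *\<^sub>R dq \<alpha> f x y)"
      using L_space_dq_integrable[OF f(1) \<alpha>(1) _ Pm(1), of "eps / 2"] kelvin_region_dist[OF x eps(1)] eps lohi
      unfolding set_integrable_def by (force simp: P_Q_D_def \<rho>_def lo_hi_def)
    have intQ: "integrable lebesgue (\<lambda>y. indicator Q y *\<^sub>R dq \<alpha> f x y)"
      using L_space_dq_integrable[OF f(1) \<alpha>(1) _ Pm(2), of "eps"] eps
      unfolding set_integrable_def by (auto simp: P_Q_D_def dist_norm)
    have Dfin: "emeasure lebesgue D < \<infinity>"
    proof -
      have "emeasure lebesgue D \<le> emeasure lebesgue (ball x hi)"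
        by (rule emeasure_mono) (auto simp: P_Q_D_def)
      also have "\<dots> < \<infinity>"
        using emeasure_lborel_ball_finite[of x hi] by simp
      finally show ?thesis .
    qed
    have intD: "integrable lebesgue (\<lambda>y. B * indicator D y)"
      using Pm Dfin by (intro integrable_mult_right integrable_real_indicator) auto
    have inD: "y \<in> D" if "(y \<in> P) \<noteq> (y \<in> Q)" for y
      using that kelvin_region_dist[OF x eps(1), of y] not_kelvin_region_dist[OF x eps(1), of y] eps lohi
      by (auto simp: P_Q_D_def \<rho>_def lo_hi_def dist_norm)
    have dqB: "\<bar>dq \<alpha> f x y\<bar> \<le> B" if y: "y \<in> D" for y
    proof -
      have d: "norm (x - y) \<ge> eps / 2" "norm (x - y) < 2 * eps"
        using y lohi by (auto simp: P_Q_D_def dist_norm)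
      then have "\<bar>f x - f y\<bar> \<le> M * norm (x - y)"
        using \<delta>(2)[of y] eps by (simp add: dist_norm norm_minus_commute abs_minus_commute)
      also have "\<dots> \<le> M * (2 * eps)"
        using d M by (intro mult_left_mono) auto
      finally have num: "\<bar>f x - f y\<bar> \<le> M * (2 * eps)" .
      have "\<bar>dq \<alpha> f x y\<bar> = \<bar>f x - f y\<bar> * norm (x - y) powr (- ?p)"
        unfolding powr_minus_divide by (simp add: dq_def abs_divide)
      also have "\<dots> \<le> M * (2 * eps) * (eps / 2) powr (- ?p)"
        using num d eps \<alpha> M by (intro mult_mono powr_mono2') auto
      also have "(eps / 2) powr (- ?p) = 2 powr ?p * eps powr (- ?p)"
        unfolding powr_divide powr_minus_divide by simp
      finally show ?thesis
        unfolding B_def .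
    qed
    have B0: "B \<ge> 0"
      using M eps by (simp add: B_def)
    have "norm ((LINT y:P|lebesgue. dq \<alpha> f x y) - (LINT y:Q|lebesgue. dq \<alpha> f x y))
        = norm (LINT y|lebesgue. indicator P y *\<^sub>R dq \<alpha> f x y - indicator Q y *\<^sub>R dq \<alpha> f x y)"
      unfolding set_lebesgue_integral_def using intP intQ by simp
    also have "\<dots> \<le> (LINT y|lebesgue. B * indicator D y)"
    proof (rule Bochner_Integration.integral_norm_bound_integral[OF _ intD])
      show "integrable lebesgue (\<lambda>y. indicator P y *\<^sub>R dq \<alpha> f x y - indicator Q y *\<^sub>R dq \<alpha> f x y)"
        using intP intQ by simp
      show "norm (indicator P y *\<^sub>R dq \<alpha> f x y - indicator Q y *\<^sub>R dq \<alpha> f x y) \<le> B * indicator D y" for y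
        using inD[of y] dqB[of y] B0 by (cases "y \<in> P"; cases "y \<in> Q"; cases "y \<in> D") auto
    qed
    also have "\<dots> = B * measure lebesgue D"
      using Pm Dfin by simp
    also have "\<dots> \<le> B * (V * (?n * (hi - lo) * hi ^ (CARD('n) - 1)))"
      using measure_ball_shell_le[of lo hi x] lohi eps B0
      by (intro mult_left_mono) (auto simp: P_Q_D_def V_def)
    also have "\<dots> \<le> B * (V * (?n * (4 / \<rho> * eps\<^sup>2) * (2 * eps) ^ (CARD('n) - 1)))"
      unfolding lohi(4)
      using lohi eps B0 \<rho> by (intro mult_left_mono power_mono) (auto simp: V_def)
    also have "(2 * eps) ^ (CARD('n) - 1) = 2 powr (?n - 1) * eps powr (?n - 1)"
    proof -
      have "(2 * eps) ^ (CARD('n) - 1) = (2 * eps) powr real (CARD('n) - 1)"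
        using eps by (intro powr_realpow[symmetric]) auto
      then show ?thesis
        by (simp add: powr_mult of_nat_diff Suc_leI)
    qed
    also have "B * (V * (?n * (4 / \<rho> * eps\<^sup>2) * (2 powr (?n - 1) * eps powr (?n - 1))))
        = c * (eps * eps powr (- ?p) * eps\<^sup>2 * eps powr (?n - 1))"
      by (simp add: B_def c_def)
    also have "eps * eps powr (- ?p) * eps\<^sup>2 * eps powr (?n - 1) = eps powr 1 * eps powr (- ?p) * eps powr 2 * eps powr (?n - 1)"
      using eps by (simp add: powr_numeral)
    also have "\<dots> = eps powr (2 - \<alpha>)"
      by (simp only: powr_add[symmetric]) simp
    finally show ?thesis
      unfolding P_Q_D_def .
  qed
  have "\<forall>\<^sub>F eps in at_right (0::real). 0 < eps \<and> eps < min (\<rho> / 4) (\<delta> / 2)"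
    using \<rho> \<delta> by (intro eventually_at_right_0_less) auto
  then have ev: "\<forall>\<^sub>F eps in at_right 0. norm ((LINT y:kelvin_region x eps|lebesgue. dq \<alpha> f x y)
      - (LINT y:(UNIV - ball x eps)|lebesgue. dq \<alpha> f x y)) \<le> c * eps powr (2 - \<alpha>)"
    by eventually_elim (use bound in blast)
  have "((\<lambda>eps. eps powr (2 - \<alpha>)) \<longlongrightarrow> 0 powr (2 - \<alpha>)) (at_right (0::real))"
    by (intro tendsto_powr') (use \<alpha> in \<open>auto simp: eventually_at_filter intro!: tendsto_intros\<close>)
  then have "((\<lambda>eps. c * eps powr (2 - \<alpha>)) \<longlongrightarrow> c * 0) (at_right (0::real))"
    by (intro tendsto_mult_left) simp
  then show ?thesis
    by (intro Lim_null_comparison[OF ev]) simp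
qed

lemma norm_diff_sph_inv_fixed:
  assumes "x \<noteq> 0" "y \<noteq> 0"
  shows "norm (x - sph_inv (norm x) y) = norm x * norm (x - y) / norm y"
proof -
  have "sph_inv (norm x) x = x"
    using assms by (simp add: sph_inv_def)
  then show ?thesis
    using norm_diff_sph_inv[of "norm x" x y] assms by (simp add: power2_eq_square)
qed

lemma kelvin_one: "kelvin \<alpha> (\<lambda>_. 1) = (\<lambda>y :: real ^ 'n. norm y powr (\<alpha> - real CARD('n)))"
  by (simp add: kelvin_def fun_eq_iff)

text \<open>The Kelvin transform of the constant \<open>1\<close> is \<open>\<phi>(y) = |y|\<^bsup>\<alpha>-n\<^esup>\<close>. The inversion in the sphere through \<open>x\<close> fixes
  \<open>x\<close> and exchanges the two terms of \<open>\<phi>(x) - \<phi>(y)\<close>, up to the conformal weight. As both truncations have the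
  same limit, that limit equals its own negative: \<open>(-\<Delta>)\<^bsup>\<alpha>/2\<^esup>\<phi> = 0\<close> off the origin, with no explicit
  integration.\<close>

lemma fundamental_solution_antisymmetry:
  fixes x :: "real ^ 'n"
  assumes x: "x \<noteq> 0"
  shows "(LINT y:(UNIV - ball x eps)|lebesgue. dq \<alpha> (kelvin \<alpha> (\<lambda>_. 1)) x y)
    = - (LINT y:kelvin_region x eps|lebesgue. dq \<alpha> (kelvin \<alpha> (\<lambda>_. 1)) x y)"
proof -
  let ?n = "real CARD('n)" and ?\<phi> = "kelvin \<alpha> (\<lambda>_. 1) :: real ^ 'n \<Rightarrow> real"
  let ?p = "?n + \<alpha>"
  define \<rho> where "\<rho> = norm x"
  have \<rho>: "\<rho> > 0"
    using x by (simp add: \<rho>_def)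
  define F where "F y = indicator (UNIV - ball x eps) y *\<^sub>R dq \<alpha> ?\<phi> x y" for y
  have "(LINT y|lebesgue. F y) = (LINT z|lebesgue. (\<rho> / norm z) powr (2 * ?n) * F (sph_inv \<rho> z))"
    by (rule inversion_integral(2)[OF \<rho>, symmetric])
  also have "\<dots> = (LINT z|lebesgue. - (indicator (kelvin_region x eps) z *\<^sub>R dq \<alpha> ?\<phi> x z))"
  proof (rule integrable_cong_AE_neq(2)[of 0])
    fix z :: "real ^ 'n" assume z: "z \<noteq> 0"
    define t where "t = norm z"
    have t: "t > 0"
      using z by (simp add: t_def)
    have d: "norm (x - sph_inv \<rho> z) = \<rho> * norm (x - z) / t"
      using norm_diff_sph_inv_fixed[OF x z] by (simp add: \<rho>_def t_def)
    have "sph_inv \<rho> z \<in> UNIV - ball x eps \<longleftrightarrow> z \<in> kelvin_region x eps"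
      using t by (simp add: dist_norm d kelvin_region_def \<rho>_def[symmetric] t_def[symmetric] not_less pos_le_divide_eq)
    then have ind: "indicator (UNIV - ball x eps) (sph_inv \<rho> z) = (indicator (kelvin_region x eps) z :: real)"
      by (simp add: indicator_def)
    have "?\<phi> x - ?\<phi> (sph_inv \<rho> z) = \<rho> powr (\<alpha> - ?n) - (\<rho>\<^sup>2 / t) powr (\<alpha> - ?n)"
      using \<rho> by (simp add: kelvin_one norm_sph_inv t_def) (simp add: \<rho>_def)
    also have "\<rho>\<^sup>2 / t = \<rho> * (\<rho> / t)"
      by (simp add: power2_eq_square)
    also have "\<rho> powr (\<alpha> - ?n) - (\<rho> * (\<rho> / t)) powr (\<alpha> - ?n)
        = - ((\<rho> / t) powr (\<alpha> - ?n) * (\<rho> powr (\<alpha> - ?n) - t powr (\<alpha> - ?n)))"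
      using t \<rho> by (simp add: powr_mult powr_divide field_simps)
    finally have num: "?\<phi> x - ?\<phi> (sph_inv \<rho> z) = - ((\<rho> / t) powr (\<alpha> - ?n) * (?\<phi> x - ?\<phi> z))"
      by (simp add: kelvin_one \<rho>_def t_def)
    have den: "norm (x - sph_inv \<rho> z) powr ?p = (\<rho> / t) powr ?p * norm (x - z) powr ?p"
      unfolding d powr_mult[symmetric] by simp
    have one: "(\<rho> / t) powr (2 * ?n) * (\<rho> / t) powr (\<alpha> - ?n) / (\<rho> / t) powr ?p = 1"
    proof -
      have "(\<rho> / t) powr (2 * ?n) * (\<rho> / t) powr (\<alpha> - ?n) = (\<rho> / t) powr ?p"
        unfolding powr_add[symmetric] by simp
      then show ?thesis
        using \<rho> t by simp
    qed
    have "(\<rho> / norm z) powr (2 * ?n) * dq \<alpha> ?\<phi> x (sph_inv \<rho> z)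
        = - (((\<rho> / t) powr (2 * ?n) * (\<rho> / t) powr (\<alpha> - ?n) / (\<rho> / t) powr ?p) * dq \<alpha> ?\<phi> x z)"
      unfolding dq_def num den t_def[symmetric] by simp
    then show "(\<rho> / norm z) powr (2 * ?n) * F (sph_inv \<rho> z) = - (indicator (kelvin_region x eps) z *\<^sub>R dq \<alpha> ?\<phi> x z)"
      unfolding one F_def ind by (cases "z \<in> kelvin_region x eps") simp_all
  qed
  finally show ?thesis
    by (simp add: F_def set_lebesgue_integral_def)
qed

text \<open>With \<open>x' = x/|x|\<^sup>2\<close> one has \<open>U(x) - U(y) = \<phi>(y) (u(x') - u(y')) + u(x') (\<phi>(x) - \<phi>(y))\<close>. The first term
  is carried by the inversion to the difference quotient of \<open>u\<close> at \<open>x'\<close>, because the weights \<open>|y|\<^bsup>\<alpha>-n\<^esup>\<close>,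
  \<open>|y|\<^bsup>n+\<alpha>\<^esup>\<close> from the kernel and \<open>|y|\<^bsup>-2n\<^esup>\<close> from the Jacobian match.\<close>

lemma kelvin_dq_integral:
  fixes u :: "real ^ 'n \<Rightarrow> real"
  assumes u: "u \<in> L_space \<alpha>" and \<alpha>: "\<alpha> > 0" and x: "x \<noteq> 0" and eps: "0 < eps" "eps < norm x / 4"
  shows "(LINT y:kelvin_region x eps|lebesgue. dq \<alpha> (kelvin \<alpha> u) x y)
    = norm x powr (- (real CARD('n) + \<alpha>)) *
        (LINT z:(UNIV - ball (sph_inv 1 x) (eps / (norm x)\<^sup>2))|lebesgue. dq \<alpha> u (sph_inv 1 x) z)
      + u (sph_inv 1 x) * (LINT y:kelvin_region x eps|lebesgue. dq \<alpha> (kelvin \<alpha> (\<lambda>_. 1)) x y)"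
proof -
  let ?n = "real CARD('n)" and ?\<phi> = "kelvin \<alpha> (\<lambda>_. 1) :: real ^ 'n \<Rightarrow> real"
  let ?p = "?n + \<alpha>"
  define x' where "x' = sph_inv 1 x"
  define \<rho> where "\<rho> = norm x"
  have \<rho>: "\<rho> > 0"
    using x by (simp add: \<rho>_def)
  define F where "F z = indicator (UNIV - ball x' (eps / \<rho>\<^sup>2)) z *\<^sub>R dq \<alpha> u x' z" for z
  have intF: "integrable lebesgue F"
  proof -
    have "set_integrable lebesgue (UNIV - ball x' (eps / \<rho>\<^sup>2)) (dq \<alpha> u x')"
      using eps \<rho> by (intro L_space_dq_integrable[OF u \<alpha>, of "eps / \<rho>\<^sup>2"]) (auto simp: dist_norm)
    then show ?thesis
      unfolding set_integrable_def F_def .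
  qed
  have int\<phi>: "integrable lebesgue (\<lambda>y. indicator (kelvin_region x eps) y *\<^sub>R dq \<alpha> ?\<phi> x y)"
  proof -
    have "2 * eps\<^sup>2 / norm x = eps * (2 * eps / norm x)"
      by (simp add: power2_eq_square)
    also have "\<dots> \<le> eps * (1 / 2)"
      using eps x by (intro mult_left_mono) (auto simp: field_simps)
    finally have le: "eps / 2 \<le> eps - 2 * eps\<^sup>2 / norm x"
      by simp
    have "set_integrable lebesgue (kelvin_region x eps) (dq \<alpha> ?\<phi> x)"
    proof (rule L_space_dq_integrable[OF L_space_kelvin[OF L_space_const[OF \<alpha>]] \<alpha> _ kelvin_region_measurable])
      show "eps / 2 > 0"
        using eps by simp
      show "eps / 2 \<le> norm (x - y)" if "y \<in> kelvin_region x eps" for y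
        using kelvin_region_dist[OF x eps(1) _ that] le eps by linarith
    qed
    then show ?thesis
      unfolding set_integrable_def .
  qed
  let ?G = "\<lambda>y. \<rho> powr (- ?p) * ((1 / norm y) powr (2 * ?n) * F (sph_inv 1 y))"
  have "(LINT y|lebesgue. indicator (kelvin_region x eps) y *\<^sub>R dq \<alpha> (kelvin \<alpha> u) x y)
      = (LINT y|lebesgue. ?G y + u x' * (indicator (kelvin_region x eps) y *\<^sub>R dq \<alpha> ?\<phi> x y))"
  proof (rule integrable_cong_AE_neq(2)[of 0])
    fix y :: "real ^ 'n" assume y: "y \<noteq> 0"
    define t where "t = norm y"
    have t: "t > 0"
      using y by (simp add: t_def)
    have d: "norm (x' - sph_inv 1 y) = norm (x - y) / (\<rho> * t)"
      using norm_diff_sph_inv[of 1 x y] x y by (simp add: x'_def \<rho>_def t_def)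
    have "sph_inv 1 y \<in> UNIV - ball x' (eps / \<rho>\<^sup>2) \<longleftrightarrow> y \<in> kelvin_region x eps"
      using t \<rho> by (simp add: dist_norm d kelvin_region_def \<rho>_def[symmetric] t_def[symmetric] not_less field_simps power2_eq_square)
    then have ind: "indicator (UNIV - ball x' (eps / \<rho>\<^sup>2)) (sph_inv 1 y) = (indicator (kelvin_region x eps) y :: real)"
      by (simp add: indicator_def)
    have num: "kelvin \<alpha> u x - kelvin \<alpha> u y
        = t powr (\<alpha> - ?n) * (u x' - u (sph_inv 1 y)) + u x' * (?\<phi> x - ?\<phi> y)"
      by (simp add: kelvin_def x'_def t_def algebra_simps)
    have coef: "\<rho> powr (- ?p) * (1 / t) powr (2 * ?n) / (1 / (\<rho> * t)) powr ?p = t powr (\<alpha> - ?n)"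
    proof -
      have "(1 / t) powr (2 * ?n) = t powr (- (2 * ?n))"
        unfolding powr_minus_divide by (simp add: powr_divide)
      moreover have "1 / (1 / (\<rho> * t)) powr ?p = \<rho> powr ?p * t powr ?p"
        using \<rho> t by (simp add: powr_divide powr_mult)
      ultimately have "\<rho> powr (- ?p) * (1 / t) powr (2 * ?n) / (1 / (\<rho> * t)) powr ?p
          = (\<rho> powr (- ?p) * \<rho> powr ?p) * (t powr (- (2 * ?n)) * t powr ?p)"
        by (simp only: divide_inverse mult_1_left mult_ac)
      also have "\<dots> = t powr (\<alpha> - ?n)"
        unfolding powr_add[symmetric] using \<rho> by simp
      finally show ?thesis .
    qed
    have "norm (x' - sph_inv 1 y) powr ?p = (1 / (\<rho> * t)) powr ?p * norm (x - y) powr ?p"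
      unfolding d powr_mult[symmetric] by simp
    then have "\<rho> powr (- ?p) * ((1 / t) powr (2 * ?n) * dq \<alpha> u x' (sph_inv 1 y))
        = (\<rho> powr (- ?p) * (1 / t) powr (2 * ?n) / (1 / (\<rho> * t)) powr ?p) * (u x' - u (sph_inv 1 y)) / norm (x - y) powr ?p"
      by (simp add: dq_def)
    also have "\<dots> = t powr (\<alpha> - ?n) * (u x' - u (sph_inv 1 y)) / norm (x - y) powr ?p"
      unfolding coef ..
    finally have "dq \<alpha> (kelvin \<alpha> u) x y
        = \<rho> powr (- ?p) * ((1 / t) powr (2 * ?n) * dq \<alpha> u x' (sph_inv 1 y)) + u x' * dq \<alpha> ?\<phi> x y"
      by (simp add: dq_def[of _ "kelvin _ _"] num add_divide_distrib)
    then show "indicator (kelvin_region x eps) y *\<^sub>R dq \<alpha> (kelvin \<alpha> u) x y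
        = ?G y + u x' * (indicator (kelvin_region x eps) y *\<^sub>R dq \<alpha> ?\<phi> x y)"
      unfolding F_def ind t_def[symmetric] by (simp add: algebra_simps)
  qed
  also have "\<dots> = (LINT y|lebesgue. ?G y) + (LINT y|lebesgue. u x' * (indicator (kelvin_region x eps) y *\<^sub>R dq \<alpha> ?\<phi> x y))"
    using intF int\<phi> inversion_integral(1)[of 1 F]
    by (intro Bochner_Integration.integral_add integrable_mult_right) auto
  also have "(LINT y|lebesgue. ?G y) = \<rho> powr (- ?p) * (LINT z|lebesgue. F z)"
    using inversion_integral(2)[of 1 F] by simp
  finally show ?thesis
    by (simp add: set_lebesgue_integral_def F_def x'_def \<rho>_def)
qed

lemma kelvin_pv:
  fixes u :: "real ^ 'n \<Rightarrow> real"
  assumes u: "u \<in> L_space \<alpha>" "quadratic_at u (sph_inv 1 x)" and \<alpha>: "0 < \<alpha>" "\<alpha> < 2" and x: "x \<noteq> 0"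
    and L: "has_pv \<alpha> u (sph_inv 1 x) L"
  shows "has_pv \<alpha> (kelvin \<alpha> u) x (norm x powr (- (real CARD('n) + \<alpha>)) * L)"
proof -
  let ?\<phi> = "kelvin \<alpha> (\<lambda>_. 1) :: real ^ 'n \<Rightarrow> real"
  define J where "J f eps = (LINT y:(UNIV - ball x eps)|lebesgue. dq \<alpha> f x y)" for f eps
  define I where "I f eps = (LINT y:kelvin_region x eps|lebesgue. dq \<alpha> f x y)" for f eps
  have diff: "((\<lambda>eps. I f eps - J f eps) \<longlongrightarrow> 0) (at_right 0)" if "f \<in> L_space \<alpha>" "quadratic_at f x" for f
    unfolding I_def J_def by (rule pv_kelvin_region[OF that x \<alpha>])
  have "((\<lambda>eps. I ?\<phi> eps - J ?\<phi> eps) \<longlongrightarrow> 0) (at_right 0)"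
    by (intro diff L_space_kelvin L_space_const quadratic_at_kelvin quadratic_at_const x \<alpha>)
  moreover have "I ?\<phi> eps = - J ?\<phi> eps" for eps
    unfolding I_def J_def using fundamental_solution_antisymmetry[OF x, of eps \<alpha>] by simp
  ultimately have "((\<lambda>eps. I ?\<phi> eps + I ?\<phi> eps) \<longlongrightarrow> 0) (at_right 0)"
    by simp
  from tendsto_mult_left[OF this, of "1/2"] have I\<phi>: "(I ?\<phi> \<longlongrightarrow> 0) (at_right 0)"
    by simp
  have "filterlim (\<lambda>eps. eps / (norm x)\<^sup>2) (at_right 0) (at_right (0::real))"
  proof (rule filterlim_at_withinI)
    show "((\<lambda>eps. eps / (norm x)\<^sup>2) \<longlongrightarrow> 0) (at_right (0::real))"
      using tendsto_divide[OF tendsto_ident_at tendsto_const, of "(norm x)\<^sup>2" 0 "{0<..}"] x by simp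
    show "\<forall>\<^sub>F eps in at_right (0::real). eps / (norm x)\<^sup>2 \<in> {0<..} - {0}"
      using eventually_at_right_less by eventually_elim (simp add: x)
  qed
  from filterlim_compose[OF L this]
  have L': "((\<lambda>eps. LINT z:(UNIV - ball (sph_inv 1 x) (eps / (norm x)\<^sup>2))|lebesgue. dq \<alpha> u (sph_inv 1 x) z) \<longlongrightarrow> L) (at_right 0)" .
  have "((\<lambda>eps. norm x powr (- (real CARD('n) + \<alpha>)) *
        (LINT z:(UNIV - ball (sph_inv 1 x) (eps / (norm x)\<^sup>2))|lebesgue. dq \<alpha> u (sph_inv 1 x) z)
      + u (sph_inv 1 x) * I ?\<phi> eps) \<longlongrightarrow> norm x powr (- (real CARD('n) + \<alpha>)) * L + u (sph_inv 1 x) * 0) (at_right 0)"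
    by (intro tendsto_intros L' I\<phi>)
  moreover have "\<forall>\<^sub>F eps in at_right (0::real). norm x powr (- (real CARD('n) + \<alpha>)) *
        (LINT z:(UNIV - ball (sph_inv 1 x) (eps / (norm x)\<^sup>2))|lebesgue. dq \<alpha> u (sph_inv 1 x) z)
      + u (sph_inv 1 x) * I ?\<phi> eps = I (kelvin \<alpha> u) eps"
  proof -
    have "\<forall>\<^sub>F eps in at_right (0::real). 0 < eps \<and> eps < norm x / 4"
      using x by (intro eventually_at_right_0_less) auto
    then show ?thesis
      by eventually_elim (simp add: I_def kelvin_dq_integral[OF u(1) \<alpha>(1) x])
  qed
  ultimately have "(I (kelvin \<alpha> u) \<longlongrightarrow> norm x powr (- (real CARD('n) + \<alpha>)) * L) (at_right 0)"
    using tendsto_cong by fastforce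
  moreover have "((\<lambda>eps. I (kelvin \<alpha> u) eps - J (kelvin \<alpha> u) eps) \<longlongrightarrow> 0) (at_right 0)"
    by (intro diff L_space_kelvin quadratic_at_kelvin x u)
  ultimately have "((\<lambda>eps. I (kelvin \<alpha> u) eps - (I (kelvin \<alpha> u) eps - J (kelvin \<alpha> u) eps))
      \<longlongrightarrow> norm x powr (- (real CARD('n) + \<alpha>)) * L - 0) (at_right 0)"
    by (rule tendsto_diff)
  then show ?thesis
    by (simp add: J_def)
qed

section \<open>Antisymmetric functions at a minimum\<close>

lemma set_integral_negative:
  fixes g :: "real ^ 'n \<Rightarrow> real"
  assumes int: "set_integrable lebesgue E g" and E: "E \<in> sets lebesgue" "ball z \<rho> \<subseteq> E" "\<rho> > 0"
    and neg: "\<And>y. y \<in> E \<Longrightarrow> y \<noteq> s \<Longrightarrow> g y < 0"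
  shows "(LINT y:E|lebesgue. g y) < 0"
proof -
  have int': "integrable lebesgue (\<lambda>y. - (indicator E y *\<^sub>R g y))"
    using int unfolding set_integrable_def by (rule Bochner_Integration.integrable_minus)
  have nonneg: "AE y in lebesgue. 0 \<le> - (indicator E y *\<^sub>R g y)"
    using AE_lebesgue_neq[of s]
  proof eventually_elim
    case (elim y)
    then show ?case
      using neg[of y] by (cases "y \<in> E") auto
  qed
  have "(LINT y|lebesgue. - (indicator E y *\<^sub>R g y)) \<noteq> 0"
  proof
    assume "(LINT y|lebesgue. - (indicator E y *\<^sub>R g y)) = 0"
    then have "AE y in lebesgue. - (indicator E y *\<^sub>R g y) = 0"
      using integral_nonneg_eq_0_iff_AE[OF int' nonneg] by blast
    then have "AE y in lebesgue. y \<notin> E"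
      using AE_lebesgue_neq[of s]
    proof eventually_elim
      case (elim y)
      then show ?case
        using neg[of y] by (auto simp: indicator_def split: if_splits)
    qed
    then have "AE y in lebesgue. y \<notin> ball z \<rho>"
      by eventually_elim (use E in blast)
    then have "emeasure lebesgue (ball z \<rho>) = 0"
      by (subst (asm) AE_iff_measurable[where N = "ball z \<rho>"]) auto
    then have "measure lebesgue (ball z \<rho>) = 0"
      by (simp add: measure_def)
    then show False
      using content_ball_pos[of \<rho> z] E by simp
  qed
  moreover have "(LINT y|lebesgue. - (indicator E y *\<^sub>R g y)) \<ge> 0"
    by (rule integral_nonneg_AE[OF nonneg])
  ultimately show ?thesis
    by (simp add: set_lebesgue_integral_def)
qed

definition mirror :: "real ^ 'n \<Rightarrow> real \<Rightarrow> real ^ 'n \<Rightarrow> real ^ 'n" where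
  "mirror e \<mu> y = y + (2 * (\<mu> - y \<bullet> e)) *\<^sub>R e"

definition half_space :: "real ^ 'n \<Rightarrow> real \<Rightarrow> (real ^ 'n) set" where
  "half_space e \<mu> = {y. y \<bullet> e < \<mu>}"

text \<open>The bound \<open>antisymmetric_negative_minimum\<close> comes from a single ball of radius \<open>d/4\<close>, whose mirror image lies
  within distance \<open>6d\<close> of \<open>x\<close>; this is the constant that results for \<open>d = 1\<close>.\<close>

definition min_const :: "real \<Rightarrow> 'n::finite itself \<Rightarrow> real" where
  "min_const \<alpha> _ = 2 * 6 powr (- (real CARD('n) + \<alpha>)) * (1/4) ^ CARD('n) * measure lebesgue (ball (0 :: real ^ 'n) 1)"

lemma min_const_pos: "min_const \<alpha> TYPE('n::finite) > 0"
  unfolding min_const_def using content_ball_pos[of 1 "0 :: real ^ 'n"] by simp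

context
  fixes e :: "real ^ 'n"
  assumes e: "norm e = 1"
begin

lemma unit_inner_self: "e \<bullet> e = 1"
  using e by (simp add: norm_eq_sqrt_inner)

lemma mirror_inner: "mirror e \<mu> y \<bullet> e = 2 * \<mu> - y \<bullet> e"
  by (simp add: mirror_def inner_add_left unit_inner_self algebra_simps)

lemma mirror_mirror: "mirror e \<mu> (mirror e \<mu> y) = y"
  unfolding mirror_def[of e \<mu> "mirror e \<mu> y"] mirror_inner by (simp add: mirror_def algebra_simps)

lemma norm_diff_mirror_sq: "(norm (x - mirror e \<mu> y))\<^sup>2 = (norm (x - y))\<^sup>2 + 4 * (\<mu> - x \<bullet> e) * (\<mu> - y \<bullet> e)"
proof -
  have "(norm (z - s *\<^sub>R e))\<^sup>2 = (norm z)\<^sup>2 - 2 * s * (z \<bullet> e) + s\<^sup>2" for z s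
    unfolding power2_norm_eq_inner
    by (simp add: inner_diff_left inner_diff_right unit_inner_self inner_commute power2_eq_square)
  from this[of "x - y" "2 * (\<mu> - y \<bullet> e)"] show ?thesis
    by (simp add: mirror_def diff_diff_add inner_diff_left power2_eq_square algebra_simps)
qed

lemma norm_mirror_diff: "norm (mirror e \<mu> x - mirror e \<mu> y) = norm (x - y)"
proof -
  have "(norm (mirror e \<mu> x - mirror e \<mu> y))\<^sup>2 = (norm (mirror e \<mu> x - y))\<^sup>2 + 4 * (\<mu> - mirror e \<mu> x \<bullet> e) * (\<mu> - y \<bullet> e)"
    by (rule norm_diff_mirror_sq)
  also have "(norm (mirror e \<mu> x - y))\<^sup>2 = (norm (y - x))\<^sup>2 + 4 * (\<mu> - y \<bullet> e) * (\<mu> - x \<bullet> e)"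
    unfolding norm_minus_commute[of "mirror e \<mu> x" y] by (rule norm_diff_mirror_sq)
  finally have "(norm (mirror e \<mu> x - mirror e \<mu> y))\<^sup>2 = (norm (x - y))\<^sup>2"
    unfolding mirror_inner norm_minus_commute[of y x] by (simp add: algebra_simps)
  then show ?thesis
    by simp
qed

lemma mirror_integral:
  fixes f :: "real ^ 'n \<Rightarrow> real"
  shows "integrable lebesgue (\<lambda>x. f (mirror e \<mu> x)) \<longleftrightarrow> integrable lebesgue f"
    and "(LINT x|lebesgue. f (mirror e \<mu> x)) = (LINT x|lebesgue. f x)"
proof -
  let ?L = "\<lambda>y. y - (2 * (y \<bullet> e)) *\<^sub>R e"
  have lin: "linear ?L"
    by (rule linearI) (simp_all add: inner_add_left algebra_simps)
  have eq: "mirror e \<mu> x = (2 * \<mu>) *\<^sub>R e + ?L x" for x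
    by (simp add: mirror_def algebra_simps)
  have iso: "norm (?L h) = norm h" for h
    using norm_mirror_diff[of 0 h 0] by (simp add: mirror_def)
  note * = isometric_involution_integral[OF mirror_mirror lin iso eq]
  show "integrable lebesgue (\<lambda>x. f (mirror e \<mu> x)) \<longleftrightarrow> integrable lebesgue f"
    by (rule *(1))
  show "(LINT x|lebesgue. f (mirror e \<mu> x)) = (LINT x|lebesgue. f x)"
    by (rule *(2))
qed

lemma half_space_measurable: "half_space e \<mu> \<in> sets lebesgue"
proof -
  have "open (half_space e \<mu>)"
    unfolding half_space_def by (intro open_Collect_less continuous_intros)
  then show ?thesis
    by auto
qed

lemma dist_mirror_ge:
  assumes "y \<bullet> e \<le> \<mu>"
  shows "norm (x - mirror e \<mu> y) \<ge> \<mu> - x \<bullet> e"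
proof -
  have "\<mu> - x \<bullet> e \<le> (mirror e \<mu> y - x) \<bullet> e"
    using assms by (simp add: inner_diff_left mirror_inner)
  also have "\<dots> \<le> norm (mirror e \<mu> y - x) * norm e"
    by (rule norm_cauchy_schwarz)
  finally show ?thesis
    using e by (simp add: norm_minus_commute)
qed

lemma norm_diff_less_mirror:
  assumes "x \<in> half_space e \<mu>" "y \<in> half_space e \<mu>"
  shows "norm (x - y) < norm (x - mirror e \<mu> y)"
proof -
  have "4 * (\<mu> - x \<bullet> e) * (\<mu> - y \<bullet> e) > 0"
    using assms by (intro mult_pos_pos) (auto simp: half_space_def)
  then have "(norm (x - y))\<^sup>2 < (norm (x - mirror e \<mu> y))\<^sup>2"
    unfolding norm_diff_mirror_sq by linarith
  then show ?thesis
    by (rule power2_less_imp_less) simp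
qed

lemma kernel_mirror_less:
  assumes "x \<in> half_space e \<mu>" "y \<in> half_space e \<mu>" "x \<noteq> y" "p > 0"
  shows "1 / norm (x - mirror e \<mu> y) powr p < 1 / norm (x - y) powr p"
proof -
  have "norm (x - y) powr p < norm (x - mirror e \<mu> y) powr p"
    using norm_diff_less_mirror[OF assms(1,2)] assms(4) by (intro powr_less_mono2) auto
  then show ?thesis
    using assms(3) by (intro frac_less2) auto
qed

text \<open>The basic inequality of the method. The half space beyond the mirror is folded back by the
  reflection, where \<open>w\<close> changes sign; with the kernels \<open>k(y) = |x - y|\<^bsup>-n-\<alpha>\<^esup>\<close> and \<open>k'(y) = |x - y'|\<^bsup>-n-\<alpha>\<^esup>\<close> the sum of
  the two integrands is \<open>2 w(x) k' - (w(y) - w(x)) (k - k')\<close>. At a nonpositive minimum both parts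
  are nonpositive since \<open>k \<ge> k'\<close>, so the integral may be restricted to any set \<open>E\<close> at positive distance from \<open>x\<close>.
  The point \<open>s\<close> at which the minimum inequality may fail is a null set; it will be the mirror image of the origin.\<close>

lemma antisymmetric_pv_bound:
  fixes U :: "real ^ 'n \<Rightarrow> real"
  defines "w \<equiv> \<lambda>\<mu> y. U (mirror e \<mu> y) - U y"
  assumes U: "U \<in> L_space \<alpha>" and \<alpha>: "\<alpha> > 0"
    and x: "x \<in> half_space e \<mu>" and cont: "isCont (w \<mu>) x"
    and a: "has_pv \<alpha> U x a"
    and b: "has_pv \<alpha> U (mirror e \<mu> x) b"
    and nonpos: "w \<mu> x \<le> 0"
    and min: "\<And>y. y \<in> half_space e \<mu> \<Longrightarrow> y \<noteq> s \<Longrightarrow> w \<mu> x \<le> w \<mu> y"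
    and E: "E \<in> sets lebesgue" "E \<subseteq> half_space e \<mu>" "\<eta> > 0" "\<And>y. y \<in> E \<Longrightarrow> norm (x - y) \<ge> \<eta>"
  defines "g \<equiv> \<lambda>y. 2 * w \<mu> x / norm (x - mirror e \<mu> y) powr (real CARD('n) + \<alpha>)
      - (w \<mu> y - w \<mu> x) * (1 / norm (x - y) powr (real CARD('n) + \<alpha>) - 1 / norm (x - mirror e \<mu> y) powr (real CARD('n) + \<alpha>))"
  shows "set_integrable lebesgue E g" "b - a \<le> (LINT y:E|lebesgue. g y)"
proof -
  let ?p = "real CARD('n) + \<alpha>"
  let ?R = "mirror e \<mu>" and ?W = "w \<mu>" and ?\<Sigma> = "half_space e \<mu>"
  define d where "d = \<mu> - x \<bullet> e"
  have d: "d > 0"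
    using x by (simp add: d_def half_space_def)
  have p: "?p > 0"
    using \<alpha> by simp
  define f where "f y = dq \<alpha> ?W x y" for y
  have f_eq: "f y = dq \<alpha> U (?R x) (?R y) - dq \<alpha> U x y" for y
    unfolding f_def dq_def w_def norm_mirror_diff by (simp add: diff_divide_distrib)
  have anti: "?W (?R y) = - ?W y" for y
    by (simp add: w_def mirror_mirror)
  have int1: "integrable lebesgue (\<lambda>y. indicator (UNIV - ball x eps) y *\<^sub>R dq \<alpha> U x y)" if "eps > 0" for eps
    using L_space_dq_integrable[OF U \<alpha> that, of "UNIV - ball x eps" x]
    unfolding set_integrable_def by (auto simp: dist_norm)
  have ind: "indicator (UNIV - ball (?R x) eps) (?R y) = (indicator (UNIV - ball x eps) y :: real)" for y eps
    by (simp add: indicator_def dist_norm norm_mirror_diff)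
  have int2: "integrable lebesgue (\<lambda>y. indicator (UNIV - ball x eps) y *\<^sub>R dq \<alpha> U (?R x) (?R y))"
    and eq2: "(LINT y|lebesgue. indicator (UNIV - ball x eps) y *\<^sub>R dq \<alpha> U (?R x) (?R y))
        = (LINT y:(UNIV - ball (?R x) eps)|lebesgue. dq \<alpha> U (?R x) y)" if "eps > 0" for eps
  proof -
    have "integrable lebesgue (\<lambda>y. indicator (UNIV - ball (?R x) eps) y *\<^sub>R dq \<alpha> U (?R x) y)"
      using L_space_dq_integrable[OF U \<alpha> that, of "UNIV - ball (?R x) eps" "?R x"]
      unfolding set_integrable_def by (auto simp: dist_norm)
    then show "integrable lebesgue (\<lambda>y. indicator (UNIV - ball x eps) y *\<^sub>R dq \<alpha> U (?R x) (?R y))"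
      using mirror_integral(1)[of "\<lambda>y. indicator (UNIV - ball (?R x) eps) y *\<^sub>R dq \<alpha> U (?R x) y" \<mu>]
      by (simp only: ind)
    show "(LINT y|lebesgue. indicator (UNIV - ball x eps) y *\<^sub>R dq \<alpha> U (?R x) (?R y))
        = (LINT y:(UNIV - ball (?R x) eps)|lebesgue. dq \<alpha> U (?R x) y)"
      using mirror_integral(2)[of "\<lambda>y. indicator (UNIV - ball (?R x) eps) y *\<^sub>R dq \<alpha> U (?R x) y" \<mu>]
      by (simp only: ind set_lebesgue_integral_def)
  qed
  have intf: "integrable lebesgue (\<lambda>y. indicator (UNIV - ball x eps) y *\<^sub>R f y)" if "eps > 0" for eps
    unfolding f_eq scaleR_diff_right using int1[OF that] int2[OF that] by (rule Bochner_Integration.integrable_diff[rotated])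
  define S where "S eps = (LINT y|lebesgue. indicator (UNIV - ball x eps) y *\<^sub>R f y)" for eps
  have S_eq: "S eps = (LINT y:(UNIV - ball (?R x) eps)|lebesgue. dq \<alpha> U (?R x) y)
      - (LINT y:(UNIV - ball x eps)|lebesgue. dq \<alpha> U x y)" if "eps > 0" for eps
    using Bochner_Integration.integral_diff[OF int2[OF that] int1[OF that]] eq2[OF that]
    unfolding S_def f_eq scaleR_diff_right set_lebesgue_integral_def by simp
  have S_lim: "(S \<longlongrightarrow> b - a) (at_right 0)"
  proof (rule Lim_transform_eventually[OF tendsto_diff[OF b a]])
    show "\<forall>\<^sub>F eps in at_right 0. (LINT y:(UNIV - ball (?R x) eps)|lebesgue. dq \<alpha> U (?R x) y)
      - (LINT y:(UNIV - ball x eps)|lebesgue. dq \<alpha> U x y) = S eps"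
      using eventually_at_right_less[of 0] by eventually_elim (simp add: S_eq)
  qed
  have g_split: "g y = f y + f (?R y)" for y
  proof -
    have "f (?R y) = (?W x + ?W y) / norm (x - ?R y) powr ?p"
      by (simp add: f_def dq_def anti)
    moreover have "f y = (?W x - ?W y) / norm (x - y) powr ?p"
      by (simp add: f_def dq_def)
    ultimately show ?thesis
      unfolding g_def by (simp add: divide_inverse algebra_simps)
  qed
  \<comment> \<open>beyond the mirror the integrand is absolutely integrable, so this part can be folded back by the reflection\<close>
  have far_int: "integrable lebesgue (\<lambda>y. indicator ?\<Sigma> y *\<^sub>R f (?R y))"
    and far_eq: "(LINT y|lebesgue. indicator {y. y \<bullet> e > \<mu>} y *\<^sub>R f y) = (LINT y|lebesgue. indicator ?\<Sigma> y *\<^sub>R f (?R y))"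
    and far_int': "integrable lebesgue (\<lambda>y. indicator {y. y \<bullet> e > \<mu>} y *\<^sub>R f y)"
  proof -
    have m: "{y. y \<bullet> e > \<mu>} \<in> sets lebesgue"
    proof -
      have "open {y. y \<bullet> e > \<mu>}"
        by (intro open_Collect_less continuous_intros)
      then show ?thesis
        by auto
    qed
    have sub: "{y. y \<bullet> e > \<mu>} \<subseteq> UNIV - ball x d"
    proof
      fix y assume "y \<in> {y. y \<bullet> e > \<mu>}"
      then have "d < (y - x) \<bullet> e"
        by (simp add: d_def inner_diff_left)
      also have "\<dots> \<le> norm (y - x) * norm e"
        by (rule norm_cauchy_schwarz)
      finally show "y \<in> UNIV - ball x d"
        using e by (simp add: dist_norm norm_minus_commute)
    qed
    have "set_integrable lebesgue (UNIV - ball x d) f"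
      using intf[OF d] unfolding set_integrable_def .
    from set_integrable_subset[OF this m sub]
    show i: "integrable lebesgue (\<lambda>y. indicator {y. y \<bullet> e > \<mu>} y *\<^sub>R f y)"
      unfolding set_integrable_def .
    have ind: "indicator {y. y \<bullet> e > \<mu>} (?R y) = (indicator ?\<Sigma> y :: real)" for y
      by (auto simp: indicator_def half_space_def mirror_inner)
    show "integrable lebesgue (\<lambda>y. indicator ?\<Sigma> y *\<^sub>R f (?R y))"
      using i mirror_integral(1)[of "\<lambda>y. indicator {y. y \<bullet> e > \<mu>} y *\<^sub>R f y" \<mu>] by (simp only: ind)
    show "(LINT y|lebesgue. indicator {y. y \<bullet> e > \<mu>} y *\<^sub>R f y) = (LINT y|lebesgue. indicator ?\<Sigma> y *\<^sub>R f (?R y))"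
      using mirror_integral(2)[of "\<lambda>y. indicator {y. y \<bullet> e > \<mu>} y *\<^sub>R f y" \<mu>] by (simp only: ind)
  qed
  have intg: "integrable lebesgue (\<lambda>y. indicator E y *\<^sub>R g y)"
  proof -
    have "set_integrable lebesgue (UNIV - ball x \<eta>) f"
      using intf[OF E(3)] unfolding set_integrable_def .
    then have "set_integrable lebesgue E f"
      by (rule set_integrable_subset) (use E(1) in \<open>auto simp: dist_norm dest!: E(4)\<close>)
    moreover have "set_integrable lebesgue E (\<lambda>y. f (?R y))"
      using far_int E(1,2) unfolding set_integrable_def[of _ ?\<Sigma>, symmetric] by (rule set_integrable_subset)
    ultimately have "set_integrable lebesgue E (\<lambda>y. f y + f (?R y))"
      by (rule set_integral_add)
    then show ?thesis
      unfolding set_integrable_def g_split .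
  qed
  then show "set_integrable lebesgue E g"
    unfolding set_integrable_def .
  have g_nonpos: "g y \<le> 0" if "y \<in> ?\<Sigma>" "y \<noteq> s" for y
  proof (cases "y = x")
    case True
    then show ?thesis
      using nonpos by (simp add: g_def divide_nonpos_nonneg)
  next
    case False
    have "1 / norm (x - ?R y) powr ?p \<le> 1 / norm (x - y) powr ?p"
      using kernel_mirror_less[OF x that(1) False[symmetric] p] by simp
    then have "(?W y - ?W x) * (1 / norm (x - y) powr ?p - 1 / norm (x - ?R y) powr ?p) \<ge> 0"
      using min[OF that] by (intro mult_nonneg_nonneg) auto
    moreover have "2 * ?W x / norm (x - ?R y) powr ?p \<le> 0"
      using nonpos by (simp add: divide_nonpos_nonneg)
    ultimately show ?thesis
      unfolding g_def by linarith
  qed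
  define c where "c = 1 / d powr ?p * measure lebesgue (ball x d)"
  have c: "c \<ge> 0"
    by (simp add: c_def)
  have main: "b - a \<le> (LINT y|lebesgue. indicator E y *\<^sub>R g y) + \<theta> * c" if \<theta>: "\<theta> > 0" for \<theta>
  proof -
    obtain \<delta> where \<delta>: "\<delta> > 0" "\<And>y. dist y x < \<delta> \<Longrightarrow> dist (?W y) (?W x) < \<theta>"
      using cont \<theta> unfolding continuous_at_eps_delta by blast
    have step: "S eps \<le> (LINT y|lebesgue. indicator E y *\<^sub>R g y) + \<theta> * c"
      if eps: "0 < eps" "eps < min (min \<delta> d) \<eta>" for eps
    proof -
      let ?B = "ball x eps"
      have B\<Sigma>: "?B \<subseteq> ?\<Sigma>"
      proof
        fix y assume y: "y \<in> ?B"
        have "(y - x) \<bullet> e \<le> norm (y - x) * norm e"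
          by (rule norm_cauchy_schwarz)
        then have "(y - x) \<bullet> e < d"
          using y eps e by (simp add: dist_norm norm_minus_commute)
        then show "y \<in> ?\<Sigma>"
          by (simp add: d_def half_space_def inner_diff_left)
      qed
      have i1: "integrable lebesgue (\<lambda>y. indicator (?\<Sigma> - ?B) y *\<^sub>R f y)"
      proof -
        have "set_integrable lebesgue (UNIV - ?B) f"
          using intf[OF eps(1)] unfolding set_integrable_def .
        then have "set_integrable lebesgue (?\<Sigma> - ?B) f"
          by (rule set_integrable_subset) (auto simp: half_space_measurable)
        then show ?thesis
          unfolding set_integrable_def .
      qed
      have iB: "integrable lebesgue (\<lambda>y. \<theta> / d powr ?p * indicator (ball x d) y)"
        using emeasure_lborel_ball_finite[of x d]
        by (intro integrable_mult_right integrable_real_indicator) auto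
      have "S eps \<le> (LINT y|lebesgue. indicator (?\<Sigma> - ?B) y *\<^sub>R f y + indicator {y. y \<bullet> e > \<mu>} y *\<^sub>R f y)"
        unfolding S_def
      proof (rule integral_mono[OF intf[OF eps(1)]])
        show "integrable lebesgue (\<lambda>y. indicator (?\<Sigma> - ?B) y *\<^sub>R f y + indicator {y. y \<bullet> e > \<mu>} y *\<^sub>R f y)"
          using i1 far_int' by (rule Bochner_Integration.integrable_add)
        (* on the mirror itself w vanishes and the integrand is nonpositive, so it can be dropped *)
        show "indicator (UNIV - ?B) y *\<^sub>R f y \<le> indicator (?\<Sigma> - ?B) y *\<^sub>R f y + indicator {y. y \<bullet> e > \<mu>} y *\<^sub>R f y" for y
        proof (cases "y \<bullet> e = \<mu>")
          case True
          then have "mirror e \<mu> y = y"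
            by (simp add: mirror_def)
          then have "?W y = 0"
            by (simp add: w_def)
          then have "f y \<le> 0"
            using nonpos by (simp add: f_def dq_def divide_nonpos_nonneg)
          then show ?thesis
            using True by (simp add: half_space_def indicator_def)
        next
          case False
          then show ?thesis
            using B\<Sigma> by (auto simp: half_space_def indicator_def)
        qed
      qed
      also have "\<dots> = (LINT y|lebesgue. indicator (?\<Sigma> - ?B) y *\<^sub>R f y + indicator ?\<Sigma> y *\<^sub>R f (?R y))"
        using i1 far_int' far_int far_eq by simp
      also have "\<dots> \<le> (LINT y|lebesgue. indicator E y *\<^sub>R g y + \<theta> / d powr ?p * indicator (ball x d) y)"
      proof (rule integral_mono_AE)
        show "integrable lebesgue (\<lambda>y. indicator (?\<Sigma> - ?B) y *\<^sub>R f y + indicator ?\<Sigma> y *\<^sub>R f (?R y))"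
          using i1 far_int by (rule Bochner_Integration.integrable_add)
        show "integrable lebesgue (\<lambda>y. indicator E y *\<^sub>R g y + \<theta> / d powr ?p * indicator (ball x d) y)"
          using intg iB by (rule Bochner_Integration.integrable_add)
        show "AE y in lebesgue. indicator (?\<Sigma> - ?B) y *\<^sub>R f y + indicator ?\<Sigma> y *\<^sub>R f (?R y)
            \<le> indicator E y *\<^sub>R g y + \<theta> / d powr ?p * indicator (ball x d) y"
          using AE_lebesgue_neq[of s]
        proof eventually_elim
          case (elim y)
          have pos: "0 \<le> \<theta> / d powr ?p * indicator (ball x d) y"
            using \<theta> by simp
          consider "y \<notin> ?\<Sigma>" | "y \<in> ?\<Sigma>" "y \<notin> ?B" | "y \<in> ?B"
            by blast
          then show ?case
          proof cases
            case 1
            then have "y \<notin> E"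
              using E by blast
            then show ?thesis
              using 1 pos by simp
          next
            case 2
            have "g y \<le> indicator E y *\<^sub>R g y"
              using g_nonpos[OF 2(1) elim] by (simp add: indicator_def)
            then show ?thesis
              using 2 pos by (simp add: g_split)
          next
            case 3
            then have "y \<notin> E"
              using E(4)[of y] eps by (auto simp: dist_norm)
            have y\<Sigma>: "y \<in> ?\<Sigma>" and yd: "y \<in> ball x d"
              using 3 B\<Sigma> eps by auto
            (* inside the small ball only the folded part is left; by continuity of w it is almost nonpositive *)
            have "dist (?W y) (?W x) < \<theta>"
              using \<delta>(2)[of y] 3 eps by (simp add: dist_commute)
            then have num: "?W x + ?W y \<le> \<theta>"
              using nonpos by (simp add: dist_real_def)
            have "norm (x - ?R y) powr ?p \<ge> d powr ?p"
              using dist_mirror_ge[of y \<mu> x] y\<Sigma> d p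
              by (intro powr_mono2) (auto simp: half_space_def d_def)
            then have "(?W x + ?W y) / norm (x - ?R y) powr ?p \<le> \<theta> / d powr ?p"
              using num \<theta> d
              by (cases "?W x + ?W y \<ge> 0") (auto intro!: frac_le intro: order_trans[of _ 0] divide_nonpos_nonneg)
            then have "f (?R y) \<le> \<theta> / d powr ?p"
              by (simp add: f_def dq_def anti)
            then show ?thesis
              using 3 y\<Sigma> yd \<open>y \<notin> E\<close> by simp
          qed
        qed
      qed
      also have "\<dots> = (LINT y|lebesgue. indicator E y *\<^sub>R g y) + (LINT y|lebesgue. \<theta> / d powr ?p * indicator (ball x d) y)"
        using intg iB by (rule Bochner_Integration.integral_add)
      also have "(LINT y|lebesgue. \<theta> / d powr ?p * indicator (ball x d) y) = \<theta> * c"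
        by (simp add: c_def)
      finally show ?thesis .
    qed
    have "\<forall>\<^sub>F eps in at_right 0. S eps \<le> (LINT y|lebesgue. indicator E y *\<^sub>R g y) + \<theta> * c"
    proof (rule eventually_mono)
      show "\<forall>\<^sub>F eps in at_right 0. 0 < eps \<and> eps < min (min \<delta> d) \<eta>"
        using \<delta> d E(3) by (intro eventually_at_right_0_less) auto
    qed (use step in blast)
    then show ?thesis
      by (rule tendsto_upperbound[OF S_lim]) simp
  qed
  show "b - a \<le> (LINT y:E|lebesgue. g y)"
    unfolding set_lebesgue_integral_def
  proof (rule field_le_epsilon)
    fix \<theta> :: real assume "\<theta> > 0"
    then have "b - a \<le> (LINT y|lebesgue. indicator E y *\<^sub>R g y) + \<theta> / (c + 1) * c"
      using c by (intro main) simp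
    also have "\<theta> / (c + 1) * c \<le> \<theta>"
      using c \<open>\<theta> > 0\<close> by (simp add: field_simps)
    finally show "b - a \<le> (LINT y|lebesgue. indicator E y *\<^sub>R g y) + \<theta>"
      by simp
  qed
qed

text \<open>Take for \<open>E\<close> the ball of radius \<open>d/4\<close> centred at depth \<open>2d\<close> below \<open>x\<close>, and keep only the term \<open>2 w(x) k'\<close>.\<close>

lemma antisymmetric_negative_minimum:
  fixes U :: "real ^ 'n \<Rightarrow> real"
  defines "w \<equiv> \<lambda>\<mu> y. U (mirror e \<mu> y) - U y"
  assumes U: "U \<in> L_space \<alpha>" and \<alpha>: "\<alpha> > 0"
    and x: "x \<in> half_space e \<mu>" and cont: "isCont (w \<mu>) x"
    and a: "has_pv \<alpha> U x a"
    and b: "has_pv \<alpha> U (mirror e \<mu> x) b"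
    and nonpos: "w \<mu> x \<le> 0"
    and min: "\<And>y. y \<in> half_space e \<mu> \<Longrightarrow> y \<noteq> s \<Longrightarrow> w \<mu> x \<le> w \<mu> y"
  shows "b - a \<le> min_const \<alpha> TYPE('n) * w \<mu> x * (\<mu> - x \<bullet> e) powr (- \<alpha>)"
proof -
  let ?p = "real CARD('n) + \<alpha>"
  define V where "V = measure lebesgue (ball (0 :: real ^ 'n) 1)"
  define d where "d = \<mu> - x \<bullet> e"
  have d: "d > 0"
    using x by (simp add: d_def half_space_def)
  have p: "?p > 0"
    using \<alpha> by simp
  define E where "E = ball (x - d *\<^sub>R e) (d / 4)"
  have inE: "norm (x - y) \<ge> 3 / 4 * d \<and> norm (x - y) \<le> 5 / 4 * d \<and> \<mu> - y \<bullet> e > 0 \<and> \<mu> - y \<bullet> e \<le> 9 / 4 * d" if "y \<in> E" for y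
  proof -
    define z where "z = x - d *\<^sub>R e"
    have zy: "norm (z - y) < d / 4"
      using that by (simp add: E_def z_def dist_norm)
    have xz: "norm (x - z) = d"
      using d e by (simp add: z_def)
    have "norm (x - y) \<le> norm (x - z) + norm (z - y)" "norm (x - z) \<le> norm (x - y) + norm (z - y)"
      using norm_triangle_ineq[of "x - z" "z - y"] norm_triangle_ineq4[of "x - y" "z - y"] by simp_all
    moreover have "(z - y) \<bullet> e \<le> d / 4" "- (d / 4) \<le> (z - y) \<bullet> e"
      using Cauchy_Schwarz_ineq2[of "z - y" e] zy e by (simp_all add: abs_le_iff)
    moreover have "(z - y) \<bullet> e = \<mu> - y \<bullet> e - 2 * d"
      by (simp add: z_def inner_diff_left unit_inner_self d_def)
    ultimately show ?thesis
      using xz zy d by (intro conjI; linarith)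
  qed
  have sub: "E \<subseteq> half_space e \<mu>"
    using inE by (auto simp: half_space_def)
  have far: "norm (x - y) \<ge> 3 / 4 * d" if "y \<in> E" for y
    using inE[OF that] by simp
  define g where "g = (\<lambda>y. 2 * w \<mu> x / norm (x - mirror e \<mu> y) powr ?p
      - (w \<mu> y - w \<mu> x) * (1 / norm (x - y) powr ?p - 1 / norm (x - mirror e \<mu> y) powr ?p))"
  have dpos: "3 / 4 * d > 0"
    using d by simp
  have Em: "E \<in> sets lebesgue"
    by (simp add: E_def)
  have bound: "set_integrable lebesgue E g" "b - a \<le> (LINT y:E|lebesgue. g y)"
    unfolding g_def w_def
    by (rule antisymmetric_pv_bound[OF U \<alpha> x cont[unfolded w_def] a b nonpos[unfolded w_def]
        min[unfolded w_def] Em sub dpos far], assumption+)+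
  have intg: "integrable lebesgue (\<lambda>y. indicator E y *\<^sub>R g y)"
    using bound(1) unfolding set_integrable_def by blast
  have le: "b - a \<le> (LINT y|lebesgue. indicator E y *\<^sub>R g y)"
    using bound(2) unfolding set_lebesgue_integral_def by blast
  define K where "K = 2 * w \<mu> x / (6 * d) powr ?p"
  have intK: "integrable lebesgue (\<lambda>y. K * indicator E y)"
    using emeasure_lborel_ball_finite[of "x - d *\<^sub>R e" "d / 4"]
    by (intro integrable_mult_right integrable_real_indicator) (auto simp: E_def)
  have "(LINT y|lebesgue. indicator E y *\<^sub>R g y) \<le> (LINT y|lebesgue. K * indicator E y)"
  proof (rule integral_mono_AE[OF intg intK])
    show "AE y in lebesgue. indicator E y *\<^sub>R g y \<le> K * indicator E y"
      using AE_lebesgue_neq[of s]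
    proof eventually_elim
      case (elim y)
      show ?case
      proof (cases "y \<in> E")
        case True
        have y\<Sigma>: "y \<in> half_space e \<mu>"
          using True sub by blast
        have lt: "0 < norm (x - y)" "norm (x - y) < norm (x - mirror e \<mu> y)"
          using far[OF True] d norm_diff_less_mirror[OF x y\<Sigma>] by auto
        have "1 / norm (x - mirror e \<mu> y) powr ?p \<le> 1 / norm (x - y) powr ?p"
          using kernel_mirror_less[OF x y\<Sigma> _ p] lt(1) by force
        then have 1: "(w \<mu> y - w \<mu> x) * (1 / norm (x - y) powr ?p - 1 / norm (x - mirror e \<mu> y) powr ?p) \<ge> 0"
          using min[OF y\<Sigma> elim] by (intro mult_nonneg_nonneg) auto
        have "norm (x - mirror e \<mu> y) \<le> norm (x - y) + norm (y - mirror e \<mu> y)"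
          using norm_triangle_ineq[of "x - y" "y - mirror e \<mu> y"] by simp
        moreover have "norm (y - mirror e \<mu> y) = 2 * (\<mu> - y \<bullet> e)"
          using inE[OF True] e by (simp add: mirror_def)
        moreover have "4 * norm (x - y) \<le> 5 * d" "4 * (\<mu> - y \<bullet> e) \<le> 9 * d"
          using inE[OF True] by auto
        ultimately have "norm (x - mirror e \<mu> y) \<le> 6 * d"
          using d by linarith
        then have "norm (x - mirror e \<mu> y) powr ?p \<le> (6 * d) powr ?p"
          using p by (intro powr_mono2) auto
        moreover have "norm (x - mirror e \<mu> y) powr ?p > 0"
          unfolding powr_gt_zero using lt by linarith
        ultimately have "1 / (6 * d) powr ?p \<le> 1 / norm (x - mirror e \<mu> y) powr ?p"
          by (intro frac_le) auto
        then have "2 * w \<mu> x / norm (x - mirror e \<mu> y) powr ?p \<le> K"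
          unfolding K_def using nonpos mult_left_mono_neg[of "1 / (6 * d) powr ?p" "1 / norm (x - mirror e \<mu> y) powr ?p" "2 * w \<mu> x"] by simp
        with 1 have "g y \<le> K"
          unfolding g_def by linarith
        then show ?thesis
          using True by simp
      qed simp
    qed
  qed
  also have "\<dots> = K * measure lebesgue E"
    by simp
  also have "measure lebesgue E = (d / 4) ^ CARD('n) * V"
    using content_ball_conv_unit_ball[of "d / 4" "x - d *\<^sub>R e"] d by (simp add: E_def V_def)
  also have "K * ((d / 4) ^ CARD('n) * V) = (2 * 6 powr (- ?p) * (1/4) ^ CARD('n) * V) * w \<mu> x * (d powr (- ?p) * d ^ CARD('n))"
    unfolding K_def powr_mult powr_minus_divide by (simp add: power_divide mult_ac)
  also have "d powr (- ?p) * d ^ CARD('n) = d powr (- \<alpha>)"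
    using d by (simp add: powr_realpow[symmetric] powr_add[symmetric])
  finally show ?thesis
    using le by (simp add: min_const_def V_def d_def)
qed

text \<open>A strong maximum principle: at a zero minimum only the term \<open>- w(y) (k - k')\<close> survives, and it is strictly
  negative where \<open>w > 0\<close>.\<close>

lemma antisymmetric_zero_minimum:
  fixes U :: "real ^ 'n \<Rightarrow> real"
  defines "w \<equiv> \<lambda>\<mu> y. U (mirror e \<mu> y) - U y"
  assumes U: "U \<in> L_space \<alpha>" and \<alpha>: "\<alpha> > 0"
    and x: "x \<in> half_space e \<mu>" and cont: "isCont (w \<mu>) x"
    and a: "has_pv \<alpha> U x a"
    and b: "has_pv \<alpha> U (mirror e \<mu> x) b"
    and zero: "w \<mu> x = 0"
    and min: "\<And>y. y \<in> half_space e \<mu> \<Longrightarrow> y \<noteq> s \<Longrightarrow> 0 \<le> w \<mu> y"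
    and r: "r > 0" "r \<le> norm (x - z) / 2" "ball z r \<subseteq> half_space e \<mu>"
    and pos: "\<And>y. y \<in> ball z r \<Longrightarrow> y \<noteq> s \<Longrightarrow> w \<mu> y > 0"
  shows "b < a"
proof -
  let ?p = "real CARD('n) + \<alpha>"
  have p: "?p > 0"
    using \<alpha> by simp
  define E where "E = ball z r"
  have far: "norm (x - y) \<ge> r" if "y \<in> E" for y
    using that r norm_triangle_ineq[of "x - y" "y - z"] by (simp add: E_def dist_norm norm_minus_commute)
  have Em: "E \<in> sets lebesgue"
    by (simp add: E_def)
  have sub: "E \<subseteq> half_space e \<mu>"
    using r by (simp add: E_def)
  define g where "g = (\<lambda>y. 2 * w \<mu> x / norm (x - mirror e \<mu> y) powr ?p
      - (w \<mu> y - w \<mu> x) * (1 / norm (x - y) powr ?p - 1 / norm (x - mirror e \<mu> y) powr ?p))"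
  have nonpos: "w \<mu> x \<le> 0"
    using zero by simp
  have min': "\<And>y. y \<in> half_space e \<mu> \<Longrightarrow> y \<noteq> s \<Longrightarrow> w \<mu> x \<le> w \<mu> y"
    using zero min by simp
  have bound: "set_integrable lebesgue E g" "b - a \<le> (LINT y:E|lebesgue. g y)"
    unfolding g_def w_def
    by (rule antisymmetric_pv_bound[OF U \<alpha> x cont[unfolded w_def] a b nonpos[unfolded w_def]
        min'[unfolded w_def] Em sub r(1) far], assumption+)+
  have neg: "g y < 0" if "y \<in> E" "y \<noteq> s" for y
  proof -
    have y\<Sigma>: "y \<in> half_space e \<mu>"
      using that sub by blast
    have "x \<noteq> y"
      using far[OF that(1)] r(1) by auto
    then have "1 / norm (x - mirror e \<mu> y) powr ?p < 1 / norm (x - y) powr ?p"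
      by (rule kernel_mirror_less[OF x y\<Sigma> _ p])
    then have "w \<mu> y * (1 / norm (x - y) powr ?p - 1 / norm (x - mirror e \<mu> y) powr ?p) > 0"
      using pos[of y] that by (intro mult_pos_pos) (auto simp: E_def)
    then show ?thesis
      by (simp add: g_def zero)
  qed
  have "(LINT y:E|lebesgue. g y) < 0"
    by (rule set_integral_negative[OF bound(1) Em _ r(1), of z s]) (use neg in \<open>auto simp: E_def\<close>)
  then show ?thesis
    using bound(2) by linarith
qed

end

section \<open>Moving planes for the singular system\<close>

lemma bounded_above_away_from_0:
  fixes f :: "'a::euclidean_space \<Rightarrow> real"
  assumes cont: "\<And>x. x \<noteq> 0 \<Longrightarrow> isCont f x" and dec: "(f \<longlongrightarrow> 0) at_infinity" and "\<delta> > 0"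
  shows "\<exists>M>0. \<forall>x. norm x \<ge> \<delta> \<longrightarrow> f x \<le> M"
proof -
  have "\<forall>\<^sub>F x in at_infinity. f x < 1"
    using dec by (rule order_tendstoD) simp
  then obtain R where R: "\<And>x. norm x \<ge> R \<Longrightarrow> f x < 1"
    unfolding eventually_at_infinity by blast
  let ?C = "cball 0 R - ball (0 :: 'a) \<delta>"
  have "compact ?C"
    by (intro compact_diff) auto
  moreover have "continuous_on ?C f"
    using \<open>\<delta> > 0\<close> by (intro continuous_at_imp_continuous_on ballI cont) auto
  ultimately have "bounded (f ` ?C)"
    by (intro compact_imp_bounded compact_continuous_image)
  then obtain B where B: "\<And>x. x \<in> ?C \<Longrightarrow> norm (f x) \<le> B"
    unfolding bounded_iff by blast
  have "f x \<le> max B 1" if "norm x \<ge> \<delta>" for x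
  proof (cases "norm x \<ge> R")
    case True
    then show ?thesis
      using R[of x] by simp
  next
    case False
    then show ?thesis
      using B[of x] that by (simp add: abs_le_iff max.coboundedI1)
  qed
  then show ?thesis
    by (intro exI[of _ "max B 1"]) auto
qed

lemma powr_diff_le_tangent:
  fixes a b q :: real
  assumes "0 < a" "a < b" "q > 1"
  shows "b powr q - a powr q \<le> q * b powr (q - 1) * (b - a)"
proof -
  obtain z where z: "a < z" "z < b" "b powr q - a powr q = (b - a) * (q * z powr (q - 1))"
    using MVT2[of a b "\<lambda>t. t powr q" "\<lambda>t. q * t powr (q - 1)"] assms
    by (force intro!: derivative_eq_intros)
  have "z powr (q - 1) \<le> b powr (q - 1)"
    using z assms by (intro powr_mono2) auto
  then have "(b - a) * (q * z powr (q - 1)) \<le> (b - a) * (q * b powr (q - 1))"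
    using assms by (intro mult_left_mono) auto
  then show ?thesis
    using z(3) by (simp add: mult_ac)
qed

definition gap :: "(real ^ 'n \<Rightarrow> real) \<Rightarrow> real ^ 'n \<Rightarrow> real \<Rightarrow> real ^ 'n \<Rightarrow> real" where
  "gap f e \<mu> x = f (mirror e \<mu> x) - f x"

text \<open>The mirror image of the origin is left out: the gap there refers to the value at the origin, which says
  nothing about a function that blows up at the origin.\<close>

definition neg_min :: "(real ^ 'n \<Rightarrow> real) \<Rightarrow> real ^ 'n \<Rightarrow> real \<Rightarrow> real ^ 'n \<Rightarrow> bool" where
  "neg_min f e \<mu> x \<longleftrightarrow> x \<in> half_space e \<mu> \<and> x \<noteq> mirror e \<mu> 0 \<and> gap f e \<mu> x < 0 \<and>
     (\<forall>y \<in> half_space e \<mu>. y \<noteq> mirror e \<mu> 0 \<longrightarrow> gap f e \<mu> x \<le> gap f e \<mu> y)"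

lemma isCont_mirror: "isCont (mirror e \<mu>) x"
  unfolding mirror_def by (intro continuous_intros)

lemma isCont_gap:
  assumes "isCont f x" "isCont f (mirror e \<mu> x)"
  shows "isCont (gap f e \<mu>) x"
  unfolding gap_def using isCont_o2[OF isCont_mirror assms(2)] assms(1) by (intro continuous_intros)

text \<open>The properties of the two Kelvin transforms on which the method of moving planes rests. The assumptions are
  symmetric under exchanging \<open>(U, r)\<close> with \<open>(V, q)\<close>, so that each fact about \<open>U\<close> also holds for \<open>V\<close>.\<close>

locale singular_system =
  fixes \<alpha> q r \<kappa> :: real and U V :: "real ^ 'n \<Rightarrow> real"
  assumes \<alpha>: "\<alpha> > 0" and q: "q > 1" and r: "r > 1" and \<kappa>: "\<kappa> > 0"
    and LU: "U \<in> L_space \<alpha>" and LV: "V \<in> L_space \<alpha>"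
    and contU: "\<And>x. x \<noteq> 0 \<Longrightarrow> isCont U x" and contV: "\<And>x. x \<noteq> 0 \<Longrightarrow> isCont V x"
    and posU: "\<And>x. x \<noteq> 0 \<Longrightarrow> U x > 0" and posV: "\<And>x. x \<noteq> 0 \<Longrightarrow> V x > 0"
    and poleU: "filterlim U at_top (at 0)" and poleV: "filterlim V at_top (at 0)"
    and decU: "(U \<longlongrightarrow> 0) at_infinity" and decV: "(V \<longlongrightarrow> 0) at_infinity"
    and decU': "((\<lambda>x. norm x powr \<alpha> * U x powr (r - 1)) \<longlongrightarrow> 0) at_infinity"
    and decV': "((\<lambda>x. norm x powr \<alpha> * V x powr (q - 1)) \<longlongrightarrow> 0) at_infinity"
    and pvU: "\<And>x. x \<noteq> 0 \<Longrightarrow>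
      has_pv \<alpha> U x (\<kappa> * V x powr q)"
    and pvV: "\<And>x. x \<noteq> 0 \<Longrightarrow>
      has_pv \<alpha> V x (\<kappa> * U x powr r)"
begin

lemma swapped: "singular_system \<alpha> r q \<kappa> V U"
  using singular_system_axioms unfolding singular_system_def by blast

context
  fixes e :: "real ^ 'n" and \<mu> :: real
  assumes e: "norm e = 1" and \<mu>: "\<mu> < 0"
begin

lemma half_space_nonzero:
  assumes "x \<bullet> e \<le> \<mu>"
  shows "x \<noteq> 0"
  using assms \<mu> by auto

lemma mirror_eq_0_iff: "mirror e \<mu> x = 0 \<longleftrightarrow> x = mirror e \<mu> 0"
  using mirror_mirror[OF e] by metis

lemma half_space_norm:
  assumes "x \<in> half_space e \<mu>"
  shows "norm x \<ge> \<bar>\<mu>\<bar>" "\<mu> - x \<bullet> e \<le> norm x" "\<mu> - x \<bullet> e > 0"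
proof -
  have "\<bar>x \<bullet> e\<bar> \<le> norm x"
    using Cauchy_Schwarz_ineq2[of x e] e by simp
  then show "norm x \<ge> \<bar>\<mu>\<bar>" "\<mu> - x \<bullet> e \<le> norm x" "\<mu> - x \<bullet> e > 0"
    using assms \<mu> by (auto simp: half_space_def)
qed

lemma pole_in_half_space: "mirror e \<mu> 0 \<in> half_space e \<mu>"
  using \<mu> by (simp add: half_space_def mirror_inner[OF e])

lemma isCont_gapU:
  assumes "x \<bullet> e \<le> \<mu>" "x \<noteq> mirror e \<mu> 0"
  shows "isCont (gap U e \<mu>) x"
  using assms half_space_nonzero mirror_eq_0_iff by (intro isCont_gap contU) auto

lemma gap_positive_near_pole:
  "\<exists>\<delta>>0. \<forall>y. y \<noteq> mirror e \<mu> 0 \<longrightarrow> dist y (mirror e \<mu> 0) < \<delta> \<longrightarrow> gap U e \<mu> y > 0"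
proof -
  let ?s = "mirror e \<mu> 0"
  have s0: "?s \<noteq> 0"
    using half_space_nonzero[of ?s] \<mu> by (simp add: mirror_inner[OF e])
  have "filterlim (mirror e \<mu>) (at 0) (at ?s)"
  proof (rule filterlim_atI)
    show "(mirror e \<mu> \<longlongrightarrow> 0) (at ?s)"
      using isCont_mirror[of ?s e \<mu>] by (simp add: isCont_def mirror_mirror[OF e])
    show "\<forall>\<^sub>F y in at ?s. mirror e \<mu> y \<noteq> 0"
      unfolding mirror_eq_0_iff by (simp add: eventually_at_filter)
  qed
  then have "filterlim (\<lambda>y. U (mirror e \<mu> y)) at_top (at ?s)"
    by (rule filterlim_compose[OF poleU])
  moreover have "(U \<longlongrightarrow> U ?s) (at ?s)"
    using contU[OF s0] by (simp add: isCont_def)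
  then have "((\<lambda>y. - U y) \<longlongrightarrow> - U ?s) (at ?s)"
    by (rule tendsto_minus)
  ultimately have "filterlim (\<lambda>y. - U y + U (mirror e \<mu> y)) at_top (at ?s)"
    by (intro filterlim_tendsto_add_at_top)
  then have "\<forall>\<^sub>F y in at ?s. - U y + U (mirror e \<mu> y) > 0"
    by (rule filterlim_at_top_dense[THEN iffD1, rule_format])
  then have "\<forall>\<^sub>F y in at ?s. gap U e \<mu> y > 0"
    by eventually_elim (simp add: gap_def)
  then show ?thesis
    unfolding eventually_at by blast
qed

text \<open>The gap is eventually above any negative level at infinity, by decay, and positive near the mirror image of the
  origin, by the singularity; on the compact set that remains the infimum is attained, off the mirror, where the gap vanishes.\<close>

lemma neg_min_exists:
  assumes x0: "x0 \<in> half_space e \<mu>" "x0 \<noteq> mirror e \<mu> 0" "gap U e \<mu> x0 < 0"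
  shows "\<exists>x. neg_min U e \<mu> x"
proof -
  let ?s = "mirror e \<mu> 0"
  obtain \<delta> where \<delta>: "\<delta> > 0" "\<And>y. y \<noteq> ?s \<Longrightarrow> dist y ?s < \<delta> \<Longrightarrow> gap U e \<mu> y > 0"
    using gap_positive_near_pole by blast
  define m where "m = gap U e \<mu> x0"
  have "\<forall>\<^sub>F x in at_infinity. U x < - m"
    using decU by (rule order_tendstoD) (use x0 in \<open>simp add: m_def\<close>)
  then obtain R where R: "\<And>x. norm x \<ge> R \<Longrightarrow> U x < - m"
    unfolding eventually_at_infinity by blast
  have far: "gap U e \<mu> y > m" if "norm y \<ge> R" "y \<noteq> ?s" for y
  proof -
    have "U (mirror e \<mu> y) > 0"
      using that mirror_eq_0_iff by (intro posU) simp
    then show ?thesis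
      using R[OF that(1)] by (simp add: gap_def)
  qed
  define C where "C = (cball 0 R \<inter> {y. y \<bullet> e \<le> \<mu>}) - ball ?s \<delta>"
  have "closed {y. y \<bullet> e \<le> \<mu>}"
    by (intro closed_Collect_le continuous_intros)
  then have "compact C"
    unfolding C_def by (intro compact_diff compact_Int_closed) auto
  moreover have x0C: "x0 \<in> C"
    using x0 far[of x0] \<delta>(2)[of x0]
    by (force simp: C_def m_def half_space_def dist_commute not_less intro: less_imp_le)
  moreover have "continuous_on C (gap U e \<mu>)"
    using \<delta>(1) by (intro continuous_at_imp_continuous_on ballI isCont_gapU) (auto simp: C_def)
  ultimately obtain x where x: "x \<in> C" "\<And>y. y \<in> C \<Longrightarrow> gap U e \<mu> x \<le> gap U e \<mu> y"
    using continuous_attains_inf[of C "gap U e \<mu>"] by blast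
  have neg: "gap U e \<mu> x < 0" "gap U e \<mu> x \<le> m"
    using x(2)[OF x0C] x0 by (auto simp: m_def)
  have "x \<bullet> e \<noteq> \<mu>"
  proof
    assume "x \<bullet> e = \<mu>"
    then have "gap U e \<mu> x = 0"
      by (simp add: gap_def mirror_def)
    then show False
      using neg by simp
  qed
  then have "x \<in> half_space e \<mu>" "x \<noteq> ?s"
    using x(1) \<delta>(1) by (auto simp: C_def half_space_def)
  moreover have "gap U e \<mu> x \<le> gap U e \<mu> y" if y: "y \<in> half_space e \<mu>" "y \<noteq> ?s" for y
  proof (cases "y \<in> C")
    case True
    then show ?thesis
      by (rule x(2))
  next
    case False
    then have "norm y \<ge> R \<or> dist y ?s < \<delta>"
      using y by (auto simp: C_def half_space_def dist_commute)
    then show ?thesis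
      using far[of y] \<delta>(2)[of y] neg y by auto
  qed
  ultimately show ?thesis
    using neg unfolding neg_min_def by blast
qed

text \<open>At a negative minimum the difference of the two equations forces \<open>V(x') < V(x)\<close>, and the tangent line of
  the power function bounds the difference of the right-hand sides.\<close>

lemma neg_min_estimate:
  assumes "neg_min U e \<mu> x"
  shows "gap V e \<mu> x < 0"
    and "min_const \<alpha> TYPE('n) * (- gap U e \<mu> x)
      \<le> \<kappa> * q * ((\<mu> - x \<bullet> e) powr \<alpha> * V x powr (q - 1)) * (- gap V e \<mu> x)"
proof -
  let ?c = "min_const \<alpha> TYPE('n)"
  define d where "d = \<mu> - x \<bullet> e"
  have x: "x \<in> half_space e \<mu>" "x \<noteq> mirror e \<mu> 0" and neg: "gap U e \<mu> x < 0"
    and min: "\<And>y. y \<in> half_space e \<mu> \<Longrightarrow> y \<noteq> mirror e \<mu> 0 \<Longrightarrow> gap U e \<mu> x \<le> gap U e \<mu> y"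
    using assms by (auto simp: neg_min_def)
  have le: "x \<bullet> e \<le> \<mu>"
    using x by (simp add: half_space_def)
  have x0: "x \<noteq> 0" "mirror e \<mu> x \<noteq> 0"
    using half_space_nonzero[OF le] x mirror_eq_0_iff by auto
  have d: "d > 0"
    using half_space_norm[OF x(1)] by (simp add: d_def)
  have "\<kappa> * V (mirror e \<mu> x) powr q - \<kappa> * V x powr q
      \<le> ?c * (U (mirror e \<mu> x) - U x) * (\<mu> - x \<bullet> e) powr (- \<alpha>)"
    using isCont_gapU[OF le x(2)] neg min
    by (intro antisymmetric_negative_minimum[OF e LU \<alpha> x(1) _ pvU[OF x0(1)] pvU[OF x0(2)]]) (auto simp: gap_def[abs_def])
  then have key: "?c * (- gap U e \<mu> x) * d powr (- \<alpha>) \<le> \<kappa> * (V x powr q - V (mirror e \<mu> x) powr q)"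
    by (simp add: gap_def d_def algebra_simps)
  have "?c * (- gap U e \<mu> x) * d powr (- \<alpha>) > 0"
    using neg d min_const_pos by (intro mult_pos_pos) auto
  then have "\<kappa> * (V x powr q - V (mirror e \<mu> x) powr q) > 0"
    using key by linarith
  then have "V (mirror e \<mu> x) powr q < V x powr q"
    using \<kappa> by (simp add: zero_less_mult_iff)
  then have lt: "V (mirror e \<mu> x) < V x"
    using posV[OF x0(1)] posV[OF x0(2)] q by (meson less_le_not_le not_le_imp_less powr_mono2 less_imp_le order_trans zero_less_one)
  then show "gap V e \<mu> x < 0"
    by (simp add: gap_def)
  have "V x powr q - V (mirror e \<mu> x) powr q \<le> q * V x powr (q - 1) * (V x - V (mirror e \<mu> x))"
    by (rule powr_diff_le_tangent[OF posV[OF x0(2)] lt q])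
  then have "\<kappa> * (V x powr q - V (mirror e \<mu> x) powr q) \<le> \<kappa> * (q * V x powr (q - 1) * (- gap V e \<mu> x))"
    using \<kappa> by (intro mult_left_mono) (auto simp: gap_def)
  with key have "?c * (- gap U e \<mu> x) * d powr (- \<alpha>) \<le> \<kappa> * (q * V x powr (q - 1) * (- gap V e \<mu> x))"
    by linarith
  then have "?c * (- gap U e \<mu> x) * d powr (- \<alpha>) * d powr \<alpha> \<le> \<kappa> * (q * V x powr (q - 1) * (- gap V e \<mu> x)) * d powr \<alpha>"
    by (intro mult_right_mono) auto
  moreover have "d powr (- \<alpha>) * d powr \<alpha> = 1"
    using d by (simp add: powr_add[symmetric])
  ultimately have "?c * (- gap U e \<mu> x) \<le> \<kappa> * (q * V x powr (q - 1) * (- gap V e \<mu> x)) * d powr \<alpha>"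
    by (simp only: mult.assoc mult_1_right)
  then show "?c * (- gap U e \<mu> x) \<le> \<kappa> * q * ((\<mu> - x \<bullet> e) powr \<alpha> * V x powr (q - 1)) * (- gap V e \<mu> x)"
    by (simp add: d_def mult_ac)
qed

lemma gap_positive:
  assumes nonneg: "\<And>y. y \<in> half_space e \<mu> \<Longrightarrow> y \<noteq> mirror e \<mu> 0 \<Longrightarrow> gap U e \<mu> y \<ge> 0 \<and> gap V e \<mu> y \<ge> 0"
    and x: "x \<in> half_space e \<mu>" "x \<noteq> mirror e \<mu> 0"
  shows "gap U e \<mu> x > 0"
proof (rule ccontr)
  let ?s = "mirror e \<mu> 0"
  assume "\<not> gap U e \<mu> x > 0"
  then have zero: "gap U e \<mu> x = 0"
    using nonneg[OF x] by simp
  have le: "x \<bullet> e \<le> \<mu>"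
    using x by (simp add: half_space_def)
  have x0: "x \<noteq> 0" "mirror e \<mu> x \<noteq> 0"
    using half_space_nonzero[OF le] x mirror_eq_0_iff by auto
  obtain \<delta> where \<delta>: "\<delta> > 0" "\<And>y. y \<noteq> ?s \<Longrightarrow> dist y ?s < \<delta> \<Longrightarrow> gap U e \<mu> y > 0"
    using gap_positive_near_pole by blast
  have "open (half_space e \<mu>)"
    unfolding half_space_def by (intro open_Collect_less continuous_intros)
  then obtain \<eta> where \<eta>: "\<eta> > 0" "ball ?s \<eta> \<subseteq> half_space e \<mu>"
    using pole_in_half_space open_contains_ball by blast
  (* a ball about the mirror image of the origin on which the gap is positive, kept away from x *)
  define \<rho> where "\<rho> = min (min \<delta> \<eta>) (norm (x - ?s) / 2)"
  have \<rho>: "\<rho> > 0" "\<rho> \<le> norm (x - ?s) / 2" "ball ?s \<rho> \<subseteq> half_space e \<mu>" "\<rho> \<le> \<delta>"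
    using \<delta>(1) \<eta> x(2) by (auto simp: \<rho>_def)
  have "\<kappa> * V (mirror e \<mu> x) powr q < \<kappa> * V x powr q"
    using isCont_gapU[OF le x(2)] zero nonneg \<rho> \<delta>(2)
    by (intro antisymmetric_zero_minimum[OF e LU \<alpha> x(1) _ pvU[OF x0(1)] pvU[OF x0(2)], where s = ?s and z = ?s and r = \<rho>])
      (auto simp: gap_def[abs_def] dist_commute)
  moreover have "V x powr q \<le> V (mirror e \<mu> x) powr q"
    using nonneg[OF x] posV[OF x0(1)] q by (intro powr_mono2) (auto simp: gap_def)
  ultimately show False
    using \<kappa> by simp
qed

end

text \<open>A negative gap of one function yields a negative gap of the other at the same point, so both have negative minima.
  Replacing the gap of \<open>V\<close> at the minimum of \<open>U\<close> by its own minimum, and conversely, and multiplying the two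
  estimates cancels the gaps.\<close>

lemma minima_estimate:
  assumes e: "norm e = 1" and \<mu>: "\<mu> < 0"
    and ex: "x0 \<in> half_space e \<mu>" "x0 \<noteq> mirror e \<mu> 0" "gap U e \<mu> x0 < 0 \<or> gap V e \<mu> x0 < 0"
  shows "\<exists>x y. neg_min U e \<mu> x \<and> neg_min V e \<mu> y \<and>
    1 \<le> (\<kappa>\<^sup>2 * q * r / (min_const \<alpha> TYPE('n))\<^sup>2) * ((\<mu> - x \<bullet> e) powr \<alpha> * V x powr (q - 1))
      * ((\<mu> - y \<bullet> e) powr \<alpha> * U y powr (r - 1))"
proof -
  interpret sw: singular_system \<alpha> r q \<kappa> V U
    by (rule swapped)
  let ?c = "min_const \<alpha> TYPE('n)"
  have "\<exists>x1. x1 \<in> half_space e \<mu> \<and> x1 \<noteq> mirror e \<mu> 0 \<and> gap U e \<mu> x1 < 0"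
  proof (cases "gap U e \<mu> x0 < 0")
    case False
    then obtain y where y: "neg_min V e \<mu> y"
      using sw.neg_min_exists[OF e \<mu>] ex by blast
    then show ?thesis
      using sw.neg_min_estimate(1)[OF e \<mu> y] unfolding neg_min_def by blast
  qed (use ex in blast)
  then obtain x where x: "neg_min U e \<mu> x"
    using neg_min_exists[OF e \<mu>] by blast
  have xin: "x \<in> half_space e \<mu>" "x \<noteq> mirror e \<mu> 0"
    using x by (auto simp: neg_min_def)
  then obtain y where y: "neg_min V e \<mu> y"
    using sw.neg_min_exists[OF e \<mu>, of x] neg_min_estimate(1)[OF e \<mu> x] by blast
  have yin: "y \<in> half_space e \<mu>" "y \<noteq> mirror e \<mu> 0"
    using y by (auto simp: neg_min_def)
  define A B where "A = - gap U e \<mu> x" "B = - gap V e \<mu> y"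
  define G H where "G = (\<mu> - x \<bullet> e) powr \<alpha> * V x powr (q - 1)" "H = (\<mu> - y \<bullet> e) powr \<alpha> * U y powr (r - 1)"
  have pos: "A > 0" "B > 0" "?c > 0"
    using x y min_const_pos by (auto simp: A_B_def neg_min_def)
  have nonneg: "G \<ge> 0" "H \<ge> 0" "\<kappa> * q \<ge> 0" "\<kappa> * r \<ge> 0"
    using \<kappa> q r by (auto simp: G_H_def)
  have "?c * A \<le> \<kappa> * q * G * (- gap V e \<mu> x)"
    using neg_min_estimate(2)[OF e \<mu> x] by (simp add: A_B_def G_H_def)
  also have "\<dots> \<le> \<kappa> * q * G * B"
    using y xin nonneg by (intro mult_left_mono) (auto simp: A_B_def neg_min_def)
  finally have 1: "?c * A \<le> \<kappa> * q * G * B" .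
  have "?c * B \<le> \<kappa> * r * H * (- gap U e \<mu> y)"
    using sw.neg_min_estimate(2)[OF e \<mu> y] by (simp add: A_B_def G_H_def)
  also have "\<dots> \<le> \<kappa> * r * H * A"
    using x yin nonneg by (intro mult_left_mono) (auto simp: A_B_def neg_min_def)
  finally have 2: "?c * B \<le> \<kappa> * r * H * A" .
  have "(?c * A) * (?c * B) \<le> (\<kappa> * q * G * B) * (\<kappa> * r * H * A)"
    by (rule mult_mono[OF 1 2]) (use pos nonneg \<kappa> q r in \<open>auto intro!: mult_nonneg_nonneg\<close>)
  then have "(A * B) * ?c\<^sup>2 \<le> (A * B) * (\<kappa>\<^sup>2 * q * r * G * H)"
    by (simp add: power2_eq_square mult_ac)
  then have "?c\<^sup>2 \<le> \<kappa>\<^sup>2 * q * r * G * H"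
    using pos by simp
  then have "1 \<le> (\<kappa>\<^sup>2 * q * r / ?c\<^sup>2) * G * H"
    using pos by (simp add: field_simps)
  then show ?thesis
    using x y unfolding G_H_def by blast
qed

lemma weight_bounded:
  assumes "\<delta> > 0"
  shows "\<exists>M>0. \<forall>x. norm x \<ge> \<delta> \<longrightarrow> norm x powr \<alpha> * U x powr (r - 1) \<le> M"
proof (rule bounded_above_away_from_0[OF _ decU' assms])
  fix x :: "real ^ 'n" assume "x \<noteq> 0"
  then show "isCont (\<lambda>x. norm x powr \<alpha> * U x powr (r - 1)) x"
    using contU posU[of x] by (intro continuous_intros) auto
qed

lemma weight_le:
  assumes e: "norm e = 1" and \<mu>: "\<mu> < 0" and x: "x \<in> half_space e \<mu>"
  shows "(\<mu> - x \<bullet> e) powr \<alpha> * U x powr (r - 1) \<le> norm x powr \<alpha> * U x powr (r - 1)"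
  using half_space_norm[OF e \<mu> x] \<alpha> by (intro mult_right_mono powr_mono2) auto

definition mirror_dominates :: "real ^ 'n \<Rightarrow> real \<Rightarrow> bool" where
  "mirror_dominates e \<mu> \<longleftrightarrow> (\<forall>x \<in> half_space e \<mu>. x \<noteq> mirror e \<mu> 0 \<longrightarrow> gap U e \<mu> x \<ge> 0 \<and> gap V e \<mu> x \<ge> 0)"

lemma mirror_dominates_start:
  assumes e: "norm e = 1"
  shows "\<exists>R. \<forall>\<mu><R. mirror_dominates e \<mu>"
proof -
  interpret sw: singular_system \<alpha> r q \<kappa> V U
    by (rule swapped)
  define K where "K = \<kappa>\<^sup>2 * q * r / (min_const \<alpha> TYPE('n))\<^sup>2"
  have K: "K > 0"
    using \<kappa> q r min_const_pos[of \<alpha>, where 'n = 'n] by (simp add: K_def)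
  define \<theta> where "\<theta> = min 1 (1 / (2 * K))"
  have \<theta>: "\<theta> > 0" "\<theta> \<le> 1" "\<theta> \<le> 1 / (2 * K)"
    using K by (auto simp: \<theta>_def)
  have "\<forall>\<^sub>F x in at_infinity. norm x powr \<alpha> * U x powr (r - 1) < \<theta> \<and> norm x powr \<alpha> * V x powr (q - 1) < \<theta>"
    using order_tendstoD(2)[OF decU' \<theta>(1)] order_tendstoD(2)[OF decV' \<theta>(1)] by eventually_elim blast
  then obtain R where R: "\<And>x. norm x \<ge> R \<Longrightarrow> norm x powr \<alpha> * U x powr (r - 1) < \<theta> \<and> norm x powr \<alpha> * V x powr (q - 1) < \<theta>"
    unfolding eventually_at_infinity by blast
  have "mirror_dominates e \<mu>" if \<mu>: "\<mu> < min (- R) 0" for \<mu>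
  proof (rule ccontr)
    assume "\<not> mirror_dominates e \<mu>"
    then obtain x0 where "x0 \<in> half_space e \<mu>" "x0 \<noteq> mirror e \<mu> 0" "gap U e \<mu> x0 < 0 \<or> gap V e \<mu> x0 < 0"
      unfolding mirror_dominates_def by force
    moreover have \<mu>0: "\<mu> < 0"
      using \<mu> by simp
    ultimately obtain x y where xy: "neg_min U e \<mu> x" "neg_min V e \<mu> y"
      "1 \<le> K * ((\<mu> - x \<bullet> e) powr \<alpha> * V x powr (q - 1)) * ((\<mu> - y \<bullet> e) powr \<alpha> * U y powr (r - 1))"
      using minima_estimate[OF e] unfolding K_def by blast
    have x: "x \<in> half_space e \<mu>" and y: "y \<in> half_space e \<mu>"
      using xy by (auto simp: neg_min_def)
    have "(\<mu> - x \<bullet> e) powr \<alpha> * V x powr (q - 1) \<le> \<theta>"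
      using sw.weight_le[OF e \<mu>0 x] R[of x] half_space_norm(1)[OF e \<mu>0 x] \<mu> by force
    moreover have "(\<mu> - y \<bullet> e) powr \<alpha> * U y powr (r - 1) \<le> \<theta>"
      using weight_le[OF e \<mu>0 y] R[of y] half_space_norm(1)[OF e \<mu>0 y] \<mu> by force
    ultimately have "K * ((\<mu> - x \<bullet> e) powr \<alpha> * V x powr (q - 1)) * ((\<mu> - y \<bullet> e) powr \<alpha> * U y powr (r - 1)) \<le> K * \<theta> * \<theta>"
      using K \<theta> by (intro mult_mono mult_left_mono) auto
    also have "\<dots> \<le> K * \<theta> * 1"
      using K \<theta> by (intro mult_left_mono) auto
    also have "\<dots> \<le> 1 / 2"
      using K \<theta>(3) by (simp add: field_simps)
    finally show False
      using xy(3) by simp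
  qed
  then show ?thesis
    by blast
qed

lemma tendsto_mirror:
  assumes "x \<longlonglongrightarrow> a" "m \<longlonglongrightarrow> \<mu>"
  shows "(\<lambda>k. mirror e (m k) (x k)) \<longlonglongrightarrow> mirror e \<mu> a"
  unfolding mirror_def using assms by (intro tendsto_intros)

text \<open>The limit cannot be the mirror image of the origin, since \<open>U\<close> at the reflected points would tend to infinity while
  staying below the bounded values of \<open>U\<close> at the points themselves.\<close>

lemma limit_of_negative_gaps:
  assumes e: "norm e = 1" and \<mu>: "\<mu> < 0" and x: "x \<longlonglongrightarrow> a" and m: "m \<longlonglongrightarrow> \<mu>"
    and a: "a \<in> half_space e \<mu>"
    and xk: "\<And>k. x k \<in> half_space e (m k)" "\<And>k. x k \<noteq> mirror e (m k) 0" "\<And>k. m k < 0" "\<And>k. gap U e (m k) (x k) < 0"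
  shows "a \<noteq> mirror e \<mu> 0" "gap U e \<mu> a \<le> 0"
proof -
  have a0: "a \<noteq> 0"
    using a \<mu> half_space_nonzero[OF e \<mu>, of a] by (auto simp: half_space_def)
  have lim1: "(\<lambda>k. U (x k)) \<longlonglongrightarrow> U a"
    using isCont_tendsto_compose[OF contU[OF a0] x] .
  have refl_lim: "(\<lambda>k. mirror e (m k) (x k)) \<longlonglongrightarrow> mirror e \<mu> a"
    by (rule tendsto_mirror[OF x m])
  have lt: "U (mirror e (m k) (x k)) \<le> U (x k)" for k
    using xk(4)[of k] by (simp add: gap_def)
  show ne: "a \<noteq> mirror e \<mu> 0"
  proof
    assume "a = mirror e \<mu> 0"
    then have "(\<lambda>k. mirror e (m k) (x k)) \<longlonglongrightarrow> 0"
      using refl_lim by (simp add: mirror_mirror[OF e])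
    moreover have "mirror e (m k) (x k) \<noteq> 0" for k
      using xk(2)[of k] mirror_eq_0_iff[OF e xk(3)] by blast
    ultimately have "filterlim (\<lambda>k. mirror e (m k) (x k)) (at 0) sequentially"
      by (intro filterlim_atI) auto
    then have "filterlim (\<lambda>k. U (mirror e (m k) (x k))) at_top sequentially"
      by (rule filterlim_compose[OF poleU])
    then have "filterlim (\<lambda>k. U (x k)) at_top sequentially"
      by (rule filterlim_at_top_mono) (simp add: lt)
    then show False
      using not_tendsto_and_filterlim_at_infinity[OF sequentially_bot lim1] filterlim_at_top_imp_at_infinity by blast
  qed
  have "mirror e \<mu> a \<noteq> 0"
    using ne mirror_eq_0_iff[OF e \<mu>] by blast
  from isCont_tendsto_compose[OF contU[OF this] refl_lim]
  have "(\<lambda>k. U (mirror e (m k) (x k))) \<longlonglongrightarrow> U (mirror e \<mu> a)" .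
  from LIMSEQ_le[OF this lim1] lt show "gap U e \<mu> a \<le> 0"
    by (auto simp: gap_def)
qed

lemma gap_nonneg_limit:
  assumes m: "m \<longlonglongrightarrow> \<mu>" and x: "mirror e \<mu> x \<noteq> 0"
    and nonneg: "\<And>k. x \<bullet> e < m k \<Longrightarrow> mirror e (m k) x \<noteq> 0 \<Longrightarrow> gap U e (m k) x \<ge> 0" and less: "x \<bullet> e < \<mu>"
  shows "gap U e \<mu> x \<ge> 0"
proof -
  have lim: "(\<lambda>k. mirror e (m k) x) \<longlonglongrightarrow> mirror e \<mu> x"
    by (rule tendsto_mirror[OF tendsto_const m])
  have "\<forall>\<^sub>F k in sequentially. U x \<le> U (mirror e (m k) x)"
    using order_tendstoD(1)[OF m less] tendsto_imp_eventually_ne[OF lim x]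
    by eventually_elim (use nonneg in \<open>simp add: gap_def\<close>)
  then have "U x \<le> U (mirror e \<mu> x)"
    by (intro tendsto_lowerbound[OF isCont_tendsto_compose[OF contU[OF x] lim]]) auto
  then show ?thesis
    by (simp add: gap_def)
qed

lemma mirror_dominates_limit:
  assumes e: "norm e = 1" and \<mu>: "\<mu> < 0" and below: "\<And>\<nu>. \<nu> < \<mu> \<Longrightarrow> mirror_dominates e \<nu>"
    and x: "x \<in> half_space e \<mu>" "x \<noteq> mirror e \<mu> 0"
  shows "gap U e \<mu> x \<ge> 0"
proof -
  define m where "m k = \<mu> - inverse (real (Suc k))" for k
  have m: "m \<longlonglongrightarrow> \<mu>"
    unfolding m_def using tendsto_diff[OF tendsto_const LIMSEQ_inverse_real_of_nat, of \<mu>] by simp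
  show ?thesis
  proof (rule gap_nonneg_limit[OF m])
    fix k assume k: "x \<bullet> e < m k" "mirror e (m k) x \<noteq> 0"
    have mk: "m k < \<mu>" "m k < 0"
      using \<mu> by (auto simp: m_def intro: order.strict_trans)
    then show "gap U e (m k) x \<ge> 0"
      using k below[OF mk(1)] mirror_eq_0_iff[OF e mk(2)] unfolding mirror_dominates_def half_space_def by blast
  qed (use x mirror_eq_0_iff[OF e \<mu>] in \<open>auto simp: half_space_def\<close>)
qed

text \<open>Let \<open>\<mu>0\<close> be the infimum of the positions at which domination fails. It holds at \<open>\<mu>0\<close> itself by
  continuity from below, so failing positions accumulate at \<open>\<mu>0\<close> from above. The estimate on pairs of minima
  keeps the minima of \<open>U\<close> in a bounded region and away from the mirrors, and a limit point contradicts the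
  strict positivity of the gap at \<open>\<mu>0\<close>.\<close>

lemma mirror_dominates_always:
  assumes e: "norm e = 1" and \<mu>: "\<mu> < 0"
  shows "mirror_dominates e \<mu>"
proof (rule ccontr)
  interpret sw: singular_system \<alpha> r q \<kappa> V U
    by (rule swapped)
  have sw_dominates: "sw.mirror_dominates e \<nu> \<longleftrightarrow> mirror_dominates e \<nu>" for \<nu>
    unfolding mirror_dominates_def sw.mirror_dominates_def by blast
  assume bad: "\<not> mirror_dominates e \<mu>"
  define B where "B = {\<nu>. \<nu> < 0 \<and> \<not> mirror_dominates e \<nu>}"
  obtain R where R: "\<And>\<nu>. \<nu> < R \<Longrightarrow> mirror_dominates e \<nu>"
    using mirror_dominates_start[OF e] by blast
  have bdd: "bdd_below B"
    using R by (intro bdd_belowI[of _ R]) (force simp: B_def not_less[symmetric])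
  have \<mu>B: "\<mu> \<in> B"
    using \<mu> bad by (simp add: B_def)
  define \<mu>0 where "\<mu>0 = Inf B"
  have \<mu>0: "\<mu>0 < 0"
    using cInf_lower[OF \<mu>B bdd] \<mu> by (simp add: \<mu>0_def)
  have below: "mirror_dominates e \<nu>" if "\<nu> < \<mu>0" for \<nu>
    using cInf_lower[of \<nu> B] bdd that \<mu>0 by (auto simp: \<mu>0_def B_def)
  have nonneg: "gap U e \<mu>0 x \<ge> 0 \<and> gap V e \<mu>0 x \<ge> 0" if "x \<in> half_space e \<mu>0" "x \<noteq> mirror e \<mu>0 0" for x
    using mirror_dominates_limit[OF e \<mu>0 below that] sw.mirror_dominates_limit[OF e \<mu>0 _ that] below sw_dominates by blast
  then have dominates0: "mirror_dominates e \<mu>0"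
    unfolding mirror_dominates_def by blast
  (* failing positions that converge to \<mu>0; the bound \<mu>0/2 keeps all their half spaces at a fixed distance
     from the origin, where U and V are bounded *)
  have "\<exists>\<nu>\<in>B. \<nu> < \<mu>0 + min (inverse (real (Suc k))) (- \<mu>0 / 2)" for k
    using cInf_lessD[of B "\<mu>0 + min (inverse (real (Suc k))) (- \<mu>0 / 2)"] \<mu>B \<mu>0 by (auto simp: \<mu>0_def[symmetric])
  then obtain m where m: "\<And>k. m k \<in> B" "\<And>k. m k < \<mu>0 + min (inverse (real (Suc k))) (- \<mu>0 / 2)"
    by metis
  have m_ge: "\<mu>0 \<le> m k" for k
    unfolding \<mu>0_def by (rule cInf_lower[OF m(1) bdd])
  have m_half: "m k < \<mu>0 / 2" and m0: "m k < 0" for k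
    using m(2)[of k] \<mu>0 by auto
  have "m \<longlonglongrightarrow> \<mu>0"
  proof (rule tendsto_sandwich[of "\<lambda>_. \<mu>0"])
    show "(\<lambda>k. \<mu>0 + inverse (real (Suc k))) \<longlonglongrightarrow> \<mu>0"
      using LIMSEQ_inverse_real_of_nat_add[of \<mu>0] .
    show "\<forall>\<^sub>F k in sequentially. m k \<le> \<mu>0 + inverse (real (Suc k))"
      using m(2) by (intro always_eventually allI) (meson less_imp_le min.boundedE add_le_cancel_left order.trans min.cobounded1)
  qed (use m_ge in auto)
  note m_lim = this
  define K where "K = \<kappa>\<^sup>2 * q * r / (min_const \<alpha> TYPE('n))\<^sup>2"
  have K: "K > 0"
    using \<kappa> q r min_const_pos[of \<alpha>, where 'n = 'n] by (simp add: K_def)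
  have "\<exists>x y. neg_min U e (m k) x \<and> neg_min V e (m k) y \<and>
    1 \<le> K * ((m k - x \<bullet> e) powr \<alpha> * V x powr (q - 1)) * ((m k - y \<bullet> e) powr \<alpha> * U y powr (r - 1))" for k
  proof -
    have "\<not> mirror_dominates e (m k)"
      using m(1)[of k] by (simp add: B_def)
    then obtain x0 where "x0 \<in> half_space e (m k)" "x0 \<noteq> mirror e (m k) 0" "gap U e (m k) x0 < 0 \<or> gap V e (m k) x0 < 0"
      unfolding mirror_dominates_def by force
    then show ?thesis
      unfolding K_def by (rule minima_estimate[OF e m0])
  qed
  then obtain x y where xy: "\<And>k. neg_min U e (m k) (x k)" "\<And>k. neg_min V e (m k) (y k)"
    "\<And>k. 1 \<le> K * ((m k - x k \<bullet> e) powr \<alpha> * V (x k) powr (q - 1)) * ((m k - y k \<bullet> e) powr \<alpha> * U (y k) powr (r - 1))"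
    by metis
  have xin: "x k \<in> half_space e (m k)" and yin: "y k \<in> half_space e (m k)" for k
    using xy(1,2)[of k] by (auto simp: neg_min_def)
  define \<delta> where "\<delta> = - \<mu>0 / 2"
  have \<delta>: "\<delta> > 0"
    using \<mu>0 by (simp add: \<delta>_def)
  have norm_ge: "norm (x k) \<ge> \<delta>" "norm (y k) \<ge> \<delta>" for k
    using half_space_norm(1)[OF e m0 xin] half_space_norm(1)[OF e m0 yin] m_half[of k] m0[of k]
    by (smt (verit, best) \<delta>_def minus_divide_left)+
  obtain M where M: "M > 0" "\<And>z. norm z \<ge> \<delta> \<Longrightarrow> norm z powr \<alpha> * U z powr (r - 1) \<le> M"
    using weight_bounded[OF \<delta>] by blast
  define c where "c = 1 / (K * M)"
  have c: "c > 0"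
    using K M by (simp add: c_def)
  have lower: "c \<le> (m k - x k \<bullet> e) powr \<alpha> * V (x k) powr (q - 1)" for k
  proof -
    define G where "G = (m k - x k \<bullet> e) powr \<alpha> * V (x k) powr (q - 1)"
    have G: "G \<ge> 0"
      by (simp add: G_def)
    have "1 \<le> K * G * ((m k - y k \<bullet> e) powr \<alpha> * U (y k) powr (r - 1))"
      using xy(3)[of k] by (simp add: G_def)
    also have "\<dots> \<le> K * G * M"
      using weight_le[OF e m0 yin[of k]] M(2)[OF norm_ge(2)[of k]] K G by (intro mult_left_mono) auto
    finally have "c \<le> G"
      using K M(1) by (simp add: c_def field_simps)
    then show ?thesis
      by (simp add: G_def)
  qed
  have "\<forall>\<^sub>F z in at_infinity. norm z powr \<alpha> * V z powr (q - 1) < c"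
    using decV' c by (rule order_tendstoD)
  then obtain R1 where R1: "\<And>z. norm z \<ge> R1 \<Longrightarrow> norm z powr \<alpha> * V z powr (q - 1) < c"
    unfolding eventually_at_infinity by blast
  have x_bdd: "norm (x k) < R1" for k
    using lower[of k] sw.weight_le[OF e m0 xin[of k]] R1[of "x k"] by fastforce
  obtain M' where M': "M' > 0" "\<And>z. norm z \<ge> \<delta> \<Longrightarrow> V z \<le> M'"
    using bounded_above_away_from_0[OF contV decV \<delta>] by blast
  define c' where "c' = (c / M' powr (q - 1)) powr (1 / \<alpha>)"
  have c': "c' > 0"
    using c M' by (simp add: c'_def)
  have d_ge: "c' \<le> m k - x k \<bullet> e" for k
  proof -
    have d: "m k - x k \<bullet> e > 0"
      using half_space_norm(3)[OF e m0 xin[of k]] .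
    have "V (x k) > 0"
      using norm_ge(1)[of k] \<delta> by (intro posV) auto
    then have "V (x k) powr (q - 1) \<le> M' powr (q - 1)"
      using M'(2)[OF norm_ge(1)] q by (intro powr_mono2) auto
    then have "c \<le> (m k - x k \<bullet> e) powr \<alpha> * M' powr (q - 1)"
      using lower[of k] mult_left_mono[of "V (x k) powr (q - 1)" "M' powr (q - 1)" "(m k - x k \<bullet> e) powr \<alpha>"] by simp
    then have "c / M' powr (q - 1) \<le> (m k - x k \<bullet> e) powr \<alpha>"
      using M' by (simp add: divide_le_eq)
    then have "c' \<le> ((m k - x k \<bullet> e) powr \<alpha>) powr (1 / \<alpha>)"
      unfolding c'_def using c M' \<alpha> by (intro powr_mono2) auto
    then show ?thesis
      using d \<alpha> by (simp add: powr_powr)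
  qed
  have "compact (cball (0 :: real ^ 'n) R1)"
    by simp
  then have "\<exists>a\<in>cball 0 R1. \<exists>f :: nat \<Rightarrow> nat. strict_mono f \<and> (x \<circ> f) \<longlonglongrightarrow> a"
    using x_bdd unfolding compact_def by (auto dest!: spec[of _ x] intro: less_imp_le)
  then obtain a f where f: "strict_mono f" and lim: "(\<lambda>k. x (f k)) \<longlonglongrightarrow> a"
    unfolding o_def by blast
  have m_lim': "(\<lambda>k. m (f k)) \<longlonglongrightarrow> \<mu>0"
    using LIMSEQ_subseq_LIMSEQ[OF m_lim f] by (simp add: o_def)
  have "(\<lambda>k. m (f k) - x (f k) \<bullet> e) \<longlonglongrightarrow> \<mu>0 - a \<bullet> e"
    by (intro tendsto_intros m_lim' lim)
  then have "c' \<le> \<mu>0 - a \<bullet> e"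
    by (rule LIMSEQ_le_const) (use d_ge in auto)
  then have a: "a \<in> half_space e \<mu>0"
    using c' by (simp add: half_space_def)
  have "a \<noteq> mirror e \<mu>0 0" "gap U e \<mu>0 a \<le> 0"
    using limit_of_negative_gaps[OF e \<mu>0 lim m_lim' a xin _ m0] xy(1) unfolding neg_min_def by blast+
  then show False
    using gap_positive[OF e \<mu>0 nonneg a] by simp
qed

text \<open>Let \<open>\<mu>\<close> increase to \<open>0\<close> in the direction \<open>e\<close> and in the direction \<open>-e\<close>: the two mirrors have the same limit, but the two
  resulting inequalities are opposite.\<close>

lemma mirror_through_origin_eq:
  assumes e: "norm e = 1" and x: "x \<noteq> 0"
  shows "U (mirror e 0 x) = U x"
proof -
  have half: "U y \<le> U (mirror e 0 y)" if e: "norm e = 1" and y: "y \<bullet> e < 0" for e y :: "real ^ 'n"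
  proof -
    define m where "m k = - inverse (real (Suc k))" for k
    have m0: "m k < 0" for k
      by (simp add: m_def)
    have m: "m \<longlonglongrightarrow> 0"
      unfolding m_def using tendsto_minus[OF LIMSEQ_inverse_real_of_nat] by simp
    have y0: "mirror e 0 y \<noteq> 0"
      using y mirror_inner[OF e, of 0 y] by auto
    have "gap U e 0 y \<ge> 0"
    proof (rule gap_nonneg_limit[OF m y0 _ y])
      fix k assume "y \<bullet> e < m k" "mirror e (m k) y \<noteq> 0"
      then show "gap U e (m k) y \<ge> 0"
        using mirror_dominates_always[OF e m0[of k]] mirror_eq_0_iff[OF e m0] unfolding mirror_dominates_def half_space_def by blast
    qed
    then show ?thesis
      by (simp add: gap_def)
  qed
  have neg: "mirror (- e) 0 y = mirror e 0 y" for y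
    by (simp add: mirror_def)
  have e': "norm (- e) = 1"
    using e by simp
  have le: "U x \<le> U (mirror e 0 x)" if "x \<bullet> e \<noteq> 0" for x
    using half[OF e, of x] half[OF e', of x] that unfolding neg by (cases "x \<bullet> e < 0") auto
  show ?thesis
  proof (cases "x \<bullet> e = 0")
    case True
    then show ?thesis
      by (simp add: mirror_def)
  next
    case False
    then show ?thesis
      using le[of x] le[of "mirror e 0 x"] mirror_mirror[OF e, of 0 x] mirror_inner[OF e, of 0 x] by auto
  qed
qed

lemma radial:
  assumes "norm x = norm y" "x \<noteq> 0"
  shows "U x = U y"
proof (cases "x = y")
  case False
  define e where "e = (1 / norm (x - y)) *\<^sub>R (x - y)"
  have e: "norm e = 1"
    using False by (simp add: e_def)
  (* as x and y have equal norm, the reflection in the hyperplane orthogonal to x - y exchanges them *)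
  have "2 * (x \<bullet> (x - y)) = (norm (x - y))\<^sup>2"
    using assms by (simp add: power2_norm_eq_inner inner_diff_left inner_diff_right inner_commute norm_eq)
  moreover have "2 * (x \<bullet> e) = 2 * (x \<bullet> (x - y)) / norm (x - y)"
    unfolding e_def inner_scaleR_right by simp
  ultimately have "2 * (x \<bullet> e) = norm (x - y)"
    using False by (simp only: power2_eq_square) simp
  then have "mirror e 0 x = x - norm (x - y) *\<^sub>R e"
    by (simp add: mirror_def)
  also have "\<dots> = y"
    using False by (simp add: e_def)
  finally show ?thesis
    using mirror_through_origin_eq[OF e assms(2)] by simp
qed simp

end

section \<open>Solutions of the original system\<close>

lemma pv_frac_laplacian:
  fixes u :: "real ^ 'n \<Rightarrow> real"
  assumes u: "u \<in> L_space \<alpha> \<inter> C11_loc" and \<alpha>: "0 < \<alpha>" "\<alpha> < 2" and C: "C > 0"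
  shows "has_pv \<alpha> u x (frac_laplacian C \<alpha> u x / C)"
proof -
  obtain L where L: "has_pv \<alpha> u x L"
    using pv_exists[OF _ C11_loc_quadratic_at \<alpha>] u by blast
  then have "Lim (at_right 0) (\<lambda>eps. LINT y:(UNIV - ball x eps)|lebesgue. dq \<alpha> u x y) = L"
    by (intro tendsto_Lim) auto
  then show ?thesis
    using L C by (simp add: frac_laplacian_dq)
qed

text \<open>At a minimum the integrand is nonpositive, so the truncated integrals decrease as the ball shrinks and lie
  below the strictly negative integral over the complement of a large ball.\<close>

lemma frac_laplacian_neg_at_minimum:
  fixes u :: "real ^ 'n \<Rightarrow> real"
  assumes u: "u \<in> L_space \<alpha> \<inter> C11_loc" and \<alpha>: "0 < \<alpha>" "\<alpha> < 2" and C: "C > 0"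
    and min: "\<And>y. u x \<le> u y" and far: "\<And>y. norm y \<ge> R \<Longrightarrow> u x < u y"
  shows "frac_laplacian C \<alpha> u x < 0"
proof -
  define \<rho> where "\<rho> = norm x + \<bar>R\<bar> + 1"
  have \<rho>: "\<rho> > 0"
    by (simp add: \<rho>_def add_nonneg_pos)
  have int: "set_integrable lebesgue (UNIV - ball x eps) (dq \<alpha> u x)" if "eps > 0" for eps
    by (rule L_space_dq_integrable[OF _ \<alpha>(1) that]) (use u in \<open>auto simp: dist_norm\<close>)
  have nonpos: "dq \<alpha> u x y \<le> 0" for y
    using min[of y] by (simp add: dq_def divide_nonpos_nonneg)
  define I where "I = (LINT y:(UNIV - ball x \<rho>)|lebesgue. dq \<alpha> u x y)"
  have "I < 0"
    unfolding I_def
  proof (rule set_integral_negative[OF int[OF \<rho>]])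
    (* any unit vector serves to place a ball in the complement *)
    let ?z = "x + (\<rho> + 1) *\<^sub>R axis undefined 1"
    show "ball ?z 1 \<subseteq> UNIV - ball x \<rho>"
    proof
      fix y assume "y \<in> ball ?z 1"
      then have "norm (?z - y) < 1"
        by (simp add: dist_norm)
      moreover have "norm (?z - x) = \<rho> + 1"
        using \<rho> by (simp add: norm_axis_1)
      moreover have "norm (?z - x) \<le> norm (?z - y) + norm (x - y)"
        using norm_triangle_ineq4[of "?z - y" "x - y"] by simp
      ultimately have "norm (x - y) \<ge> \<rho>"
        by linarith
      then show "y \<in> UNIV - ball x \<rho>"
        by (simp add: dist_norm)
    qed
    fix y assume "y \<in> UNIV - ball x \<rho>"
    then have "norm (x - y) \<ge> \<rho>"
      by (simp add: dist_norm)
    moreover have "norm (x - y) \<le> norm x + norm y"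
      by (rule norm_triangle_ineq4)
    ultimately have "norm y \<ge> R" "norm (x - y) > 0"
      using \<rho> by (auto simp: \<rho>_def)
    then show "dq \<alpha> u x y < 0"
      using far[of y] by (simp add: dq_def divide_neg_pos)
  qed auto
  have ev: "\<forall>\<^sub>F eps in at_right 0. (LINT y:(UNIV - ball x eps)|lebesgue. dq \<alpha> u x y) \<le> I"
    using eventually_at_right_0_less[OF \<rho>]
  proof eventually_elim
    case (elim eps)
    show ?case
      unfolding I_def set_lebesgue_integral_def
    proof (rule integral_mono)
      show "indicator (UNIV - ball x eps) y *\<^sub>R dq \<alpha> u x y \<le> indicator (UNIV - ball x \<rho>) y *\<^sub>R dq \<alpha> u x y" for y
        using nonpos[of y] elim by (auto simp: indicator_def)
    qed (use int[OF \<rho>] int[of eps] elim in \<open>auto simp: set_integrable_def\<close>)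
  qed
  have "frac_laplacian C \<alpha> u x / C \<le> I"
    by (rule tendsto_upperbound[OF pv_frac_laplacian[OF u \<alpha> C] ev]) simp
  then show ?thesis
    using \<open>I < 0\<close> C by (simp add: divide_le_eq mult_neg_pos order.strict_trans1)
qed

lemma no_blowup_solution:
  fixes u :: "real ^ 'n \<Rightarrow> real"
  assumes u: "u \<in> L_space \<alpha> \<inter> C11_loc" and \<alpha>: "0 < \<alpha>" "\<alpha> < 2" and C: "C > 0"
    and nonneg: "\<And>x. frac_laplacian C \<alpha> u x \<ge> 0"
  shows "\<not> filterlim u at_top at_infinity"
proof
  assume "filterlim u at_top at_infinity"
  then have "\<forall>\<^sub>F x in at_infinity. u 0 < u x"
    by (simp add: filterlim_at_top_dense)
  then obtain R where R: "\<And>x. norm x \<ge> R \<Longrightarrow> u 0 < u x"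
    unfolding eventually_at_infinity by blast
  have "isCont u x" for x
    using u by (intro quadratic_at_continuous C11_loc_quadratic_at) auto
  then have "continuous_on (cball 0 \<bar>R\<bar>) u"
    by (intro continuous_at_imp_continuous_on) auto
  then obtain x where x: "x \<in> cball 0 \<bar>R\<bar>" "\<And>y. y \<in> cball 0 \<bar>R\<bar> \<Longrightarrow> u x \<le> u y"
    using continuous_attains_inf[of "cball 0 \<bar>R\<bar>" u] by auto
  have x0: "u x \<le> u 0"
    by (rule x(2)) simp
  have min: "u x \<le> u y" for y
  proof (cases "norm y \<le> \<bar>R\<bar>")
    case True
    then show ?thesis
      by (intro x(2)) simp
  next
    case False
    then have "u 0 < u y"
      by (intro R) linarith
    then show ?thesis
      using x0 by linarith
  qed
  have "frac_laplacian C \<alpha> u x < 0"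
    using x0 R by (intro frac_laplacian_neg_at_minimum[OF u \<alpha> C min, of R]) (meson order.strict_trans1)
  then show False
    using nonneg[of x] by simp
qed

lemma filterlim_sph_inv_at_0: "filterlim (sph_inv 1) at_infinity (at (0 :: real ^ 'n))"
proof (rule filterlim_norm_at_top_imp_at_infinity)
  have "filterlim (\<lambda>x :: real ^ 'n. inverse (norm x)) at_top (at 0)"
    by (rule filterlim_compose[OF filterlim_inverse_at_top_right])
      (auto simp: filterlim_at eventually_at_filter intro!: tendsto_norm_zero)
  then show "filterlim (\<lambda>x :: real ^ 'n. norm (sph_inv 1 x)) at_top (at 0)"
    by (simp add: norm_sph_inv inverse_eq_divide)
qed

lemma filterlim_sph_inv_at_infinity: "(sph_inv 1 \<longlongrightarrow> (0 :: real ^ 'n)) at_infinity"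
proof (rule tendsto_norm_zero_cancel)
  have "((\<lambda>x :: real ^ 'n. inverse (norm x)) \<longlongrightarrow> 0) at_infinity"
    by (intro tendsto_inverse_0_at_top filterlim_at_infinity_imp_norm_at_top filterlim_ident)
  then show "((\<lambda>x :: real ^ 'n. norm (sph_inv 1 x)) \<longlongrightarrow> 0) at_infinity"
    by (simp add: norm_sph_inv inverse_eq_divide)
qed

lemma norm_sph_inv_powr: "norm (sph_inv 1 x) powr s = norm x powr (- s)" for x :: "real ^ 'n"
  by (simp add: norm_sph_inv powr_minus_divide powr_divide)

context
  fixes u :: "real ^ 'n \<Rightarrow> real" and \<alpha> :: real
  assumes \<alpha>: "0 < \<alpha>" "\<alpha> < real CARD('n)"
    and cont: "isCont u 0" and pos: "\<And>x. u x > 0"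
begin

lemma kelvin_pos: "x \<noteq> 0 \<Longrightarrow> kelvin \<alpha> u x > 0"
  using pos by (simp add: kelvin_def)

lemma kelvin_at_0:
  assumes "filterlim (\<lambda>x. norm x powr (real CARD('n) - \<alpha>) * u x) at_top at_infinity"
  shows "filterlim (kelvin \<alpha> u) at_top (at 0)"
  using filterlim_compose[OF assms filterlim_sph_inv_at_0] by (simp add: norm_sph_inv_powr kelvin_def[abs_def])

lemma kelvin_power_at_infinity:
  assumes "s \<ge> 0" "a < (real CARD('n) - \<alpha>) * s"
  shows "((\<lambda>x. norm x powr a * kelvin \<alpha> u x powr s) \<longlongrightarrow> 0) at_infinity"
proof -
  have "((\<lambda>x. u (sph_inv 1 x)) \<longlongrightarrow> u 0) at_infinity"
    by (rule isCont_tendsto_compose[OF cont filterlim_sph_inv_at_infinity])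
  then have 1: "((\<lambda>x. u (sph_inv 1 x) powr s) \<longlongrightarrow> u 0 powr s) at_infinity"
    using pos[of 0] by (intro tendsto_intros) auto
  have 2: "((\<lambda>x :: real ^ 'n. norm x powr (a - (real CARD('n) - \<alpha>) * s)) \<longlongrightarrow> 0) at_infinity"
    using assms by (intro tendsto_neg_powr filterlim_at_infinity_imp_norm_at_top filterlim_ident) auto
  have eq: "norm x powr a * kelvin \<alpha> u x powr s
      = norm x powr (a - (real CARD('n) - \<alpha>) * s) * u (sph_inv 1 x) powr s" for x
  proof -
    have "norm x powr a * kelvin \<alpha> u x powr s = norm x powr a * norm x powr ((\<alpha> - real CARD('n)) * s) * u (sph_inv 1 x) powr s"
      by (simp add: kelvin_def powr_mult powr_powr)
    also have "norm x powr a * norm x powr ((\<alpha> - real CARD('n)) * s) = norm x powr (a - (real CARD('n) - \<alpha>) * s)"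
      unfolding powr_add[symmetric] by (simp add: algebra_simps)
    finally show ?thesis .
  qed
  show ?thesis
    unfolding eq using tendsto_mult[OF 2 1] by simp
qed

lemma kelvin_radially_symmetric:
  assumes "\<And>x y. norm x = norm y \<Longrightarrow> x \<noteq> 0 \<Longrightarrow> kelvin \<alpha> u x = kelvin \<alpha> u y"
  shows "radially_symmetric u"
  unfolding radially_symmetric_def
proof (intro allI impI)
  fix x y :: "real ^ 'n" assume xy: "norm x = norm y"
  show "u x = u y"
  proof (cases "x = 0")
    case True
    then show ?thesis
      using xy by simp
  next
    case False
    have y: "y \<noteq> 0"
      using xy False by (metis norm_eq_zero)
    have "norm (sph_inv 1 x) = norm (sph_inv 1 y)" "sph_inv 1 x \<noteq> 0"
      using xy False y by (simp_all add: norm_sph_inv sph_inv_def)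
    then have "kelvin \<alpha> u (sph_inv 1 x) = kelvin \<alpha> u (sph_inv 1 y)"
      by (rule assms)
    then show ?thesis
      using xy False y by (simp add: kelvin_def norm_sph_inv_powr sph_inv_sph_inv)
  qed
qed

end

lemma kelvin_equation:
  fixes u v :: "real ^ 'n \<Rightarrow> real"
  assumes u: "u \<in> L_space \<alpha> \<inter> C11_loc" and \<alpha>: "0 < \<alpha>" "\<alpha> < 2" and C: "C > 0"
    and eq: "\<And>x. frac_laplacian C \<alpha> u x = norm x powr ((real CARD('n) - \<alpha>) * q - (real CARD('n) + \<alpha>)) * v x powr q"
    and x: "x \<noteq> 0"
  shows "has_pv \<alpha> (kelvin \<alpha> u) x (1 / C * kelvin \<alpha> v x powr q)"
proof -
  let ?n = "real CARD('n)"
  have "norm x powr (- (?n + \<alpha>)) * (frac_laplacian C \<alpha> u (sph_inv 1 x) / C)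
      = 1 / C * (norm x powr (- (?n + \<alpha>)) * norm x powr (- ((?n - \<alpha>) * q - (?n + \<alpha>))) * v (sph_inv 1 x) powr q)"
    by (simp add: eq norm_sph_inv_powr)
  also have "norm x powr (- (?n + \<alpha>)) * norm x powr (- ((?n - \<alpha>) * q - (?n + \<alpha>))) = (norm x powr (\<alpha> - ?n)) powr q"
    unfolding powr_add[symmetric] powr_powr by (simp add: algebra_simps)
  also have "(norm x powr (\<alpha> - ?n)) powr q * v (sph_inv 1 x) powr q = kelvin \<alpha> v x powr q"
    by (simp add: kelvin_def powr_mult)
  finally have rhs: "norm x powr (- (?n + \<alpha>)) * (frac_laplacian C \<alpha> u (sph_inv 1 x) / C) = 1 / C * kelvin \<alpha> v x powr q" .
  show ?thesis
    using kelvin_pv[OF IntD1[OF u] C11_loc_quadratic_at[OF IntD2[OF u]] \<alpha> x pv_frac_laplacian[OF u \<alpha> C]]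
    unfolding rhs .
qed

theorem theorem7:
  fixes u v :: "real ^ 'n \<Rightarrow> real"
    and C \<alpha> q r \<sigma>\<^sub>1 \<sigma>\<^sub>2 :: real
  assumes "C > 0"
    and "0 < \<alpha>" and "\<alpha> < 2"
    and "q > (real CARD('n) + \<alpha>) / (real CARD('n) - \<alpha>)"
    and "r > (real CARD('n) + \<alpha>) / (real CARD('n) - \<alpha>)"
    and "\<sigma>\<^sub>1 = (real CARD('n) - \<alpha>) * q - (real CARD('n) + \<alpha>)"
    and "\<sigma>\<^sub>2 = (real CARD('n) - \<alpha>) * r - (real CARD('n) + \<alpha>)"
    and "u \<in> L_space \<alpha> \<inter> C11_loc"
    and "v \<in> L_space \<alpha> \<inter> C11_loc"
    and "\<And>x. frac_laplacian C \<alpha> u x = norm x powr \<sigma>\<^sub>1 * v x powr q"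
    and "\<And>x. frac_laplacian C \<alpha> v x = norm x powr \<sigma>\<^sub>2 * u x powr r"
    and "\<And>x. u x > 0"
    and "\<And>x. v x > 0"
    and "filterlim (\<lambda>x. norm x powr (real CARD('n) - \<alpha>) * u x) at_top at_infinity"
    and "filterlim (\<lambda>x. norm x powr (real CARD('n) - \<alpha>) * v x) at_top at_infinity"
  shows "radially_symmetric u \<and> radially_symmetric v"
proof (cases "\<alpha> < real CARD('n)")
  case True
  let ?n = "real CARD('n)"
  note C = assms(1) and \<alpha> = assms(2,3) and \<sigma> = assms(6,7) and u = assms(8) and v = assms(9)
    and equ = assms(10) and eqv = assms(11) and posu = assms(12) and posv = assms(13)
    and limu = assms(14) and limv = assms(15)
  have quad: "quadratic_at u x" "quadratic_at v x" for x
    using u v C11_loc_quadratic_at by auto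
  have cont: "isCont u x" "isCont v x" for x
    using quad by (auto intro: quadratic_at_continuous)
  have exponent: "s > 1" "\<alpha> < (?n - \<alpha>) * (s - 1)" if "s > (?n + \<alpha>) / (?n - \<alpha>)" for s
  proof -
    have "?n + \<alpha> < (?n - \<alpha>) * s"
      using that True by (simp add: divide_less_eq mult.commute)
    then show "\<alpha> < (?n - \<alpha>) * (s - 1)"
      using \<alpha> by (simp add: algebra_simps)
    then have "0 < (?n - \<alpha>) * (s - 1)"
      using \<alpha> by simp
    then show "s > 1"
      using True by (simp add: zero_less_mult_iff)
  qed
  have dec: "(kelvin \<alpha> f \<longlongrightarrow> 0) at_infinity" if "isCont f 0" "\<And>x. f x > 0" for f :: "real ^ 'n \<Rightarrow> real"
  proof -
    have "((\<lambda>x. norm x powr 0 * kelvin \<alpha> f x powr 1) \<longlongrightarrow> 0) at_infinity"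
      using kelvin_power_at_infinity[OF \<alpha>(1) True that, of 1 0] True by simp
    moreover have "\<forall>\<^sub>F x :: real ^ 'n in at_infinity. norm x powr 0 * kelvin \<alpha> f x powr 1 = kelvin \<alpha> f x"
      unfolding eventually_at_infinity using that(2) by (intro exI[of _ 1]) (auto simp: kelvin_def less_imp_le)
    ultimately show ?thesis
      by (rule Lim_transform_eventually)
  qed
  interpret sys: singular_system \<alpha> q r "1 / C" "kelvin \<alpha> u" "kelvin \<alpha> v"
  proof
    show "((\<lambda>x. norm x powr \<alpha> * kelvin \<alpha> u x powr (r - 1)) \<longlongrightarrow> 0) at_infinity"
      using exponent[OF assms(5)] by (intro kelvin_power_at_infinity[OF \<alpha>(1) True cont(1) posu]) auto
    show "((\<lambda>x. norm x powr \<alpha> * kelvin \<alpha> v x powr (q - 1)) \<longlongrightarrow> 0) at_infinity"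
      using exponent[OF assms(4)] by (intro kelvin_power_at_infinity[OF \<alpha>(1) True cont(2) posv]) auto
  next
    fix x :: "real ^ 'n" assume x: "x \<noteq> 0"
    show "isCont (kelvin \<alpha> u) x" "isCont (kelvin \<alpha> v) x"
      using quadratic_at_kelvin[OF x] quad by (auto intro: quadratic_at_continuous)
    show "kelvin \<alpha> u x > 0" "kelvin \<alpha> v x > 0"
      using kelvin_pos[OF \<alpha>(1) True cont(1) posu x] kelvin_pos[OF \<alpha>(1) True cont(2) posv x] .
    show "has_pv \<alpha> (kelvin \<alpha> u) x (1 / C * kelvin \<alpha> v x powr q)"
      using kelvin_equation[OF u \<alpha> C _ x] equ \<sigma> by simp
    show "has_pv \<alpha> (kelvin \<alpha> v) x (1 / C * kelvin \<alpha> u x powr r)"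
      using kelvin_equation[OF v \<alpha> C _ x] eqv \<sigma> by simp
  qed (use \<alpha> C exponent(1) assms(4,5) u v L_space_kelvin dec cont posu posv
      kelvin_at_0[OF \<alpha>(1) True cont(1) posu limu] kelvin_at_0[OF \<alpha>(1) True cont(2) posv limv] in auto)
  show ?thesis
    using kelvin_radially_symmetric[OF \<alpha>(1) True cont(1) posu sys.radial]
      kelvin_radially_symmetric[OF \<alpha>(1) True cont(2) posv singular_system.radial[OF sys.swapped]] by blast
next
  case False
  have "filterlim u at_top at_infinity"
  proof (rule filterlim_at_top_mono[OF assms(14)])
    have "norm x powr (real CARD('n) - \<alpha>) * u x \<le> u x" if "norm x \<ge> 1" for x
    proof -
      have "norm x powr (real CARD('n) - \<alpha>) \<le> norm x powr 0"
        using that False by (intro powr_mono) auto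
      also have "\<dots> \<le> 1"
        by simp
      finally show ?thesis
        using that assms(12)[of x] mult_right_mono[of "norm x powr (real CARD('n) - \<alpha>)" 1 "u x"] by simp
    qed
    then show "\<forall>\<^sub>F x in at_infinity. norm x powr (real CARD('n) - \<alpha>) * u x \<le> u x"
      unfolding eventually_at_infinity by blast
  qed
  moreover have "frac_laplacian C \<alpha> u x \<ge> 0" for x
    by (simp add: assms(10))
  ultimately show ?thesis
    using no_blowup_solution[OF assms(8,2,3,1)] by blast
qed

end
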